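(* Let $G$ be a connected noncompact real semisimple Lie group with Lie algebra $\mathfrak g$ and let $\theta$ be a Cartan involution of $\mathfrak g$ with Cartan decomposition $\mathfrak g=\mathfrak k\oplus\mathfrak p$. Let $X\in\mathfrak g$ be a regular element whose stabilizer algebra $\mathfrak g_X$ is a $\theta$-stable, maximally noncompact Cartan subalgebra. Put $\mathfrak a=\mathfrak g_X\cap\mathfrak p$, let $\Sigma=\Sigma(\mathfrak g,\mathfrak a)$ be the restricted root system, choose positive restricted roots $\Sigma^+$, and let $\mathfrak n=\bigoplus_{\lambda\in\Sigma^+}\mathfrak g_\lambda$ be the nilpotent part of the corresponding Iwasawa decomposition $\mathfrak g=\mathfrak k\oplus\mathfrak n\oplus\mathfrak a$. Then the adjoint orbit $\Omega=Ad_G X$ admits a left-invariant foliation $\mathcal N$, isotropic with respect to the Kirillov symplectic form $\omega$, whose tangent space at $X$ is $\mathcal N_X=\mathfrak n$.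
   Context: $B$ is the Killing form of $\mathfrak g$, used to identify $\mathfrak g^*$ with $\mathfrak g$ and coadjoint orbits with adjoint orbits. An element $X\in\mathfrak g$ is regular if the coefficient of $\lambda^r$ in $\det(\lambda\mathbf 1-ad_X)$ is nonzero, where $r$ is the rank of $\mathfrak g$ (the dimension of any Cartan subalgebra). The stabilizer algebra is $\mathfrak g_X=\{Y\in\mathfrak g:[X,Y]=0\}$, which is a Cartan subalgebra for $X$ regular. A $\theta$-stable Cartan subalgebra $\mathfrak h$ is maximally noncompact if $\dim(\mathfrak h\cap\mathfrak p)$ is as large as possible among $\theta$-stable Cartan subalgebras (equivalently, $\mathfrak h\cap\mathfrak p$ is maximal abelian in $\mathfrak p$). Here $\mathfrak k,\mathfrak p$ are the $+1,-1$ eigenspaces of $\theta$; $\mathfrak g_\lambda$ is the restricted root space of $\lambda$. The tangent space $T_X\Omega=\{[U,X]:U\in\mathfrak g\}$ is identified with $\mathfrak g/\mathfrak g_X$ via $U\mapsto[U,X]$; a subspace $V\subset\mathfrak g$ with $V\cap\mathfrak g_X=0$ is regarded as the subspace $\{[U,X]:U\in V\}$ of $T_X\Omega$. The Kirillov form on $\Omega$ is the $G$-invariant symplectic form with $\omega_X([U,X],[V,X])=B(X,[U,V])$. A foliation of $\Omega$ is left-invariant if its tangent distribution is invariant under the transitive action of $G$ by $Ad$; it is isotropic if $\omega$ vanishes on its tangent spaces. *)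

theory Defs
  imports "HOL-Analysis.Analysis" "HOL-Algebra.Group" "HOL-Library.Disjoint_Sets"
begin
text \<open>
  \<open>Ck_on k S f\<close> is meant for open \<open>S\<close>.  In finite dimension, being \<open>C\<^sup>k\<^sup>+\<^sup>1\<close> is the same as being
  differentiable with all directional derivatives \<open>C\<^sup>k\<close>.
\<close>

primrec Ck_on ::
  "nat \<Rightarrow> 'a::euclidean_space set \<Rightarrow> ('a \<Rightarrow> 'b::euclidean_space) \<Rightarrow> bool" where
  "Ck_on 0 S f \<longleftrightarrow> continuous_on S f"
| "Ck_on (Suc k) S f \<longleftrightarrow>
     (\<exists>f'. (\<forall>x\<in>S. (f has_derivative f' x) (at x)) \<and> (\<forall>v. Ck_on k S (\<lambda>x. f' x v)))"

definition smooth_on :: "'a::euclidean_space set \<Rightarrow> ('a \<Rightarrow> 'b::euclidean_space) \<Rightarrow> bool" where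
  "smooth_on S f \<longleftrightarrow> (\<forall>k. Ck_on k S f)"

definition chart_on :: "'g topology \<Rightarrow> 'g set \<Rightarrow> ('g \<Rightarrow> 'a::euclidean_space) \<Rightarrow> bool" where
  "chart_on T U \<phi> \<longleftrightarrow> openin T U \<and> open (\<phi> ` U)
     \<and> homeomorphic_map (subtopology T U) (top_of_set (\<phi> ` U)) \<phi>"

definition smooth_atlas :: "'g topology \<Rightarrow> ('g set \<times> ('g \<Rightarrow> 'a::euclidean_space)) set \<Rightarrow> bool" where
  "smooth_atlas T \<A> \<longleftrightarrow>
     (\<Union>(U, \<phi>)\<in>\<A>. U) = topspace T
     \<and> (\<forall>(U, \<phi>)\<in>\<A>. chart_on T U \<phi>)
     \<and> (\<forall>(U, \<phi>)\<in>\<A>. \<forall>(V, \<psi>)\<in>\<A>. smooth_on (\<phi> ` (U \<inter> V)) (\<psi> \<circ> inv_into U \<phi>))"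

definition smooth_map ::
  "'g topology \<Rightarrow> ('g set \<times> ('g \<Rightarrow> 'a::euclidean_space)) set \<Rightarrow>
   'h topology \<Rightarrow> ('h set \<times> ('h \<Rightarrow> 'b::euclidean_space)) set \<Rightarrow> ('g \<Rightarrow> 'h) \<Rightarrow> bool" where
  "smooth_map T \<A> T' \<A>' f \<longleftrightarrow> continuous_map T T' f
     \<and> (\<forall>(U, \<phi>)\<in>\<A>. \<forall>(V, \<psi>)\<in>\<A>'. smooth_on (\<phi> ` (U \<inter> f -` V)) (\<psi> \<circ> f \<circ> inv_into U \<phi>))"

definition prod_atlas ::
  "('g set \<times> ('g \<Rightarrow> 'a)) set \<Rightarrow> ('h set \<times> ('h \<Rightarrow> 'b)) set \<Rightarrow>
   (('g \<times> 'h) set \<times> ('g \<times> 'h \<Rightarrow> 'a \<times> 'b)) set" where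
  "prod_atlas \<A> \<B> = {(U \<times> V, map_prod \<phi> \<psi>) | U \<phi> V \<psi>. (U, \<phi>) \<in> \<A> \<and> (V, \<psi>) \<in> \<B>}"

definition lie_group ::
  "('g, 'm) monoid_scheme \<Rightarrow> 'g topology \<Rightarrow> ('g set \<times> ('g \<Rightarrow> real ^ 'n::finite)) set \<Rightarrow> bool" where
  "lie_group G T \<A> \<longleftrightarrow>
     group G \<and> topspace T = carrier G \<and> Hausdorff_space T \<and> second_countable T
     \<and> smooth_atlas T \<A>
     \<and> smooth_map (prod_topology T T) (prod_atlas \<A> \<A>) T \<A> (\<lambda>(x, y). x \<otimes>\<^bsub>G\<^esub> y)
     \<and> smooth_map T \<A> T \<A> (\<lambda>x. inv\<^bsub>G\<^esub> x)"

text \<open>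
  A chart \<open>(U, \<phi>)\<close> of the atlas around the unit identifies the tangent space at the unit with the
  model space \<open>real ^ 'n\<close>, which thus becomes the Lie algebra of \<open>G\<close>.  \<open>Ad g\<close> is the differential
  at the unit of conjugation by \<open>g\<close>, and the bracket is \<open>[u, v] = ad u v\<close>, where \<open>ad\<close> is the
  differential at the unit of \<open>Ad\<close>.
\<close>

definition Ad ::
  "('g, 'm) monoid_scheme \<Rightarrow> 'g set \<Rightarrow> ('g \<Rightarrow> real ^ 'n::finite) \<Rightarrow> 'g \<Rightarrow> real ^ 'n \<Rightarrow> real ^ 'n" where
  "Ad G U \<phi> g =
     frechet_derivative (\<lambda>x. \<phi> (g \<otimes>\<^bsub>G\<^esub> inv_into U \<phi> x \<otimes>\<^bsub>G\<^esub> inv\<^bsub>G\<^esub> g)) (at (\<phi> \<one>\<^bsub>G\<^esub>))"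

definition lie_bracket ::
  "('g, 'm) monoid_scheme \<Rightarrow> 'g set \<Rightarrow> ('g \<Rightarrow> real ^ 'n::finite) \<Rightarrow>
   real ^ 'n \<Rightarrow> real ^ 'n \<Rightarrow> real ^ 'n" where
  "lie_bracket G U \<phi> u v =
     frechet_derivative (\<lambda>x. Ad G U \<phi> (inv_into U \<phi> x) v) (at (\<phi> \<one>\<^bsub>G\<^esub>)) u"

type_synonym 'n bracket = "real ^ 'n \<Rightarrow> real ^ 'n \<Rightarrow> real ^ 'n"

definition lie_subalgebra :: "'n::finite bracket \<Rightarrow> (real ^ 'n) set \<Rightarrow> bool" where
  "lie_subalgebra br h \<longleftrightarrow> subspace h \<and> (\<forall>x\<in>h. \<forall>y\<in>h. br x y \<in> h)"

definition lie_ideal :: "'n::finite bracket \<Rightarrow> (real ^ 'n) set \<Rightarrow> bool" where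
  "lie_ideal br I \<longleftrightarrow> subspace I \<and> (\<forall>x. \<forall>y\<in>I. br x y \<in> I)"

primrec derived_series :: "'n::finite bracket \<Rightarrow> (real ^ 'n) set \<Rightarrow> nat \<Rightarrow> (real ^ 'n) set" where
  "derived_series br h 0 = h"
| "derived_series br h (Suc k) =
     span {br x y | x y. x \<in> derived_series br h k \<and> y \<in> derived_series br h k}"

primrec lower_central_series ::
  "'n::finite bracket \<Rightarrow> (real ^ 'n) set \<Rightarrow> nat \<Rightarrow> (real ^ 'n) set" where
  "lower_central_series br h 0 = h"
| "lower_central_series br h (Suc k) =
     span {br x y | x y. x \<in> h \<and> y \<in> lower_central_series br h k}"

definition solvable_algebra :: "'n::finite bracket \<Rightarrow> (real ^ 'n) set \<Rightarrow> bool" where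
  "solvable_algebra br h \<longleftrightarrow> (\<exists>k. derived_series br h k = {0})"

definition nilpotent_algebra :: "'n::finite bracket \<Rightarrow> (real ^ 'n) set \<Rightarrow> bool" where
  "nilpotent_algebra br h \<longleftrightarrow> (\<exists>k. lower_central_series br h k = {0})"

definition semisimple_algebra :: "'n::finite bracket \<Rightarrow> bool" where
  "semisimple_algebra br \<longleftrightarrow> (\<forall>I. lie_ideal br I \<and> solvable_algebra br I \<longrightarrow> I = {0})"

definition killing :: "'n::finite bracket \<Rightarrow> real ^ 'n \<Rightarrow> real ^ 'n \<Rightarrow> real" where
  "killing br X Y = trace (matrix (br X \<circ> br Y))"

definition cartan_subalgebra :: "'n::finite bracket \<Rightarrow> (real ^ 'n) set \<Rightarrow> bool" where
  "cartan_subalgebra br h \<longleftrightarrow> lie_subalgebra br h \<and> nilpotent_algebra br h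
     \<and> {x. \<forall>y\<in>h. br x y \<in> h} = h"

definition lie_rank :: "'n::finite bracket \<Rightarrow> nat" where
  "lie_rank br = (THE r. \<exists>h. cartan_subalgebra br h \<and> dim h = r)"

text \<open>The polynomial \<open>det (\<lambda> 1 - f)\<close> in the indeterminate \<open>\<lambda> = [:0, 1:]\<close>.\<close>

definition char_polynomial :: "(real ^ 'n::finite \<Rightarrow> real ^ 'n) \<Rightarrow> real poly" where
  "char_polynomial f = det (\<chi> i j. (if i = j then [:0, 1:] else 0) - [:matrix f $ i $ j:])"

definition regular_element :: "'n::finite bracket \<Rightarrow> real ^ 'n \<Rightarrow> bool" where
  "regular_element br X \<longleftrightarrow> coeff (char_polynomial (br X)) (lie_rank br) \<noteq> 0"

definition stabilizer_algebra :: "'n::finite bracket \<Rightarrow> real ^ 'n \<Rightarrow> (real ^ 'n) set" where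
  "stabilizer_algebra br X = {Y. br X Y = 0}"

definition cartan_involution :: "'n::finite bracket \<Rightarrow> (real ^ 'n \<Rightarrow> real ^ 'n) \<Rightarrow> bool" where
  "cartan_involution br \<theta> \<longleftrightarrow> linear \<theta> \<and> (\<forall>x y. \<theta> (br x y) = br (\<theta> x) (\<theta> y))
     \<and> (\<forall>x. \<theta> (\<theta> x) = x) \<and> (\<forall>x. x \<noteq> 0 \<longrightarrow> - killing br x (\<theta> x) > 0)"

definition minus_eigenspace :: "(real ^ 'n::finite \<Rightarrow> real ^ 'n) \<Rightarrow> (real ^ 'n) set" where
  "minus_eigenspace \<theta> = {x. \<theta> x = - x}"

definition theta_stable_cartan ::
  "'n::finite bracket \<Rightarrow> (real ^ 'n \<Rightarrow> real ^ 'n) \<Rightarrow> (real ^ 'n) set \<Rightarrow> bool" where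
  "theta_stable_cartan br \<theta> h \<longleftrightarrow> cartan_subalgebra br h \<and> \<theta> ` h = h"

definition maximally_noncompact ::
  "'n::finite bracket \<Rightarrow> (real ^ 'n \<Rightarrow> real ^ 'n) \<Rightarrow> (real ^ 'n) set \<Rightarrow> bool" where
  "maximally_noncompact br \<theta> h \<longleftrightarrow> theta_stable_cartan br \<theta> h
     \<and> (\<forall>h'. theta_stable_cartan br \<theta> h' \<longrightarrow>
          dim (h' \<inter> minus_eigenspace \<theta>) \<le> dim (h \<inter> minus_eigenspace \<theta>))"

text \<open>
  Elements of the dual of the subspace \<open>a\<close> are represented by functions that are \<open>undefined\<close>
  outside \<open>a\<close>, so that a functional on \<open>a\<close> is represented exactly once.
\<close>

definition dual_on :: "(real ^ 'n::finite) set \<Rightarrow> (real ^ 'n \<Rightarrow> real) set" where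
  "dual_on a = {\<alpha> \<in> extensional a.
     (\<forall>x\<in>a. \<forall>y\<in>a. \<alpha> (x + y) = \<alpha> x + \<alpha> y) \<and> (\<forall>c. \<forall>x\<in>a. \<alpha> (c *\<^sub>R x) = c * \<alpha> x)}"

definition root_space ::
  "'n::finite bracket \<Rightarrow> (real ^ 'n) set \<Rightarrow> (real ^ 'n \<Rightarrow> real) \<Rightarrow> (real ^ 'n) set" where
  "root_space br a \<alpha> = {Y. \<forall>H\<in>a. br H Y = \<alpha> H *\<^sub>R Y}"

definition restricted_roots :: "'n::finite bracket \<Rightarrow> (real ^ 'n) set \<Rightarrow> (real ^ 'n \<Rightarrow> real) set" where
  "restricted_roots br a =
     {\<alpha> \<in> dual_on a. \<alpha> \<noteq> (\<lambda>H\<in>a. 0) \<and> root_space br a \<alpha> \<noteq> {0}}"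

text \<open>
  \<open>P\<close> is the set of positive elements for a total ordering of the dual of \<open>a\<close> compatible with the
  vector space structure; positive restricted roots are chosen by means of such an ordering.
\<close>

definition positivity_on :: "(real ^ 'n::finite) set \<Rightarrow> (real ^ 'n \<Rightarrow> real) set \<Rightarrow> bool" where
  "positivity_on a P \<longleftrightarrow> P \<subseteq> dual_on a \<and> (\<lambda>H\<in>a. 0) \<notin> P
     \<and> (\<forall>\<alpha>\<in>dual_on a. \<alpha> \<noteq> (\<lambda>H\<in>a. 0) \<longrightarrow> (\<alpha> \<in> P \<longleftrightarrow> (\<lambda>H\<in>a. - \<alpha> H) \<notin> P))
     \<and> (\<forall>\<alpha>\<in>P. \<forall>\<beta>\<in>P. (\<lambda>H\<in>a. \<alpha> H + \<beta> H) \<in> P)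
     \<and> (\<forall>\<alpha>\<in>P. \<forall>c>0. (\<lambda>H\<in>a. c * \<alpha> H) \<in> P)"

definition positive_restricted_roots ::
  "'n::finite bracket \<Rightarrow> (real ^ 'n) set \<Rightarrow> (real ^ 'n \<Rightarrow> real) set \<Rightarrow> bool" where
  "positive_restricted_roots br a \<Sigma>p \<longleftrightarrow>
     (\<exists>P. positivity_on a P \<and> \<Sigma>p = restricted_roots br a \<inter> P)"

definition nilpotent_part ::
  "'n::finite bracket \<Rightarrow> (real ^ 'n) set \<Rightarrow> (real ^ 'n \<Rightarrow> real) set \<Rightarrow> (real ^ 'n) set" where
  "nilpotent_part br a \<Sigma>p = span (\<Union>\<alpha>\<in>\<Sigma>p. root_space br a \<alpha>)"

text \<open>
  A foliated chart of the subset \<open>M\<close> (an embedded submanifold) with partition \<open>\<L>\<close> into leaves is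
  given by its inverse \<open>\<phi>\<close>, defined on the box \<open>A \<times> B\<close> formed by the unit balls of two subspaces
  \<open>E\<close> (leaf directions) and \<open>F\<close> (transversal directions); the subspaces play the role of Euclidean
  spaces of varying dimension, and \<open>\<phi>\<close> extends smoothly to the ambient open box.  \<open>\<phi>\<close> is an
  immersion along \<open>E \<times> F\<close> and a homeomorphism of the box onto an open subset of \<open>M\<close>, and the path
  components of the intersection of a leaf with this open subset are plaques \<open>\<phi> ` (A \<times> {b})\<close>.
\<close>

definition foliated_chart ::
  "(real ^ 'n::finite) set \<Rightarrow> (real ^ 'n) set set \<Rightarrow> (real ^ 'n) set \<Rightarrow> (real ^ 'n) set \<Rightarrow>
   ((real ^ 'n) \<times> (real ^ 'n) \<Rightarrow> real ^ 'n) \<Rightarrow> bool" where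
  "foliated_chart M \<L> E F \<phi> \<longleftrightarrow> subspace E \<and> subspace F
     \<and> smooth_on (ball 0 1 \<times> ball 0 1) \<phi>
     \<and> (let A = E \<inter> ball 0 1; B = F \<inter> ball 0 1; W = \<phi> ` (A \<times> B) in
          openin (top_of_set M) W
          \<and> homeomorphic_map (top_of_set (A \<times> B)) (top_of_set W) \<phi>
          \<and> (\<forall>z\<in>A \<times> B. inj_on (frechet_derivative \<phi> (at z)) (E \<times> F))
          \<and> (\<forall>L\<in>\<L>. \<forall>a\<in>A. \<forall>b\<in>B. \<phi> (a, b) \<in> L \<longrightarrow>
               path_component_set (L \<inter> W) (\<phi> (a, b)) = \<phi> ` (A \<times> {b})))"

definition foliation ::
  "nat \<Rightarrow> (real ^ 'n::finite) set \<Rightarrow> (real ^ 'n) set set \<Rightarrow> bool" where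
  "foliation d M \<L> \<longleftrightarrow> partition_on M \<L> \<and> (\<forall>L\<in>\<L>. path_connected L)
     \<and> (\<forall>y\<in>M. \<exists>E F \<phi>. foliated_chart M \<L> E F \<phi> \<and> dim E = d
          \<and> y \<in> \<phi> ` ((E \<inter> ball 0 1) \<times> (F \<inter> ball 0 1)))"

text \<open>
  The tangent space at \<open>y\<close> to the leaf through \<open>y\<close>, as the set of velocities of smooth curves
  contained in that leaf.  By the condition on path components, a curve in a leaf stays locally in
  one plaque, so these are exactly the tangent vectors of the plaque.
\<close>

definition leaf_tangent ::
  "(real ^ 'n::finite) set set \<Rightarrow> real ^ 'n \<Rightarrow> (real ^ 'n) set" where
  "leaf_tangent \<L> y = {v. \<exists>L\<in>\<L>. \<exists>\<epsilon>>0. \<exists>\<gamma>.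
     smooth_on {-\<epsilon><..<\<epsilon>} \<gamma> \<and> \<gamma> ` {-\<epsilon><..<\<epsilon>} \<subseteq> L \<and> \<gamma> 0 = y
     \<and> (\<gamma> has_vector_derivative v) (at (0::real))}"

definition adjoint_orbit ::
  "('g, 'm) monoid_scheme \<Rightarrow> ('g \<Rightarrow> real ^ 'n::finite \<Rightarrow> real ^ 'n) \<Rightarrow> real ^ 'n \<Rightarrow> (real ^ 'n) set" where
  "adjoint_orbit G AdG X = (\<lambda>g. AdG g X) ` carrier G"

definition left_invariant_foliation ::
  "('g, 'm) monoid_scheme \<Rightarrow> ('g \<Rightarrow> real ^ 'n::finite \<Rightarrow> real ^ 'n) \<Rightarrow> (real ^ 'n) set \<Rightarrow>
   (real ^ 'n) set set \<Rightarrow> bool" where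
  "left_invariant_foliation G AdG \<Omega> \<L> \<longleftrightarrow>
     (\<forall>g\<in>carrier G. \<forall>y\<in>\<Omega>. leaf_tangent \<L> (AdG g y) = AdG g ` leaf_tangent \<L> y)"

text \<open>
  The Kirillov form at the point \<open>Y\<close> of an orbit, with \<open>\<omega>\<^sub>Y ([U, Y], [V, Y]) = B (Y, [U, V])\<close>; it is
  only meaningful on tangent vectors to the orbit at \<open>Y\<close>, i.e. on vectors of the form \<open>[U, Y]\<close>.
\<close>

definition kirillov_form ::
  "'n::finite bracket \<Rightarrow> real ^ 'n \<Rightarrow> real ^ 'n \<Rightarrow> real ^ 'n \<Rightarrow> real" where
  "kirillov_form br Y \<xi> \<eta> =
     (THE c. \<exists>U V. \<xi> = br U Y \<and> \<eta> = br V Y \<and> c = killing br Y (br U V))"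

definition isotropic_foliation ::
  "'n::finite bracket \<Rightarrow> (real ^ 'n) set \<Rightarrow> (real ^ 'n) set set \<Rightarrow> bool" where
  "isotropic_foliation br \<Omega> \<L> \<longleftrightarrow>
     (\<forall>y\<in>\<Omega>. \<forall>\<xi>\<in>leaf_tangent \<L> y. \<forall>\<eta>\<in>leaf_tangent \<L> y. kirillov_form br y \<xi> \<eta> = 0)"

end

theory Submission
  imports Defs "HOL-Complex_Analysis.Complex_Analysis"
begin

text \<open>
  The leaves are the sets \<open>S (X + \<nn>)\<close>, where \<open>S\<close> ranges over \<open>Ad G\<close>, the group generated by all
  \<open>exp (ad Y)\<close>.  Since \<open>ad (X + V)\<close> is injective on \<open>\<nn>\<close> for all \<open>V \<in> \<nn>\<close>, the group
  generated by \<open>exp (ad \<nn>)\<close> has open orbits in the connected set \<open>X + \<nn>\<close>, hence acts transitively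
  on it, so these sets lie in the orbit.  They form a partition because an inner automorphism that fixes
  \<open>X\<close> fixes its Cartan subalgebra \<open>\<hh>\<close> pointwise, and therefore preserves every restricted root
  space.  This fact is proved by joining such an automorphism, times a generic \<open>exp (t ad X)\<close>, to
  \<open>exp (t ad X)\<close> along an analytic path: near the latter the space of fixed vectors has dimension
  at least \<open>dim \<hh>\<close>, and a lower bound of this kind persists along the path.  Finally \<open>X\<close> is
  isolated in the intersection of the orbit with \<open>\<hh>\<close>, which shows that the orbit is an embedded
  submanifold and supplies the foliated charts.  Isotropy holds because
  \<open>B (X, [\<nn>, \<nn>]) \<subseteq> B (\<hh>, \<nn>) = 0\<close>.
\<close>

section \<open>Smooth maps\<close>

text \<open>Invariance forces the tangent space at \<open>S X\<close> to be \<open>S\<close> applied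
  to \<nn>, so everything hinges on every inner automorphism that fixes \<open>X\<close> preserving
  \<nn>. The stabilizer of \<open>X\<close> may be disconnected, and its Lie algebra alone cannot
  decide this; hence a global argument. The dimension of a fixed space is not an analytic quantity,
  so the condition on it becomes the vanishing of a determinant, after adding a fixed operator
  \<open>R\<close> adapted to the end of the path. One local tool serves three times: nondegeneracy
  of the Killing form makes all derivations inner, so a family of automorphisms whose logarithmic
  derivative is onto contains all automorphisms near its base point. It places \<open>Ad g\<close>
  for small \<open>g\<close> among the exponentials, places small exponentials in the image of
  \<open>Ad\<close>, and gives the conjugacy near \<open>exp (t ad X)\<close>. The leaves are affine
  subspaces. They are therefore convex, and straight lines inside a leaf realize all of its tangent
  vectors.\<close>

lemma Ck_on_SucI:
  assumes "\<And>x. x \<in> S \<Longrightarrow> (f has_derivative f' x) (at x)" "\<And>v. Ck_on k S (\<lambda>x. f' x v)"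
  shows "Ck_on (Suc k) S f"
  using assms by auto

lemma Ck_on_SucE:
  assumes "Ck_on (Suc k) S f"
  obtains f' where "\<And>x. x \<in> S \<Longrightarrow> (f has_derivative f' x) (at x)" "\<And>v. Ck_on k S (\<lambda>x. f' x v)"
  using assms by auto

lemma Ck_on_subset: "Ck_on k S f \<Longrightarrow> S' \<subseteq> S \<Longrightarrow> Ck_on k S' f"
proof (induction k arbitrary: f)
  case 0
  then show ?case by (auto intro: continuous_on_subset)
next
  case (Suc k)
  then obtain f' where "\<forall>x\<in>S. (f has_derivative f' x) (at x)" "\<forall>v. Ck_on k S (\<lambda>x. f' x v)"
    by auto
  then have "\<forall>x\<in>S'. (f has_derivative f' x) (at x)" "\<forall>v. Ck_on k S' (\<lambda>x. f' x v)"
    using Suc by auto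
  then show ?case by auto
qed

lemma Ck_on_cong:
  assumes "open S" "\<And>x. x \<in> S \<Longrightarrow> f x = g x"
  shows "Ck_on k S f \<Longrightarrow> Ck_on k S g"
proof (cases k)
  case 0
  assume "Ck_on k S f"
  then show ?thesis using 0 assms(2) by (simp cong: continuous_on_cong)
next
  case (Suc j)
  assume "Ck_on k S f"
  then obtain f' where f': "\<forall>x\<in>S. (f has_derivative f' x) (at x)" "\<forall>v. Ck_on j S (\<lambda>x. f' x v)"
    using Suc by auto
  have "\<forall>x\<in>S. (g has_derivative f' x) (at x)"
    using f'(1) assms by (auto intro: has_derivative_transform_within_open)
  then show ?thesis using f'(2) Suc by auto
qed

lemma Ck_on_Suc_imp: "Ck_on (Suc k) S f \<Longrightarrow> Ck_on k S f"
proof (induction k arbitrary: f)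
  case 0
  then obtain f' where "\<And>x. x \<in> S \<Longrightarrow> (f has_derivative f' x) (at x)"
    by (rule Ck_on_SucE) (rule that)
  then show ?case by (auto intro!: continuous_at_imp_continuous_on dest: has_derivative_continuous)
next
  case (Suc k)
  then obtain f' where f': "\<forall>x\<in>S. (f has_derivative f' x) (at x)"
      "\<forall>v. Ck_on (Suc k) S (\<lambda>x. f' x v)"
    by auto
  then have "\<forall>v. Ck_on k S (\<lambda>x. f' x v)" using Suc.IH by blast
  with f'(1) show ?case by auto
qed

lemma Ck_on_const: "Ck_on k S (\<lambda>_. c)"
proof (induction k arbitrary: c)
  case (Suc k)
  then show ?case by (auto intro!: exI[of _ "\<lambda>_ _. 0"])
qed simp

lemma Ck_on_linear: "linear L \<Longrightarrow> Ck_on k S L"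
proof (cases k)
  case (Suc j)
  assume "linear L"
  then have "\<forall>x\<in>S. (L has_derivative L) (at x)"
    by (simp add: linear_conv_bounded_linear bounded_linear_imp_has_derivative)
  then show ?thesis using Suc by (auto intro!: exI[of _ "\<lambda>_. L"] Ck_on_const)
qed (simp add: linear_continuous_on linear_conv_bounded_linear)

lemma Ck_on_compose_linear:
  assumes "linear L"
  shows "Ck_on k S f \<Longrightarrow> Ck_on k S (\<lambda>x. L (f x))"
proof (induction k arbitrary: f)
  case 0
  have "continuous_on S (L \<circ> f)"
    using 0 assms by (intro continuous_on_compose) (auto simp: linear_continuous_on linear_conv_bounded_linear)
  then show ?case by (simp add: o_def)
next
  case (Suc k)
  from Suc.prems(1) obtain f' where f': "\<And>x. x \<in> S \<Longrightarrow> (f has_derivative f' x) (at x)"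
      "\<And>v. Ck_on k S (\<lambda>x. f' x v)"
    by (rule Ck_on_SucE) (rule that)
  have "\<And>x. x \<in> S \<Longrightarrow> ((\<lambda>x. L (f x)) has_derivative (\<lambda>v. L (f' x v))) (at x)"
    using f'(1) assms by (auto simp: linear_conv_bounded_linear intro: bounded_linear.has_derivative)
  moreover have "\<And>v. Ck_on k S (\<lambda>x. L (f' x v))" using Suc.IH f'(2) by blast
  ultimately show ?case by (rule Ck_on_SucI)
qed

lemma Ck_on_add:
  "Ck_on k S f \<Longrightarrow> Ck_on k S g \<Longrightarrow> Ck_on k S (\<lambda>x. f x + g x)"
proof (induction k arbitrary: f g)
  case 0
  then show ?case by (simp add: continuous_on_add)
next
  case (Suc k)
  from Suc.prems(1) obtain f' where f': "\<And>x. x \<in> S \<Longrightarrow> (f has_derivative f' x) (at x)"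
      "\<And>v. Ck_on k S (\<lambda>x. f' x v)"
    by (rule Ck_on_SucE) (rule that)
  from Suc.prems(2) obtain g' where g': "\<And>x. x \<in> S \<Longrightarrow> (g has_derivative g' x) (at x)"
      "\<And>v. Ck_on k S (\<lambda>x. g' x v)"
    by (rule Ck_on_SucE) (rule that)
  have "\<And>x. x \<in> S \<Longrightarrow> ((\<lambda>x. f x + g x) has_derivative (\<lambda>v. f' x v + g' x v)) (at x)"
    using f'(1) g'(1) by (auto intro: has_derivative_add)
  moreover have "\<And>v. Ck_on k S (\<lambda>x. f' x v + g' x v)" using Suc.IH f'(2) g'(2) by blast
  ultimately show ?case by (rule Ck_on_SucI)
qed

lemma Ck_on_sum:
  "(\<And>i. i \<in> I \<Longrightarrow> Ck_on k S (f i)) \<Longrightarrow> Ck_on k S (\<lambda>x. \<Sum>i\<in>I. f i x)"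
proof (induction I rule: infinite_finite_induct)
  case (insert j I)
  have "Ck_on k S (\<lambda>x. f j x + (\<Sum>i\<in>I. f i x))"
    using insert.prems insert.IH by (intro Ck_on_add) simp_all
  then show ?case using insert.hyps by simp
qed (simp_all add: Ck_on_const)

lemma Ck_on_scaleR:
  fixes f :: "'a::euclidean_space \<Rightarrow> real"
  shows "Ck_on k S f \<Longrightarrow> Ck_on k S g \<Longrightarrow> Ck_on k S (\<lambda>x. f x *\<^sub>R g x)"
proof (induction k arbitrary: f g)
  case 0
  then show ?case by (simp add: continuous_on_scaleR)
next
  case (Suc k)
  from Suc.prems(1) obtain f' where f': "\<And>x. x \<in> S \<Longrightarrow> (f has_derivative f' x) (at x)"
      "\<And>v. Ck_on k S (\<lambda>x. f' x v)"
    by (rule Ck_on_SucE) (rule that)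
  from Suc.prems(2) obtain g' where g': "\<And>x. x \<in> S \<Longrightarrow> (g has_derivative g' x) (at x)"
      "\<And>v. Ck_on k S (\<lambda>x. g' x v)"
    by (rule Ck_on_SucE) (rule that)
  have "\<And>x. x \<in> S \<Longrightarrow> ((\<lambda>x. f x *\<^sub>R g x) has_derivative (\<lambda>v. f x *\<^sub>R g' x v + f' x v *\<^sub>R g x)) (at x)"
    using f'(1) g'(1) by (auto intro: has_derivative_scaleR)
  moreover have "\<And>v. Ck_on k S (\<lambda>x. f x *\<^sub>R g' x v + f' x v *\<^sub>R g x)"
    by (intro Ck_on_add Suc.IH f'(2) g'(2) Ck_on_Suc_imp[OF Suc.prems(1)] Ck_on_Suc_imp[OF Suc.prems(2)])
  ultimately show ?case by (rule Ck_on_SucI)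
qed

lemma Ck_on_compose:
  assumes S: "open S"
  shows "Ck_on k S f \<Longrightarrow> Ck_on k R g \<Longrightarrow> f ` S \<subseteq> R \<Longrightarrow> Ck_on k S (\<lambda>x. g (f x))"
proof (induction k arbitrary: g)
  case 0
  then show ?case by (auto intro: continuous_on_compose2)
next
  case (Suc k)
  from Suc.prems(1) obtain f' where f': "\<And>x. x \<in> S \<Longrightarrow> (f has_derivative f' x) (at x)"
      "\<And>v. Ck_on k S (\<lambda>x. f' x v)"
    by (rule Ck_on_SucE) (rule that)
  from Suc.prems(2) obtain g' where g': "\<And>x. x \<in> R \<Longrightarrow> (g has_derivative g' x) (at x)"
      "\<And>v. Ck_on k R (\<lambda>x. g' x v)"
    by (rule Ck_on_SucE) (rule that)
  have 1: "\<And>x. x \<in> S \<Longrightarrow> ((\<lambda>x. g (f x)) has_derivative (\<lambda>v. g' (f x) (f' x v))) (at x)"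
  proof -
    fix x assume "x \<in> S"
    then have "f x \<in> R" using Suc.prems by auto
    then show "((\<lambda>x. g (f x)) has_derivative (\<lambda>v. g' (f x) (f' x v))) (at x)"
      using f'(1) g'(1) \<open>x \<in> S\<close> has_derivative_compose by blast
  qed
  have f: "Ck_on k S f" using Suc.prems(1) by (rule Ck_on_Suc_imp)
  \<comment> \<open>The induction hypothesis covers \<open>g' (f x)\<close> only in a fixed
    direction. The direction \<open>f' x v\<close> moves with \<open>x\<close>, so it is expanded in
    the basis and linearity of \<open>g' (f x)\<close> is used.\<close>
  have 2: "Ck_on k S (\<lambda>x. g' (f x) (f' x v))" for v
  proof -
    have "Ck_on k S (\<lambda>x. \<Sum>b\<in>Basis. (f' x v \<bullet> b) *\<^sub>R g' (f x) b)"
    proof (intro Ck_on_sum Ck_on_scaleR)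
      fix b :: 'b
      have "linear (\<lambda>w::'b. w \<bullet> b)" by (simp add: linear_iff inner_add_left)
      then show "Ck_on k S (\<lambda>x. f' x v \<bullet> b)"
        using Ck_on_compose_linear f'(2) by blast
      show "Ck_on k S (\<lambda>x. g' (f x) b)"
        using Suc.IH[OF f] g'(2) Suc.prems(3) by blast
    qed
    moreover have "(\<Sum>b\<in>Basis. (f' x v \<bullet> b) *\<^sub>R g' (f x) b) = g' (f x) (f' x v)" if "x \<in> S" for x
    proof -
      have "f x \<in> R" using that Suc.prems by auto
      then have "linear (g' (f x))" using g'(1) has_derivative_linear by blast
      then have "(\<Sum>b\<in>Basis. (f' x v \<bullet> b) *\<^sub>R g' (f x) b) = g' (f x) (\<Sum>b\<in>Basis. (f' x v \<bullet> b) *\<^sub>R b)"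
        by (simp add: linear_sum linear_scale)
      then show ?thesis by (simp add: euclidean_representation)
    qed
    ultimately show ?thesis
      by (rule Ck_on_cong[OF S, rotated])
  qed
  from 1 this show ?case by (rule Ck_on_SucI)
qed

lemma Ck_on_Pair:
  assumes "Ck_on k S f" "Ck_on k S g"
  shows "Ck_on k S (\<lambda>x. (f x, g x))"
proof -
  have l: "linear (\<lambda>a::'b. (a, 0::'c))" "linear (\<lambda>b::'c. (0::'b, b))"
    by (auto simp: linear_iff)
  have "Ck_on k S (\<lambda>x. (f x, 0) + (0, g x))"
    by (intro Ck_on_add Ck_on_compose_linear[OF l(1)] Ck_on_compose_linear[OF l(2)] assms)
  then show ?thesis by simp
qed

lemma smooth_on_has_derivative:
  assumes "smooth_on S f" "x \<in> S"
  shows "(f has_derivative frechet_derivative f (at x)) (at x)"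
proof -
  have "Ck_on (Suc 0) S f" using assms by (simp add: smooth_on_def)
  then obtain f' where "\<And>x. x \<in> S \<Longrightarrow> (f has_derivative f' x) (at x)"
    by (rule Ck_on_SucE) (rule that)
  then show ?thesis using assms(2) frechet_derivative_works differentiableI by blast
qed

lemma smooth_on_derivative:
  assumes "smooth_on S f" "open S"
  shows "smooth_on S (\<lambda>x. frechet_derivative f (at x) v)"
  unfolding smooth_on_def
proof
  fix k
  have "Ck_on (Suc k) S f" using assms by (simp add: smooth_on_def)
  then obtain f' where f': "\<And>x. x \<in> S \<Longrightarrow> (f has_derivative f' x) (at x)"
      "\<And>v. Ck_on k S (\<lambda>x. f' x v)"
    by (rule Ck_on_SucE) (rule that)
  have "f' x v = frechet_derivative f (at x) v" if "x \<in> S" for x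
    using f'(1)[OF that] frechet_derivative_at by metis
  then show "Ck_on k S (\<lambda>x. frechet_derivative f (at x) v)"
    by (rule Ck_on_cong[OF assms(2) _ f'(2)[of v]])
qed

lemma smooth_on_subset:
  assumes "smooth_on S f" "S' \<subseteq> S"
  shows "smooth_on S' f"
  unfolding smooth_on_def
proof
  show "Ck_on k S' f" for k
    by (rule Ck_on_subset[of k S]) (use assms in \<open>simp_all add: smooth_on_def\<close>)
qed

lemma smooth_on_cong:
  assumes "open S" "\<And>x. x \<in> S \<Longrightarrow> f x = g x" "smooth_on S f"
  shows "smooth_on S g"
  unfolding smooth_on_def
proof
  show "Ck_on k S g" for k
    by (rule Ck_on_cong[OF assms(1,2)]) (use assms(3) in \<open>simp_all add: smooth_on_def\<close>)
qed

lemma smooth_on_compose: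
  assumes "open S" "smooth_on S f" "smooth_on R g" "f ` S \<subseteq> R"
  shows "smooth_on S (\<lambda>x. g (f x))"
  unfolding smooth_on_def
proof
  show "Ck_on k S (\<lambda>x. g (f x))" for k
    by (rule Ck_on_compose[OF assms(1) _ _ assms(4)]) (use assms(2,3) in \<open>simp_all add: smooth_on_def\<close>)
qed

lemma smooth_on_linear: "linear L \<Longrightarrow> smooth_on S L"
  by (simp add: smooth_on_def Ck_on_linear)

lemma smooth_on_const: "smooth_on S (\<lambda>_. c)"
  by (simp add: smooth_on_def Ck_on_const)

lemma smooth_on_Pair:
  assumes "smooth_on S f" "smooth_on S g"
  shows "smooth_on S (\<lambda>x. (f x, g x))"
  unfolding smooth_on_def
proof
  show "Ck_on k S (\<lambda>x. (f x, g x))" for k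
    by (rule Ck_on_Pair) (use assms in \<open>simp_all add: smooth_on_def\<close>)
qed

lemma smooth_on_add:
  assumes "smooth_on S f" "smooth_on S g"
  shows "smooth_on S (\<lambda>x. f x + g x)"
  unfolding smooth_on_def
proof
  show "Ck_on k S (\<lambda>x. f x + g x)" for k
    by (rule Ck_on_add) (use assms in \<open>simp_all add: smooth_on_def\<close>)
qed

lemma smooth_on_scaleR:
  fixes f :: "'a::euclidean_space \<Rightarrow> real"
  assumes "smooth_on S f" "smooth_on S g"
  shows "smooth_on S (\<lambda>x. f x *\<^sub>R g x)"
  unfolding smooth_on_def
proof
  show "Ck_on k S (\<lambda>x. f x *\<^sub>R g x)" for k
    by (rule Ck_on_scaleR) (use assms in \<open>simp_all add: smooth_on_def\<close>)
qed

lemma smooth_on_sum: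
  assumes "\<And>i. i \<in> A \<Longrightarrow> smooth_on S (f i)"
  shows "smooth_on S (\<lambda>x. \<Sum>i\<in>A. f i x)"
  unfolding smooth_on_def
proof
  show "Ck_on k S (\<lambda>x. \<Sum>i\<in>A. f i x)" for k
    by (rule Ck_on_sum) (use assms in \<open>simp add: smooth_on_def\<close>)
qed

lemma smooth_on_compose_linear:
  assumes "linear L" "smooth_on S f"
  shows "smooth_on S (\<lambda>x. L (f x))"
  unfolding smooth_on_def
proof
  show "Ck_on k S (\<lambda>x. L (f x))" for k
    by (rule Ck_on_compose_linear[OF assms(1)]) (use assms(2) in \<open>simp add: smooth_on_def\<close>)
qed

lemma smooth_on_imp_continuous_on:
  assumes "smooth_on S f"
  shows "continuous_on S f"
proof -
  have "Ck_on 0 S f" using assms unfolding smooth_on_def by blast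
  then show ?thesis by simp
qed

section \<open>The adjoint representation of a Lie group\<close>

locale lie_group_chart =
  fixes G :: "('g, 'm) monoid_scheme" (structure)
    and T :: "'g topology"
    and \<A> :: "('g set \<times> ('g \<Rightarrow> real ^ 'n::finite)) set"
    and U :: "'g set" and \<phi> :: "'g \<Rightarrow> real ^ 'n"
  assumes lie: "lie_group G T \<A>"
    and chart: "(U, \<phi>) \<in> \<A>"
    and one_in: "\<one> \<in> U"
begin

definition "x\<^sub>0 = \<phi> \<one>"
definition "D = \<phi> ` U"
abbreviation "\<sigma> \<equiv> inv_into U \<phi>"
abbreviation "Ad' \<equiv> Ad G U \<phi>"
abbreviation "br \<equiv> lie_bracket G U \<phi>"

sublocale group G
  using lie by (simp add: lie_group_def)

lemma topspace: "topspace T = carrier G"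
  using lie by (simp add: lie_group_def)

lemma chart_on: "openin T U" "open D" "homeomorphic_map (subtopology T U) (top_of_set D) \<phi>"
proof -
  have "chart_on T U \<phi>"
    using lie chart by (force simp: lie_group_def smooth_atlas_def)
  then show "openin T U" "open D" "homeomorphic_map (subtopology T U) (top_of_set D) \<phi>"
    by (auto simp: chart_on_def D_def)
qed

lemma U_carrier: "U \<subseteq> carrier G"
  using chart_on(1) openin_subset topspace by blast

lemma inj_phi: "inj_on \<phi> U"
proof -
  have "topspace (subtopology T U) = U"
    using U_carrier topspace by auto
  then show ?thesis
    using homeomorphic_imp_injective_map[OF chart_on(3)] by simp
qed

lemma sigma_in: "x \<in> D \<Longrightarrow> \<sigma> x \<in> U"
  by (simp add: D_def inv_into_into)

lemma sigma_carrier: "x \<in> D \<Longrightarrow> \<sigma> x \<in> carrier G"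
  using sigma_in U_carrier by blast

lemma phi_sigma: "x \<in> D \<Longrightarrow> \<phi> (\<sigma> x) = x"
  by (simp add: D_def f_inv_into_f)

lemma sigma_phi: "u \<in> U \<Longrightarrow> \<sigma> (\<phi> u) = u"
  using inj_phi by simp

lemma x0_in: "x\<^sub>0 \<in> D"
  using one_in by (simp add: x\<^sub>0_def D_def)

lemma sigma_x0: "\<sigma> x\<^sub>0 = \<one>"
  by (simp add: x\<^sub>0_def sigma_phi one_in)

lemma continuous_sigma: "continuous_map (top_of_set D) T \<sigma>"
proof -
  obtain g where g: "homeomorphic_maps (subtopology T U) (top_of_set D) \<phi> g"
    using chart_on(3) homeomorphic_map_maps by blast
  then have cg: "continuous_map (top_of_set D) (subtopology T U) g"
    by (simp add: homeomorphic_maps_def)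
  have "g x = \<sigma> x" if "x \<in> D" for x
  proof -
    have "\<phi> (g x) = x" using g that by (simp add: homeomorphic_maps_def)
    moreover have "g x \<in> U" using cg that by (auto simp: continuous_map_def)
    ultimately show ?thesis using sigma_phi by metis
  qed
  then have "continuous_map (top_of_set D) (subtopology T U) \<sigma>"
    using cg by (auto intro: continuous_map_eq)
  then show ?thesis by (simp add: continuous_map_in_subtopology)
qed

lemma continuous_mult:
  assumes "continuous_map Z T f" "continuous_map Z T g"
  shows "continuous_map Z T (\<lambda>z. f z \<otimes> g z)"
proof -
  have 1: "continuous_map (prod_topology T T) T (\<lambda>(x, y). x \<otimes> y)"
    using lie by (simp add: lie_group_def smooth_map_def)
  have 2: "continuous_map Z (prod_topology T T) (\<lambda>z. (f z, g z))"
    using assms by (simp add: continuous_map_pairedI)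
  show ?thesis
    using continuous_map_compose[OF 2 1] by (simp add: o_def)
qed

lemma continuous_inv:
  assumes "continuous_map Z T f"
  shows "continuous_map Z T (\<lambda>z. inv (f z))"
proof -
  have "continuous_map T T (\<lambda>x. inv x)"
    using lie by (simp add: lie_group_def smooth_map_def)
  then show ?thesis
    using continuous_map_compose[OF assms, of T "\<lambda>x. inv x"] by (simp add: o_def)
qed

lemma continuous_sigma_comp:
  assumes "continuous_on S f" "f ` S \<subseteq> D"
  shows "continuous_map (top_of_set S) T (\<lambda>x. \<sigma> (f x))"
proof -
  have "continuous_map (top_of_set S) (top_of_set D) f"
    using assms by (auto simp: continuous_map_in_subtopology)
  from continuous_map_compose[OF this continuous_sigma] show ?thesis
    by (simp add: o_def)
qed

lemma open_preimage_U:
  assumes "open S" "continuous_map (top_of_set S) T f"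
  shows "open {x \<in> S. f x \<in> U}"
  using openin_continuous_map_preimage[OF assms(2) chart_on(1)] assms(1)
    openin_open_eq by auto

section \<open>Multiplication, inversion and conjugation in chart coordinates\<close>

definition "Mdom = {z \<in> D \<times> D. \<sigma> (fst z) \<otimes> \<sigma> (snd z) \<in> U}"
definition "Idom = {x \<in> D. inv (\<sigma> x) \<in> U}"
definition "M = (\<lambda>z. \<phi> (\<sigma> (fst z) \<otimes> \<sigma> (snd z)))"
definition "I = (\<lambda>x. \<phi> (inv (\<sigma> x)))"
definition "c = (\<lambda>z. \<phi> (\<sigma> (fst z) \<otimes> \<sigma> (snd z) \<otimes> inv (\<sigma> (fst z))))"
text \<open>The intermediate product and the inverse must lie in the chart as well, so that on this
  set \<open>c\<close> is a composition of \<open>M\<close> and \<open>I\<close> and inherits their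
  smoothness.\<close>

definition "cdom = {z \<in> Mdom. fst z \<in> Idom \<and> \<sigma> (fst z) \<otimes> \<sigma> (snd z) \<otimes> inv (\<sigma> (fst z)) \<in> U}"

lemma open_DD: "open (D \<times> D)"
  by (simp add: chart_on(2) open_Times)

lemma continuous_fst_snd:
  "continuous_map (top_of_set (D \<times> D)) T (\<lambda>z. \<sigma> (fst z))"
  "continuous_map (top_of_set (D \<times> D)) T (\<lambda>z. \<sigma> (snd z))"
  by (auto intro!: continuous_sigma_comp continuous_intros)

lemma open_Mdom: "open Mdom"
  unfolding Mdom_def
  by (intro open_preimage_U open_DD continuous_mult continuous_fst_snd)

lemma open_Idom: "open Idom"
  unfolding Idom_def
  by (intro open_preimage_U chart_on(2) continuous_inv continuous_sigma)

lemma open_cdom: "open cdom"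
proof -
  have "cdom = Mdom \<inter> (Idom \<times> UNIV) \<inter>
      {z \<in> D \<times> D. \<sigma> (fst z) \<otimes> \<sigma> (snd z) \<otimes> inv (\<sigma> (fst z)) \<in> U}"
    by (auto simp: cdom_def Mdom_def)
  moreover have "open {z \<in> D \<times> D. \<sigma> (fst z) \<otimes> \<sigma> (snd z) \<otimes> inv (\<sigma> (fst z)) \<in> U}"
    by (intro open_preimage_U open_DD continuous_mult continuous_inv continuous_fst_snd)
  ultimately show ?thesis
    by (simp add: open_Int open_Mdom open_Idom open_Times)
qed

lemma smooth_M: "smooth_on Mdom M"
proof -
  have "smooth_map (prod_topology T T) (prod_atlas \<A> \<A>) T \<A> (\<lambda>(x, y). x \<otimes> y)"
    using lie by (simp add: lie_group_def)
  moreover have "(U \<times> U, map_prod \<phi> \<phi>) \<in> prod_atlas \<A> \<A>"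
    using chart by (auto simp: prod_atlas_def)
  ultimately have s: "smooth_on (map_prod \<phi> \<phi> ` (U \<times> U \<inter> (\<lambda>(x, y). x \<otimes> y) -` U))
      (\<phi> \<circ> (\<lambda>(x, y). x \<otimes> y) \<circ> inv_into (U \<times> U) (map_prod \<phi> \<phi>))"
    using chart unfolding smooth_map_def by blast
  have inv: "inv_into (U \<times> U) (map_prod \<phi> \<phi>) (x, y) = (\<sigma> x, \<sigma> y)" if "x \<in> D" "y \<in> D" for x y
  proof (rule inv_into_f_eq)
    show "inj_on (map_prod \<phi> \<phi>) (U \<times> U)"
      using inj_phi by (simp add: map_prod_inj_on)
  qed (use that sigma_in phi_sigma in auto)
  have dom: "map_prod \<phi> \<phi> ` (U \<times> U \<inter> (\<lambda>(x, y). x \<otimes> y) -` U) = Mdom"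
  proof (intro Set.set_eqI iffI)
    fix z assume "z \<in> map_prod \<phi> \<phi> ` (U \<times> U \<inter> (\<lambda>(x, y). x \<otimes> y) -` U)"
    then show "z \<in> Mdom" by (auto simp: Mdom_def D_def inj_phi)
  next
    fix z assume z: "z \<in> Mdom"
    then have "z = map_prod \<phi> \<phi> (\<sigma> (fst z), \<sigma> (snd z))"
      by (auto simp: Mdom_def phi_sigma)
    moreover have "(\<sigma> (fst z), \<sigma> (snd z)) \<in> U \<times> U \<inter> (\<lambda>(x, y). x \<otimes> y) -` U"
      using z by (auto simp: Mdom_def sigma_in)
    ultimately show "z \<in> map_prod \<phi> \<phi> ` (U \<times> U \<inter> (\<lambda>(x, y). x \<otimes> y) -` U)" by blast
  qed
  show ?thesis
  proof (rule smooth_on_cong[OF open_Mdom _ s[unfolded dom]])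
    fix z assume "z \<in> Mdom"
    then show "(\<phi> \<circ> (\<lambda>(x, y). x \<otimes> y) \<circ> inv_into (U \<times> U) (map_prod \<phi> \<phi>)) z = M z"
      by (cases z) (auto simp: Mdom_def M_def inv)
  qed
qed

lemma smooth_I: "smooth_on Idom I"
proof -
  have "smooth_on (\<phi> ` (U \<inter> (\<lambda>x. inv x) -` U)) (\<phi> \<circ> (\<lambda>x. inv x) \<circ> \<sigma>)"
    using lie chart unfolding lie_group_def smooth_map_def by blast
  moreover have "\<phi> ` (U \<inter> (\<lambda>x. inv x) -` U) = Idom"
  proof (intro Set.set_eqI iffI)
    fix x assume "x \<in> Idom"
    then have "x = \<phi> (\<sigma> x)" "\<sigma> x \<in> U \<inter> (\<lambda>x. inv x) -` U"
      by (auto simp: Idom_def phi_sigma sigma_in)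
    then show "x \<in> \<phi> ` (U \<inter> (\<lambda>x. inv x) -` U)" by blast
  qed (auto simp: Idom_def D_def inj_phi)
  ultimately show ?thesis by (simp add: I_def o_def)
qed

lemma smooth_c: "smooth_on cdom c"
proof -
  have "smooth_on cdom (\<lambda>z. M (M z, I (fst z)))"
  proof (rule smooth_on_compose[OF open_cdom _ smooth_M])
    have "smooth_on cdom M"
      using smooth_M by (rule smooth_on_subset) (auto simp: cdom_def)
    moreover have "smooth_on cdom (\<lambda>z. I (fst z))"
      by (rule smooth_on_compose[OF open_cdom _ smooth_I])
        (auto simp: cdom_def intro: smooth_on_linear linear_fst)
    ultimately show "smooth_on cdom (\<lambda>z. (M z, I (fst z)))"
      by (rule smooth_on_Pair)
    show "(\<lambda>z. (M z, I (fst z))) ` cdom \<subseteq> Mdom"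
      by (auto simp: cdom_def Mdom_def Idom_def M_def I_def sigma_phi) (auto simp: D_def)
  qed
  then show ?thesis
  proof (rule smooth_on_cong[OF open_cdom, rotated])
    fix z assume z: "z \<in> cdom"
    have "\<sigma> (M z) = \<sigma> (fst z) \<otimes> \<sigma> (snd z)"
      using z sigma_phi by (simp add: cdom_def Mdom_def M_def)
    moreover have "\<sigma> (I (fst z)) = inv (\<sigma> (fst z))"
      using z sigma_phi by (simp add: cdom_def Idom_def I_def)
    ultimately show "M (M z, I (fst z)) = c z"
      unfolding M_def[THEN fun_cong, of "(M z, I (fst z))"] c_def by simp
  qed
qed

section \<open>Differentials of conjugations at the unit\<close>

definition "conjug g = (\<lambda>x. \<phi> (g \<otimes> \<sigma> x \<otimes> inv g))"

lemma Ad_eq: "Ad' g = frechet_derivative (conjug g) (at x\<^sub>0)"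
  by (simp add: Ad_def conjug_def x\<^sub>0_def)

text \<open>For elements of this neighbourhood, conjugation is \<open>c\<close> with its first
  argument frozen, hence differentiable at the unit. The rest of the group is reached by
  products.\<close>

definition "V = {g \<in> carrier G. g \<in> U \<and> inv g \<in> U}"

lemma V_open: "openin T V" "\<one> \<in> V"
proof -
  have "continuous_map T T (\<lambda>x. inv x)"
    using continuous_inv[of T "\<lambda>x. x"] by simp
  from openin_continuous_map_preimage[OF this chart_on(1)]
  have "openin T {x \<in> carrier G. inv x \<in> U}" by (simp add: topspace)
  moreover have "V = {x \<in> carrier G. inv x \<in> U} \<inter> U"
    using U_carrier by (auto simp: V_def)
  ultimately show "openin T V" using chart_on(1) by (simp add: openin_Int)
  show "\<one> \<in> V" using one_in by (simp add: V_def)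
qed

lemma V_cdom:
  assumes "g \<in> V"
  shows "(\<phi> g, x\<^sub>0) \<in> cdom"
  using assms one_in x0_in
  by (auto simp: V_def cdom_def Mdom_def Idom_def sigma_phi sigma_x0 D_def)

lemma conj_V: "g \<in> V \<Longrightarrow> conjug g = (\<lambda>y. c (\<phi> g, y))"
  by (auto simp: conjug_def c_def V_def sigma_phi)

lemma has_derivative_Pair_const: "((\<lambda>y. (a, y)) has_derivative (\<lambda>v. (0, v))) (at y)"
  "((\<lambda>x. (x, a)) has_derivative (\<lambda>v. (v, 0))) (at y)"
  by (auto intro!: derivative_eq_intros)

lemma conj_derivative_V:
  assumes "g \<in> V"
  shows "(conjug g has_derivative (\<lambda>v. frechet_derivative c (at (\<phi> g, x\<^sub>0)) (0, v))) (at x\<^sub>0)"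
  unfolding conj_V[OF assms]
  using has_derivative_compose[OF has_derivative_Pair_const(1)
      smooth_on_has_derivative[OF smooth_c V_cdom[OF assms]]] by simp

lemma open_conj_dom:
  assumes "h \<in> carrier G"
  shows "open {x \<in> D. h \<otimes> \<sigma> x \<otimes> inv h \<in> U}"
  using assms by (intro open_preimage_U chart_on(2) continuous_mult continuous_sigma)
    (auto simp: topspace)

lemma conj_x0: "h \<in> carrier G \<Longrightarrow> conjug h x\<^sub>0 = x\<^sub>0"
  using sigma_x0 by (simp add: conjug_def) (simp add: x\<^sub>0_def)

lemma conj_mult:
  assumes "g \<in> carrier G" "h \<in> carrier G" "x \<in> D" "h \<otimes> \<sigma> x \<otimes> inv h \<in> U"
  shows "conjug g (conjug h x) = conjug (g \<otimes> h) x"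
  using assms sigma_carrier[OF assms(3)]
  by (simp add: conjug_def sigma_phi m_assoc inv_mult_group)

text \<open>The composition rule for \<open>conjug\<close> holds where the inner conjugate is still
  in the chart, which is a neighbourhood of \<open>x\<^sub>0\<close>. Since conjugations fix
  \<open>x\<^sub>0\<close>, both differentials are taken at the same point.\<close>

lemma conj_derivative_mult:
  assumes "g \<in> carrier G" "h \<in> carrier G"
    and "(conjug g has_derivative A) (at x\<^sub>0)" "(conjug h has_derivative B) (at x\<^sub>0)"
  shows "(conjug (g \<otimes> h) has_derivative (\<lambda>v. A (B v))) (at x\<^sub>0)"
proof (rule has_derivative_transform_within_open)
  show "((\<lambda>x. conjug g (conjug h x)) has_derivative (\<lambda>v. A (B v))) (at x\<^sub>0)"
    using has_derivative_compose[OF assms(4)] assms(3) conj_x0[OF assms(2)] by simp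
  show "open {x \<in> D. h \<otimes> \<sigma> x \<otimes> inv h \<in> U}" using assms by (intro open_conj_dom)
  show "x\<^sub>0 \<in> {x \<in> D. h \<otimes> \<sigma> x \<otimes> inv h \<in> U}"
    using x0_in assms one_in by (simp add: sigma_x0)
qed (use conj_mult assms in auto)

lemma continuous_translation:
  assumes "a \<in> carrier G"
  shows "continuous_map T T (\<lambda>x. a \<otimes> x)"
  using continuous_mult[of T "\<lambda>_. a" "\<lambda>x. x"] assms by (simp add: topspace)

text \<open>Since \<open>N\<close> may be replaced by \<open>N \<inter> N\<inverse>\<close>, a set closed under multiplication that contains
  \<open>N\<close> is both open and closed.\<close>

lemma connected_generation:
  assumes conn: "connected_space T" and N: "openin T N" "\<one> \<in> N"
    and P: "\<And>g. g \<in> N \<Longrightarrow> P g"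
    and mult: "\<And>g h. g \<in> carrier G \<Longrightarrow> h \<in> carrier G \<Longrightarrow> P g \<Longrightarrow> P h \<Longrightarrow> P (g \<otimes> h)"
    and g: "g \<in> carrier G"
  shows "P g"
proof -
  define W where "W = {x \<in> carrier G. x \<in> N \<and> inv x \<in> N}"
  have "continuous_map T T (\<lambda>x. inv x)"
    using continuous_inv[of T "\<lambda>x. x"] by simp
  from openin_continuous_map_preimage[OF this N(1)]
  have "openin T {x \<in> carrier G. inv x \<in> N}" by (simp add: topspace)
  moreover have "W = {x \<in> carrier G. inv x \<in> N} \<inter> N"
    using openin_subset[OF N(1)] by (auto simp: W_def topspace)
  ultimately have W: "openin T W" "\<one> \<in> W" using N by (simp_all add: openin_Int W_def)
  have tr: "openin T {x \<in> carrier G. inv a \<otimes> x \<in> W}" if "a \<in> carrier G" for a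
    using openin_continuous_map_preimage[OF continuous_translation[of "inv a"] W(1)] that
    by (simp add: topspace)
  define K where "K = {x \<in> carrier G. P x}"
  have 1: "openin T K"
  proof (subst openin_subopen, intro ballI)
    fix a assume a: "a \<in> K"
    have "{x \<in> carrier G. inv a \<otimes> x \<in> W} \<subseteq> K"
    proof
      fix x assume x: "x \<in> {x \<in> carrier G. inv a \<otimes> x \<in> W}"
      then have "P (a \<otimes> (inv a \<otimes> x))" using a P mult[of a "inv a \<otimes> x"] by (auto simp: K_def W_def)
      then show "x \<in> K" using x a by (simp add: K_def m_assoc[symmetric])
    qed
    then show "\<exists>T'. openin T T' \<and> a \<in> T' \<and> T' \<subseteq> K"
      using tr[of a] a W(2) by (intro exI[of _ "{x \<in> carrier G. inv a \<otimes> x \<in> W}"]) (auto simp: K_def)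
  qed
  have 2: "openin T (topspace T - K)"
  proof (subst openin_subopen, intro ballI)
    fix a assume a: "a \<in> topspace T - K"
    then have ac: "a \<in> carrier G" by (simp add: topspace)
    have "{x \<in> carrier G. inv a \<otimes> x \<in> W} \<subseteq> topspace T - K"
    proof
      fix x assume x: "x \<in> {x \<in> carrier G. inv a \<otimes> x \<in> W}"
      have "x \<notin> K"
      proof
        assume "x \<in> K"
        moreover have "P (inv (inv a \<otimes> x))" using x P by (auto simp: W_def)
        ultimately have "P (x \<otimes> inv (inv a \<otimes> x))"
          using x ac mult[of x "inv (inv a \<otimes> x)"] by (auto simp: K_def)
        moreover have "x \<otimes> inv (inv a \<otimes> x) = a"
          using x ac by (simp add: inv_mult_group m_assoc[symmetric])
        ultimately show False using a ac by (simp add: K_def)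
      qed
      then show "x \<in> topspace T - K" using x by (simp add: topspace)
    qed
    then show "\<exists>T'. openin T T' \<and> a \<in> T' \<and> T' \<subseteq> topspace T - K"
      using tr[of a] ac W(2) by (intro exI[of _ "{x \<in> carrier G. inv a \<otimes> x \<in> W}"]) auto
  qed
  have "K = {} \<or> K = topspace T"
    using conn 1 2 unfolding connected_space_clopen_in by (metis closedin_def openin_subset)
  moreover have "\<one> \<in> K" using P N by (simp add: K_def)
  ultimately show ?thesis using g by (auto simp: K_def topspace)
qed

end

section \<open>The adjoint representation and the bracket of a connected group\<close>

locale connected_lie_group_chart = lie_group_chart +
  assumes conn: "connected_space T"
begin

text \<open>The chart directly handles conjugation by small elements only;
  \<open>connected_generation\<close> spreads differentiability to the whole group.\<close>

lemma conj_derivative: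
  assumes "g \<in> carrier G"
  shows "(conjug g has_derivative Ad' g) (at x\<^sub>0)"
proof -
  have "conjug g differentiable (at x\<^sub>0)"
    using conn V_open _ _ assms
  proof (rule connected_generation)
    show "conjug g differentiable (at x\<^sub>0)" if "g \<in> V" for g
      using conj_derivative_V[OF that] differentiableI by blast
    show "conjug (g \<otimes> h) differentiable (at x\<^sub>0)"
      if "g \<in> carrier G" "h \<in> carrier G" "conjug g differentiable (at x\<^sub>0)"
        "conjug h differentiable (at x\<^sub>0)" for g h
      using conj_derivative_mult[OF that(1,2)] that(3,4) unfolding differentiable_def by blast
  qed
  then show ?thesis
    by (simp add: Ad_eq frechet_derivative_works)
qed

lemma Ad_unique: "g \<in> carrier G \<Longrightarrow> (conjug g has_derivative A) (at x\<^sub>0) \<Longrightarrow> Ad' g = A"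
  using conj_derivative has_derivative_unique by blast

lemma Ad_linear: "g \<in> carrier G \<Longrightarrow> linear (Ad' g)"
  using conj_derivative has_derivative_linear by blast

lemma Ad_mult: "g \<in> carrier G \<Longrightarrow> h \<in> carrier G \<Longrightarrow> Ad' (g \<otimes> h) v = Ad' g (Ad' h v)"
  using Ad_unique[OF _ conj_derivative_mult[OF _ _ conj_derivative conj_derivative]] by simp

lemma Ad_one: "Ad' \<one> v = v"
proof -
  have "(conjug \<one> has_derivative (\<lambda>v. v)) (at x\<^sub>0)"
  proof (rule has_derivative_transform_within_open[OF has_derivative_ident chart_on(2) x0_in])
    show "x = conjug \<one> x" if "x \<in> D" for x
      using that sigma_carrier phi_sigma by (simp add: conjug_def)
  qed
  then show ?thesis using Ad_unique by simp
qed

lemma Ad_inv: "g \<in> carrier G \<Longrightarrow> Ad' g (Ad' (inv g) v) = v"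
  "g \<in> carrier G \<Longrightarrow> Ad' (inv g) (Ad' g v) = v"
  by (simp_all add: Ad_mult[symmetric] Ad_one)

definition "Edom = {x. (x, x\<^sub>0) \<in> cdom}"

lemma open_Edom: "open Edom"
proof -
  have "open ((\<lambda>x. (x, x\<^sub>0)) -` cdom)"
    by (rule open_vimage[OF open_cdom]) (auto intro: continuous_intros)
  then show ?thesis by (simp add: Edom_def vimage_def)
qed

lemma x0_Edom: "x\<^sub>0 \<in> Edom"
  using V_cdom[OF V_open(2)] by (simp add: Edom_def x\<^sub>0_def)

lemma Edom_D: "x \<in> Edom \<Longrightarrow> x \<in> D"
  by (simp add: Edom_def cdom_def Mdom_def)

lemma Edom_V: "x \<in> Edom \<Longrightarrow> \<sigma> x \<in> V"
  using sigma_carrier sigma_in by (auto simp: Edom_def cdom_def Mdom_def Idom_def V_def)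

lemma Ad_sigma:
  assumes "x \<in> Edom"
  shows "Ad' (\<sigma> x) v = frechet_derivative c (at (x, x\<^sub>0)) (0, v)"
  using Ad_unique[OF sigma_carrier conj_derivative_V[OF Edom_V[OF assms]]] Edom_D[OF assms] phi_sigma
  by simp

lemma smooth_Ad_sigma: "smooth_on Edom (\<lambda>x. Ad' (\<sigma> x) v)"
proof (rule smooth_on_cong[OF open_Edom])
  have "smooth_on Edom (\<lambda>x. (x, x\<^sub>0))"
    by (rule smooth_on_Pair) (auto intro: smooth_on_linear smooth_on_const linear_id[unfolded id_def])
  then show "smooth_on Edom (\<lambda>x. frechet_derivative c (at (x, x\<^sub>0)) (0, v))"
    by (rule smooth_on_compose[OF open_Edom _ smooth_on_derivative[OF smooth_c open_cdom]])
      (auto simp: Edom_def)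
qed (simp add: Ad_sigma)

lemma bracket_derivative: "((\<lambda>x. Ad' (\<sigma> x) v) has_derivative (\<lambda>u. br u v)) (at x\<^sub>0)"
proof -
  have "br u v = frechet_derivative (\<lambda>x. Ad' (\<sigma> x) v) (at x\<^sub>0) u" for u
    by (simp add: lie_bracket_def x\<^sub>0_def)
  then show ?thesis
    using smooth_on_has_derivative[OF smooth_Ad_sigma x0_Edom] by simp
qed

lemma bracket_unique:
  "((\<lambda>x. Ad' (\<sigma> x) v) has_derivative A) (at x\<^sub>0) \<Longrightarrow> br u v = A u"
  using fun_cong[OF has_derivative_unique[OF bracket_derivative], of v A u] by simp

lemma Ad_add: "g \<in> carrier G \<Longrightarrow> Ad' g (v + w) = Ad' g v + Ad' g w"
  and Ad_scaleR: "g \<in> carrier G \<Longrightarrow> Ad' g (a *\<^sub>R v) = a *\<^sub>R Ad' g v"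
  using Ad_linear by (simp_all add: linear_add linear_scale)

lemma bracket_transform:
  assumes "(f has_derivative A) (at x\<^sub>0)" "\<And>x. x \<in> Edom \<Longrightarrow> f x = Ad' (\<sigma> x) v"
  shows "br u v = A u"
  using has_derivative_transform_within_open[OF assms(1) open_Edom x0_Edom assms(2)]
  by (rule bracket_unique)

lemma bilinear_bracket: "bilinear br"
  unfolding bilinear_def
proof (intro conjI allI)
  show "linear (\<lambda>u. br u v)" for v
    using bracket_derivative has_derivative_linear by blast
  show "linear (br u)" for u
  proof
    show "br u (v + w) = br u v + br u w" for v w
      by (rule bracket_transform[OF has_derivative_add[OF bracket_derivative bracket_derivative]])
        (simp add: Ad_add sigma_carrier Edom_D)
    show "br u (a *\<^sub>R v) = a *\<^sub>R br u v" for a v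
      by (rule bracket_transform[OF has_derivative_scaleR_right[OF bracket_derivative]])
        (simp add: Ad_scaleR sigma_carrier Edom_D)
  qed
qed

text \<open>Both sides are derivatives at the unit of one function of \<open>x\<close>: the
  expression \<open>Ad' (g \<otimes> \<sigma> x \<otimes> inv g) (Ad' g v)\<close> equals
  \<open>Ad' g (Ad' (\<sigma> x) v)\<close>.\<close>

lemma Ad_bracket:
  assumes g: "g \<in> carrier G"
  shows "Ad' g (br u v) = br (Ad' g u) (Ad' g v)"
proof -
  let ?O = "{x \<in> D. g \<otimes> \<sigma> x \<otimes> inv g \<in> U}"
  have "((\<lambda>x. Ad' (\<sigma> x) (Ad' g v)) has_derivative (\<lambda>u. br u (Ad' g v))) (at (conjug g x\<^sub>0))"
    using bracket_derivative conj_x0[OF g] by simp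
  note 1 = has_derivative_compose[OF conj_derivative[OF g] this]
  have 2: "((\<lambda>x. Ad' (\<sigma> (conjug g x)) (Ad' g v)) has_derivative (\<lambda>u. Ad' g (br u v))) (at x\<^sub>0)"
  proof (rule has_derivative_transform_within_open[OF _ open_conj_dom[OF g]])
    show "((\<lambda>x. Ad' g (Ad' (\<sigma> x) v)) has_derivative (\<lambda>u. Ad' g (br u v))) (at x\<^sub>0)"
      by (rule bounded_linear.has_derivative[OF _ bracket_derivative])
        (simp add: Ad_linear g linear_conv_bounded_linear[symmetric])
    show "x\<^sub>0 \<in> ?O" using x0_in one_in g by (simp add: sigma_x0)
    fix x assume x: "x \<in> ?O"
    then have "\<sigma> (conjug g x) = g \<otimes> \<sigma> x \<otimes> inv g"
      by (simp add: conjug_def sigma_phi)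
    then show "Ad' g (Ad' (\<sigma> x) v) = Ad' (\<sigma> (conjug g x)) (Ad' g v)"
      using x g by (simp add: Ad_mult Ad_inv sigma_carrier)
  qed
  show ?thesis using fun_cong[OF has_derivative_unique[OF 2 1], of u] .
qed

text \<open>Differentiate \<open>Ad_bracket\<close> with respect to the group element at the unit;
  the product rule yields the two terms.\<close>

lemma jacobi_bracket: "br w (br u v) = br (br w u) v + br u (br w v)"
proof (rule bracket_transform)
  have bb: "bounded_bilinear br" using bilinear_bracket by (simp add: bilinear_conv_bounded_bilinear)
  show "((\<lambda>x. br (Ad' (\<sigma> x) u) (Ad' (\<sigma> x) v)) has_derivative
      (\<lambda>w. br (br w u) v + br u (br w v))) (at x\<^sub>0)"
    using bounded_bilinear.FDERIV[OF bb bracket_derivative[of u] bracket_derivative[of v]]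
    by (simp add: sigma_x0 Ad_one add.commute)
qed (simp add: Ad_bracket sigma_carrier Edom_D)

text \<open>
  Conjugation fixes the conjugating element, that is \<open>c (x, x) = x\<close>, while
  \<open>c (x, y) - y - br (x - x\<^sub>0) (y - x\<^sub>0)\<close> is of order greater than two; comparing the two
  along a line through the unit makes \<open>br u u\<close> vanish.
\<close>

lemma bracket_self: "br u u = 0"
proof (rule ccontr)
  assume nz: "br u u \<noteq> 0"
  then have u: "u \<noteq> 0"
    using bilinear_bracket by (auto simp: bilinear_lzero)
  define N where "N z = frechet_derivative c (at z) (0, u)" for z
  let ?z = "(x\<^sub>0, x\<^sub>0)"
  have z: "?z \<in> cdom" using x0_Edom by (simp add: Edom_def)
  have "smooth_on cdom N"
    unfolding N_def by (rule smooth_on_derivative[OF smooth_c open_cdom])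
  then obtain N' where N': "(N has_derivative N') (at ?z)"
    using smooth_on_has_derivative z by blast
  interpret N': bounded_linear N' using N' by (rule has_derivative_bounded_linear)
  have 1: "N' (a, 0) = br a u" for a
  proof -
    have "((\<lambda>x. N (x, x\<^sub>0)) has_derivative (\<lambda>a. N' (a, 0))) (at x\<^sub>0)"
      using has_derivative_compose[OF has_derivative_Pair_const(2) N'] by simp
    then show ?thesis
      by (rule bracket_transform[symmetric]) (simp add: N_def Ad_sigma)
  qed
  have 2: "N' (0, b) = 0" for b
  proof -
    have "open ((\<lambda>y. (x\<^sub>0, y)) -` cdom)"
      by (rule open_vimage[OF open_cdom]) (auto intro: continuous_intros)
    moreover have "N (x\<^sub>0, y) = u" if "y \<in> (\<lambda>y. (x\<^sub>0, y)) -` cdom" for y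
    proof -
      have 1: "((\<lambda>y. c (x\<^sub>0, y)) has_derivative (\<lambda>v. frechet_derivative c (at (x\<^sub>0, y)) (0, v))) (at y)"
        using has_derivative_compose[OF has_derivative_Pair_const(1)
            smooth_on_has_derivative[OF smooth_c, of "(x\<^sub>0, y)"]] that by simp
      have 2: "((\<lambda>y. c (x\<^sub>0, y)) has_derivative (\<lambda>v. v)) (at y)"
      proof (rule has_derivative_transform_within_open[OF has_derivative_ident chart_on(2)])
        show "y \<in> D" using that by (simp add: cdom_def Mdom_def)
        show "y = c (x\<^sub>0, y)" if "y \<in> D" for y
          using that sigma_carrier phi_sigma by (simp add: c_def sigma_x0)
      qed
      show ?thesis using fun_cong[OF has_derivative_unique[OF 1 2], of u] by (simp add: N_def)
    qed
    ultimately have 1: "((\<lambda>y. N (x\<^sub>0, y)) has_derivative (\<lambda>v. 0)) (at x\<^sub>0)"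
      using z by (intro has_derivative_transform_within_open[OF has_derivative_const]) auto
    have 2: "((\<lambda>y. N (x\<^sub>0, y)) has_derivative (\<lambda>b. N' (0, b))) (at x\<^sub>0)"
      using has_derivative_compose[OF has_derivative_Pair_const(1) N'] by simp
    show ?thesis using fun_cong[OF has_derivative_unique[OF 2 1], of b] .
  qed
  have N'_eq: "N' (a, b) = br a u" for a b
    using N'.add[of "(a, 0)" "(0, b)"] 1 2 by simp
  \<comment> \<open>The concluding estimate reads
    \<open>t^2 * norm (br u u) \<le> 2 * e * t^2 * norm u\<close>; this \<open>e\<close> makes its
    right-hand side half of the left.\<close>
  define e where "e = norm (br u u) / (4 * norm u)"
  have e: "e > 0" using nz u by (simp add: e_def)
  have Nz: "N ?z = u" 
    using Ad_sigma[OF x0_Edom, of u] by (simp add: N_def sigma_x0 Ad_one)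
  obtain d1 where d1: "d1 > 0" "\<And>z. norm (z - ?z) < d1 \<Longrightarrow>
      norm (N z - N ?z - N' (z - ?z)) \<le> e * norm (z - ?z)"
    using N' e unfolding has_derivative_at_alt by blast
  obtain d2 where d2: "d2 > 0" "ball ?z d2 \<subseteq> cdom"
    using open_cdom z openE by blast
  define t where "t = min d1 d2 / (4 * norm u)"
  have t: "t > 0" using d1 d2 u by (simp add: t_def)
  have t2: "2 * t * norm u < d1" "2 * t * norm u < d2"
    using d1(1) d2(1) u by (simp_all add: t_def min_def)
  define z where "z s = (x\<^sub>0 + t *\<^sub>R u, x\<^sub>0 + s *\<^sub>R u)" for s
  have nz: "norm (z s - ?z) \<le> 2 * t * norm u" if "s \<in> {0..t}" for s
  proof -
    have "norm (z s - ?z) \<le> norm (t *\<^sub>R u) + norm (s *\<^sub>R u)"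
      using norm_Pair_le[of "t *\<^sub>R u" "s *\<^sub>R u"] by (simp add: z_def)
    moreover have "norm (s *\<^sub>R u) \<le> t * norm u" "norm (t *\<^sub>R u) = t * norm u"
      using that t by (auto intro: mult_right_mono)
    ultimately show ?thesis by linarith
  qed
  have zc: "z s \<in> cdom" if "s \<in> {0..t}" for s
  proof -
    have "dist (z s) ?z < d2" using nz[OF that] t2 by (simp add: dist_norm)
    then have "z s \<in> ball ?z d2" by (simp add: dist_commute)
    then show ?thesis using d2(2) by blast
  qed
  \<comment> \<open>The conjugating element stays at \<open>x\<^sub>0 + t *\<^sub>R u\<close> while
    the conjugated one runs from the unit to it. At \<open>s = 0\<close> the unit is conjugated, at
    \<open>s = t\<close> the element is conjugated by itself, so both end values of \<open>k\<close>
    are known exactly.\<close>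
  define k where "k s = c (z s) - (x\<^sub>0 + s *\<^sub>R u) - (s * t) *\<^sub>R br u u" for s
  have dk: "(k has_derivative (\<lambda>h. h *\<^sub>R (N (z s) - u - t *\<^sub>R br u u))) (at s within {0..t})"
    if "s \<in> {0..t}" for s
  proof -
    have zd: "(z has_derivative (\<lambda>h. (0, h *\<^sub>R u))) (at s)"
      unfolding z_def by (auto intro!: derivative_eq_intros)
    have "((\<lambda>s. c (z s)) has_derivative (\<lambda>h. frechet_derivative c (at (z s)) (0, h *\<^sub>R u))) (at s)"
      by (rule has_derivative_compose[OF zd smooth_on_has_derivative[OF smooth_c zc[OF that]]])
    moreover have "frechet_derivative c (at (z s)) (0, h *\<^sub>R u) = h *\<^sub>R N (z s)" for h
    proof -
      have "linear (frechet_derivative c (at (z s)))"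
        using smooth_on_has_derivative[OF smooth_c zc[OF that]] has_derivative_linear by blast
      then show ?thesis
        using linear_scale[of _ h "(0, u)"] by (simp add: N_def)
    qed
    ultimately have 1: "((\<lambda>s. c (z s)) has_derivative (\<lambda>h. h *\<^sub>R N (z s))) (at s)" by simp
    have 2: "((\<lambda>s. x\<^sub>0 + s *\<^sub>R u) has_derivative (\<lambda>h. h *\<^sub>R u)) (at s)"
      by (auto intro!: derivative_eq_intros)
    have 3: "((\<lambda>s. (s * t) *\<^sub>R br u u) has_derivative (\<lambda>h. (h * t) *\<^sub>R br u u)) (at s)"
      by (auto intro!: derivative_eq_intros)
    have "(k has_derivative (\<lambda>h. h *\<^sub>R N (z s) - h *\<^sub>R u - (h * t) *\<^sub>R br u u)) (at s)"
      unfolding k_def by (rule has_derivative_diff[OF has_derivative_diff[OF 1 2] 3])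
    then show ?thesis
      by (simp add: scaleR_diff_right has_derivative_at_withinI)
  qed
  have bound: "onorm (\<lambda>h. h *\<^sub>R (N (z s) - u - t *\<^sub>R br u u)) \<le> e * (2 * t * norm u)"
    if "s \<in> {0..t}" for s
  proof (rule onorm_le)
    have br_t: "t *\<^sub>R br u u = N' (z s - ?z)"
      using N'_eq bilinear_bracket by (simp add: z_def bilinear_lmul)
    have "norm (N (z s) - u - t *\<^sub>R br u u) \<le> e * norm (z s - ?z)"
      using d1(2)[of "z s"] nz[OF that] t2 by (simp add: br_t Nz)
    also have "\<dots> \<le> e * (2 * t * norm u)" using nz[OF that] e by (simp add: mult_left_mono)
    finally show "norm (h *\<^sub>R (N (z s) - u - t *\<^sub>R br u u)) \<le> e * (2 * t * norm u) * norm h" for h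
      by (simp add: mult.commute mult_left_mono)
  qed
  have "norm (k t - k 0) \<le> e * (2 * t * norm u) * norm (t - 0)"
    by (rule differentiable_bound[OF convex_closed_interval dk bound]) (use t in auto)
  moreover have "k 0 = 0"
  proof -
    have "x\<^sub>0 + t *\<^sub>R u \<in> D" using zc[of 0] t by (simp add: z_def cdom_def Mdom_def)
    then have "c (z 0) = x\<^sub>0"
      using sigma_carrier by (simp add: c_def z_def sigma_x0) (simp add: x\<^sub>0_def)
    then show ?thesis by (simp add: k_def)
  qed
  moreover have "k t = - ((t * t) *\<^sub>R br u u)"
  proof -
    have "x\<^sub>0 + t *\<^sub>R u \<in> D" using zc[of 0] t by (simp add: z_def cdom_def Mdom_def)
    then have "c (z t) = x\<^sub>0 + t *\<^sub>R u"
      using sigma_carrier phi_sigma by (simp add: c_def z_def m_assoc)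
    then show ?thesis by (simp add: k_def)
  qed
  ultimately have "(t * t) * norm (br u u) \<le> e * (2 * t * norm u) * t"
    using t by simp
  also have "\<dots> = (t * t) * (norm (br u u) / 2)" using u by (simp add: e_def)
  finally show False using t nz \<open>br u u \<noteq> 0\<close> by simp
qed

end

section \<open>The exponential of a linear map\<close>

text \<open>A copy of the bounded endomorphisms that carries their Banach algebra structure, so that
  the exponential function of the library applies to linear maps.\<close>

typedef (overloaded) 'a endo = "UNIV :: ('a::euclidean_space \<Rightarrow>\<^sub>L 'a) set"
  morphisms blinfun_of_endo Endo ..

setup_lifting type_definition_endo

instantiation endo :: (euclidean_space) real_normed_algebra_1
begin

lift_definition norm_endo :: "'a endo \<Rightarrow> real" is norm .
lift_definition minus_endo :: "'a endo \<Rightarrow> 'a endo \<Rightarrow> 'a endo" is "(-)" .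
definition dist_endo :: "'a endo \<Rightarrow> 'a endo \<Rightarrow> real" where "dist_endo a b = norm (a - b)"
definition [code del]:
  "(uniformity :: ('a endo \<times> 'a endo) filter) = (INF e\<in>{0 <..}. principal {(x, y). dist x y < e})"
definition open_endo :: "'a endo set \<Rightarrow> bool"
  where [code del]: "open_endo S = (\<forall>x\<in>S. \<forall>\<^sub>F (x', y) in uniformity. x' = x \<longrightarrow> y \<in> S)"
lift_definition uminus_endo :: "'a endo \<Rightarrow> 'a endo" is uminus .
lift_definition zero_endo :: "'a endo" is 0 .
lift_definition plus_endo :: "'a endo \<Rightarrow> 'a endo \<Rightarrow> 'a endo" is "(+)" .
lift_definition scaleR_endo :: "real \<Rightarrow> 'a endo \<Rightarrow> 'a endo" is "(*\<^sub>R)" .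
definition sgn_endo :: "'a endo \<Rightarrow> 'a endo" where "sgn_endo x = inverse (norm x) *\<^sub>R x"
lift_definition one_endo :: "'a endo" is id_blinfun .
lift_definition times_endo :: "'a endo \<Rightarrow> 'a endo \<Rightarrow> 'a endo" is blinfun_compose .

instance
proof
  fix x y z :: "'a endo" and a b :: real
  show "x + y + z = x + (y + z)" "x + y = y + x" "0 + x = x" "- x + x = 0" "x - y = x + - y"
    by (transfer, simp)+
  show "a *\<^sub>R (x + y) = a *\<^sub>R x + a *\<^sub>R y" "(a + b) *\<^sub>R x = a *\<^sub>R x + b *\<^sub>R x"
    "a *\<^sub>R b *\<^sub>R x = (a * b) *\<^sub>R x" "1 *\<^sub>R x = x"
    by (transfer, simp add: algebra_simps)+
  show "dist x y = norm (x - y)" by (rule dist_endo_def)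
  show "sgn x = inverse (norm x) *\<^sub>R x" by (rule sgn_endo_def)
  show "(norm x = 0) = (x = 0)" "norm (a *\<^sub>R x) = \<bar>a\<bar> * norm x" by (transfer, simp)+
  show "norm (x + y) \<le> norm x + norm y" by transfer (rule norm_triangle_ineq)
  show "norm (x * y) \<le> norm x * norm y" by transfer (rule norm_blinfun_compose)
  show "norm (1 :: 'a endo) = 1" by transfer simp
  show "x * y * z = x * (y * z)" "(x + y) * z = x * z + y * z" "x * (y + z) = x * y + x * z"
    "1 * x = x" "x * 1 = x" "a *\<^sub>R x * y = a *\<^sub>R (x * y)" "x * a *\<^sub>R y = a *\<^sub>R (x * y)"
    by (transfer, auto intro!: blinfun_eqI simp: blinfun.bilinear_simps)+
  have "norm (1 :: 'a endo) \<noteq> norm (0 :: 'a endo)" by transfer simp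
  then show "(0 :: 'a endo) \<noteq> 1" by metis
qed (simp_all add: uniformity_endo_def open_endo_def)

end

instance endo :: (euclidean_space) banach
proof
  fix X :: "nat \<Rightarrow> 'a endo"
  assume "Cauchy X"
  then have "Cauchy (\<lambda>n. blinfun_of_endo (X n))"
    unfolding Cauchy_def dist_norm by transfer
  then obtain L where "(\<lambda>n. blinfun_of_endo (X n)) \<longlonglongrightarrow> L"
    using Cauchy_convergent_iff convergent_def by blast
  then have "X \<longlonglongrightarrow> Endo L"
    unfolding lim_sequentially dist_norm
    by (simp add: norm_endo.rep_eq minus_endo.rep_eq Endo_inverse)
  then show "convergent X" by (auto simp: convergent_def)
qed

definition endo_of :: "('a::euclidean_space \<Rightarrow> 'a) \<Rightarrow> 'a endo" where
  "endo_of A = Endo (Blinfun A)"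

definition endo_apply :: "'a::euclidean_space endo \<Rightarrow> 'a \<Rightarrow> 'a" where
  "endo_apply E v = blinfun_apply (blinfun_of_endo E) v"

lemma endo_apply_endo_of: "linear A \<Longrightarrow> endo_apply (endo_of A) v = A v"
  by (simp add: endo_apply_def endo_of_def Endo_inverse linear_conv_bounded_linear
      bounded_linear_Blinfun_apply)

lemma endo_eqI: "(\<And>v. endo_apply E v = endo_apply F v) \<Longrightarrow> E = F"
  by (metis endo_apply_def blinfun_eqI blinfun_of_endo_inject)

lemma endo_apply_simps:
  "endo_apply (E + F) v = endo_apply E v + endo_apply F v"
  "endo_apply (r *\<^sub>R E) v = r *\<^sub>R endo_apply E v"
  "endo_apply (E * F) v = endo_apply E (endo_apply F v)"
  "endo_apply 1 v = v"
  "endo_apply 0 v = 0"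
  by (simp_all add: endo_apply_def plus_endo.rep_eq scaleR_endo.rep_eq times_endo.rep_eq
      one_endo.rep_eq zero_endo.rep_eq blinfun.bilinear_simps)

lemma endo_apply_power: "linear A \<Longrightarrow> endo_apply (endo_of A ^ n) v = (A ^^ n) v"
  by (induction n) (simp_all add: endo_apply_simps endo_apply_endo_of)

lemma linear_endo_apply: "linear (endo_apply E)"
  unfolding endo_apply_def by (simp add: linear_conv_bounded_linear blinfun.bounded_linear_right)

lemma bounded_linear_endo_apply: "bounded_linear (\<lambda>E. endo_apply E v)"
proof (rule bounded_linear_intro[of _ "norm v"])
  show "norm (endo_apply E v) \<le> norm E * norm v" for E
    unfolding endo_apply_def norm_endo.rep_eq by (rule norm_blinfun)
qed (simp_all add: endo_apply_simps)

lemma endo_of_scaleR: "linear A \<Longrightarrow> endo_of (\<lambda>x. t *\<^sub>R A x) = t *\<^sub>R endo_of A"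
  by (rule endo_eqI) (simp add: endo_apply_simps endo_apply_endo_of linear_compose_scale_right)

definition exp_lin :: "('a::euclidean_space \<Rightarrow> 'a) \<Rightarrow> 'a \<Rightarrow> 'a" where
  "exp_lin A v = endo_apply (exp (endo_of A)) v"

lemma linear_exp_lin: "linear (exp_lin A)"
  using linear_endo_apply by (simp add: exp_lin_def[abs_def])

lemma exp_lin_sums:
  assumes "linear A"
  shows "(\<lambda>n. (A ^^ n) v /\<^sub>R fact n) sums exp_lin A v"
  using bounded_linear.sums[OF bounded_linear_endo_apply exp_converges[of "endo_of A"], of v]
  by (simp add: exp_lin_def endo_apply_simps endo_apply_power assms)

lemma exp_lin_zero: "exp_lin (\<lambda>_. 0) v = v"
proof -
  have "endo_of (\<lambda>_. 0) = (0 :: 'a endo)"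
    by (rule endo_eqI) (simp add: endo_apply_simps endo_apply_endo_of linear_zero)
  then show ?thesis by (simp add: exp_lin_def endo_apply_simps)
qed

lemma exp_lin_add:
  assumes "linear A"
  shows "exp_lin (\<lambda>x. (s + t) *\<^sub>R A x) v = exp_lin (\<lambda>x. s *\<^sub>R A x) (exp_lin (\<lambda>x. t *\<^sub>R A x) v)"
proof -
  have "endo_of (\<lambda>x. (s + t) *\<^sub>R A x) = s *\<^sub>R endo_of A + t *\<^sub>R endo_of A"
    by (subst endo_of_scaleR[OF assms]) (rule scaleR_add_left)
  then show ?thesis
    by (simp add: exp_lin_def endo_of_scaleR[OF assms] exp_add_commuting endo_apply_simps)
qed

lemma exp_lin_minus:
  assumes "linear A"
  shows "exp_lin A (exp_lin (\<lambda>x. - A x) v) = v" "exp_lin (\<lambda>x. - A x) (exp_lin A v) = v"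
  using exp_lin_add[OF assms, of 1 "-1"] exp_lin_add[OF assms, of "-1" 1] by (simp_all add: exp_lin_zero)

lemma exp_lin_derivative:
  assumes "linear A"
  shows "((\<lambda>t. exp_lin (\<lambda>x. t *\<^sub>R A x) v) has_vector_derivative
    A (exp_lin (\<lambda>x. t *\<^sub>R A x) v)) (at t)"
  using bounded_linear.has_vector_derivative[OF bounded_linear_endo_apply
      exp_scaleR_has_vector_derivative_left[of "endo_of A" t], of v]
  by (simp add: exp_lin_def endo_of_scaleR assms endo_apply_simps endo_apply_endo_of)

lemma exp_lin_commute:
  assumes "linear A" "linear B" "\<And>x. B (A x) = A (B x)"
  shows "B (exp_lin A v) = exp_lin A (B v)"
proof -
  have "B ((A ^^ n) v) = (A ^^ n) (B v)" for n
    by (induction n) (simp_all add: assms(3))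
  then have "(\<lambda>n. (A ^^ n) (B v) /\<^sub>R fact n) sums B (exp_lin A v)"
    using bounded_linear.sums[OF _ exp_lin_sums[OF assms(1)], of B v] assms(2)
    by (simp add: linear_conv_bounded_linear[symmetric] linear_scale)
  then show ?thesis using exp_lin_sums[OF assms(1)] sums_unique2 by blast
qed

lemma exp_lin_fixed:
  assumes "linear A" "A v = 0"
  shows "exp_lin A v = v"
proof -
  have "(A ^^ n) v /\<^sub>R fact n = (if n = 0 then v else 0)" for n
  proof (cases n)
    case (Suc m)
    have "(A ^^ k) 0 = 0" for k by (induction k) (simp_all add: linear_0[OF assms(1)])
    then have "(A ^^ Suc m) v = 0"
      by (simp add: funpow_Suc_right assms(2) del: funpow.simps)
    then show ?thesis using Suc by simp
  qed simp
  then have "(\<lambda>n. (A ^^ n) v /\<^sub>R fact n) sums v"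
    using sums_single[of 0 "\<lambda>_. v"] by (simp add: eq_commute)
  then show ?thesis using exp_lin_sums[OF assms(1)] sums_unique2 by blast
qed

lemma exp_lin_invariant:
  assumes "linear A" "subspace W" "\<And>w. w \<in> W \<Longrightarrow> A w \<in> W" "v \<in> W"
  shows "exp_lin A v \<in> W"
proof -
  have "(A ^^ n) v \<in> W" for n
    by (induction n) (simp_all add: assms)
  then have *: "(\<Sum>i<n. (A ^^ i) v /\<^sub>R fact i) \<in> W" for n
    by (intro subspace_sum[OF assms(2)] subspace_scale[OF assms(2)])
  show ?thesis
    by (rule closed_sequentially[OF closed_subspace[OF assms(2)] * exp_lin_sums[OF assms(1), unfolded sums_def]])
qed

text \<open>Only the first term of the exponential series can lie outside \<open>W\<close>. With
  \<open>W\<close> the nilpotent part, this keeps an affine space such as \<open>X + \<nn>\<close>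
  invariant although \<open>X\<close> is not in \<open>W\<close>.\<close>

lemma exp_lin_displacement:
  assumes "linear A" "subspace W" "\<And>w. w \<in> W \<Longrightarrow> A w \<in> W" "A v \<in> W"
  shows "exp_lin A v - v \<in> W"
proof -
  have W: "(A ^^ n) v /\<^sub>R fact n \<in> W" if "n > 0" for n
  proof -
    have "(A ^^ Suc m) v \<in> W" for m by (induction m) (simp_all add: assms)
    then show ?thesis using that assms(2) by (cases n) (auto intro: subspace_scale)
  qed
  have 1: "(\<lambda>n. (A ^^ (n + 1)) v /\<^sub>R fact (n + 1)) sums (exp_lin A v - v)"
    using exp_lin_sums[OF assms(1), of v] sums_iff_shift[of "\<lambda>n. (A ^^ n) v /\<^sub>R fact n" 1] by simp
  have 2: "(\<Sum>i<n. (A ^^ (i + 1)) v /\<^sub>R fact (i + 1)) \<in> W" for n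
    by (intro subspace_sum[OF assms(2)] W) simp
  show ?thesis
    by (rule closed_sequentially[OF closed_subspace[OF assms(2)] 2 1[unfolded sums_def]])
qed

lemma bounded_bilinear_endo_apply: "bounded_bilinear endo_apply"
proof (rule bounded_bilinear.intro)
  show "\<exists>K. \<forall>a b. norm (endo_apply a b :: 'a) \<le> norm a * norm b * K"
    using norm_blinfun unfolding endo_apply_def norm_endo.rep_eq by (intro exI[of _ 1]) auto
qed (simp_all add: endo_apply_simps linear_add[OF linear_endo_apply] linear_scale[OF linear_endo_apply])

text \<open>Applying the inverse flow to a solution gives a curve with zero derivative.\<close>

lemma exp_lin_unique_solution:
  assumes A: "linear A" and x: "\<And>t. (x has_vector_derivative A (x t)) (at t)"
  shows "x t = exp_lin (\<lambda>v. t *\<^sub>R A v) (x 0)"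
proof -
  let ?E = "endo_of (\<lambda>v. - A v)"
  have nA: "linear (\<lambda>v. - A v)" using A by (simp add: linear_compose_neg)
  define y where "y t = endo_apply (exp (t *\<^sub>R ?E)) (x t)" for t
  have "(y has_vector_derivative 0) (at t)" for t
  proof -
    have "(y has_vector_derivative endo_apply (exp (t *\<^sub>R ?E)) (A (x t)) +
        endo_apply (exp (t *\<^sub>R ?E) * ?E) (x t)) (at t)"
      unfolding y_def
      by (rule bounded_bilinear.has_vector_derivative[OF bounded_bilinear_endo_apply
            exp_scaleR_has_vector_derivative_right x])
    then show ?thesis
      by (simp add: endo_apply_simps endo_apply_endo_of nA linear_neg[OF linear_endo_apply])
  qed
  then have "y t = y 0"
    using has_vector_derivative_zero_constant[of UNIV y] by (metis UNIV_I convex_UNIV has_vector_derivative_at_within)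
  then have "exp_lin (\<lambda>v. - (t *\<^sub>R A v)) (x t) = x 0"
    using endo_of_scaleR[OF nA, of t] by (simp add: y_def exp_lin_def endo_apply_simps)
  then show ?thesis
    using exp_lin_minus(1)[OF linear_compose_scale_right[OF A, of t], of "x t"] by simp
qed

section \<open>Continuity of the exponential and its derivative at the origin\<close>

lemma continuous_on_exp_algebra:
  "continuous_on UNIV (exp :: 'a::{real_normed_algebra_1,banach} \<Rightarrow> 'a)"
proof -
  have "continuous_on (ball 0 R) (exp :: 'a \<Rightarrow> 'a)" for R :: real
  proof (rule uniform_limit_theorem)
    show "uniform_limit (ball 0 R) (\<lambda>n x. \<Sum>i<n. x ^ i /\<^sub>R fact i) (exp :: 'a \<Rightarrow> 'a) sequentially"
    proof -
      have "uniform_limit (ball 0 R) (\<lambda>n x. \<Sum>i<n. x ^ i /\<^sub>R fact i)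
          (\<lambda>x::'a. \<Sum>i. x ^ i /\<^sub>R fact i) sequentially"
      proof (rule Weierstrass_m_test_ev[where M = "\<lambda>n. R ^ n /\<^sub>R fact n"])
        show "\<forall>\<^sub>F n in sequentially. \<forall>x\<in>ball 0 R. norm (x ^ n /\<^sub>R fact n :: 'a) \<le> R ^ n /\<^sub>R fact n"
        proof (intro always_eventually allI ballI)
          fix n and x :: 'a assume "x \<in> ball 0 R"
          then have "norm (x ^ n) \<le> R ^ n"
            by (intro order_trans[OF norm_power_ineq] power_mono) auto
          then show "norm (x ^ n /\<^sub>R fact n) \<le> R ^ n /\<^sub>R fact n"
            by (simp add: mult_left_mono)
        qed
      qed (rule summable_exp_generic)
      then show ?thesis by (simp add: exp_def)
    qed
  qed (auto intro!: always_eventually continuous_intros)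
  then have "continuous_on (\<Union>R. ball 0 R) (exp :: 'a \<Rightarrow> 'a)"
    by (intro continuous_on_open_UN) auto
  moreover have "(\<Union>R. ball (0::'a) R) = UNIV"
    by (auto intro: gt_ex)
  ultimately show ?thesis by simp
qed

text \<open>On the unit ball, the part of the series beyond its first two terms is at most a
  constant times \<open>(norm h)\<^sup>2\<close>.\<close>

lemma has_derivative_exp_0:
  "((exp :: 'a::{real_normed_algebra_1,banach} \<Rightarrow> 'a) has_derivative (\<lambda>h. h)) (at 0)"
proof -
  define C where "C = (\<Sum>n. inverse (fact (n + 2)) :: real)"
  have sC: "summable (\<lambda>n. inverse (fact (n + 2)) :: real)"
    using summable_ignore_initial_segment[OF summable_exp[of "1::real"], of 2] by simp
  have C: "C \<ge> 0" unfolding C_def by (intro suminf_nonneg sC) simp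
  have bound: "norm (exp h - 1 - h) \<le> C * (norm h)\<^sup>2" if "norm h \<le> 1" for h :: 'a
  proof -
    have le: "norm (inverse (fact (n + 2)) *\<^sub>R h ^ (n + 2)) \<le> inverse (fact (n + 2)) * (norm h)\<^sup>2" for n
    proof -
      have "norm (h ^ (n + 2)) \<le> norm h ^ (n + 2)" by (rule norm_power_ineq)
      also have "\<dots> \<le> (norm h)\<^sup>2" using that by (intro power_decreasing) auto
      finally show ?thesis by (simp add: mult_left_mono)
    qed
    have s: "summable (\<lambda>n. inverse (fact (n + 2)) * (norm h)\<^sup>2)" by (rule summable_mult2[OF sC])
    have "exp h - 1 - h = (\<Sum>n. inverse (fact (n + 2)) *\<^sub>R (h ^ (n + 2)))"
      using exp_first_two_terms[of h] by (simp add: algebra_simps)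
    also have "norm \<dots> \<le> (\<Sum>n. inverse (fact (n + 2)) * (norm h)\<^sup>2)"
      by (rule norm_suminf_le[OF le s])
    also have "\<dots> = C * (norm h)\<^sup>2" unfolding C_def by (rule suminf_mult2[OF sC, symmetric])
    finally show ?thesis .
  qed
  show ?thesis
    unfolding has_derivative_at_alt
  proof (intro conjI allI impI)
    fix e :: real assume e: "e > 0"
    \<comment> \<open>Only \<open>C \<ge> 0\<close> is at hand, hence the denominator
      \<open>C + 1\<close>; the bound by 1 keeps \<open>y\<close> where the quadratic estimate
      applies.\<close>
    define d where "d = min 1 (e / (C + 1))"
    have d: "d > 0" using e C by (simp add: d_def)
    have "norm (exp y - exp 0 - (y - 0)) \<le> e * norm (y - 0)" if y: "norm (y - 0) < d" for y :: 'a
    proof -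
      have y1: "norm y \<le> 1" "norm y \<le> e / (C + 1)" using y by (simp_all add: d_def)
      then have "norm y * (C + 1) \<le> e" using C by (simp add: pos_le_divide_eq)
      then have "norm y + C * norm y \<le> e" by (simp add: algebra_simps)
      then have "C * norm y \<le> e" using norm_ge_zero[of y] by linarith
      then have "C * norm y * norm y \<le> e * norm y" by (intro mult_right_mono) auto
      then show ?thesis using bound[OF y1(1)] by (simp add: power2_eq_square)
    qed
    then show "\<exists>d>0. \<forall>y::'a. norm (y - 0) < d \<longrightarrow> norm (exp y - exp 0 - (y - 0)) \<le> e * norm (y - 0)"
      using d by blast
  qed (rule bounded_linear_ident)
qed

lemma bounded_linear_endo_of:
  fixes A :: "'b::euclidean_space \<Rightarrow> 'a::euclidean_space \<Rightarrow> 'a"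
  assumes "bilinear A"
  shows "bounded_linear (\<lambda>x. endo_of (A x))"
proof -
  have l: "linear (A x)" for x using assms by (simp add: bilinear_def)
  have "linear (\<lambda>x. endo_of (A x))"
  proof
    show "endo_of (A (x + y)) = endo_of (A x) + endo_of (A y)" for x y
      by (rule endo_eqI) (simp add: endo_apply_simps endo_apply_endo_of l bilinear_ladd[OF assms])
    show "endo_of (A (r *\<^sub>R x)) = r *\<^sub>R endo_of (A x)" for r x
      by (rule endo_eqI) (simp add: endo_apply_simps endo_apply_endo_of l bilinear_lmul[OF assms])
  qed
  then show ?thesis by (simp add: linear_conv_bounded_linear)
qed

lemma continuous_on_exp_lin:
  fixes A :: "'b::euclidean_space \<Rightarrow> 'a::euclidean_space \<Rightarrow> 'a"
  assumes "bilinear A"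
  shows "continuous_on UNIV (\<lambda>x. exp_lin (A x) v)"
proof -
  have "continuous_on UNIV (\<lambda>x. exp (endo_of (A x)))"
    by (rule continuous_on_compose2[OF continuous_on_exp_algebra])
      (simp_all add: linear_continuous_on bounded_linear_endo_of[OF assms])
  then show ?thesis
    unfolding exp_lin_def
    by (rule bounded_linear.continuous_on[OF bounded_linear_endo_apply])
qed

lemma exp_lin_derivative_0:
  fixes A :: "'b::euclidean_space \<Rightarrow> 'a::euclidean_space \<Rightarrow> 'a"
  assumes "bilinear A"
  shows "((\<lambda>x. exp_lin (A x) v) has_derivative (\<lambda>x. A x v)) (at 0)"
proof -
  have l: "linear (A x)" for x using assms by (simp add: bilinear_def)
  note bl = bounded_linear_endo_of[OF assms]
  have "endo_of (A 0) = 0" using bl linear_0 linear_conv_bounded_linear by blast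
  then have "((\<lambda>x. exp (endo_of (A x))) has_derivative (\<lambda>h. endo_of (A h))) (at 0)"
    using has_derivative_compose[OF bounded_linear_imp_has_derivative[OF bl, of "at 0"], of exp "\<lambda>h. h"]
      has_derivative_exp_0 by simp
  from bounded_linear.has_derivative[OF bounded_linear_endo_apply this, of v]
  show ?thesis by (simp add: exp_lin_def endo_apply_endo_of l)
qed

section \<open>Entire functions of a real variable\<close>

text \<open>Extendability to the complex plane makes the identity theorem available. The class is
  closed under sums and products, hence under determinants of matrices with entries in it.\<close>

definition entire_real :: "(real \<Rightarrow> real) \<Rightarrow> bool" where
  "entire_real f \<longleftrightarrow> (\<exists>F. F holomorphic_on UNIV \<and> (\<forall>t. F (of_real t) = of_real (f t)))"

lemma entire_real_const: "entire_real (\<lambda>_. a)"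
  unfolding entire_real_def by (rule exI[of _ "\<lambda>_. of_real a"]) auto

lemma entire_real_add:
  assumes "entire_real f" "entire_real g"
  shows "entire_real (\<lambda>t. f t + g t)"
proof -
  obtain F H where "F holomorphic_on UNIV" "\<And>t. F (of_real t) = of_real (f t)"
      "H holomorphic_on UNIV" "\<And>t. H (of_real t) = of_real (g t)"
    using assms by (auto simp: entire_real_def)
  then show ?thesis
    unfolding entire_real_def by (intro exI[of _ "\<lambda>z. F z + H z"]) (simp add: holomorphic_on_add)
qed

lemma entire_real_mult:
  assumes "entire_real f" "entire_real g"
  shows "entire_real (\<lambda>t. f t * g t)"
proof -
  obtain F H where "F holomorphic_on UNIV" "\<And>t. F (of_real t) = of_real (f t)"
      "H holomorphic_on UNIV" "\<And>t. H (of_real t) = of_real (g t)"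
    using assms by (auto simp: entire_real_def)
  then show ?thesis
    unfolding entire_real_def by (intro exI[of _ "\<lambda>z. F z * H z"]) (simp add: holomorphic_on_mult)
qed

lemma entire_real_sum:
  assumes "\<And>i. i \<in> I \<Longrightarrow> entire_real (f i)"
  shows "entire_real (\<lambda>t. \<Sum>i\<in>I. f i t)"
  using assms
proof (induction I rule: infinite_finite_induct)
  case (insert j I)
  have "entire_real (\<lambda>t. f j t + (\<Sum>i\<in>I. f i t))"
    by (rule entire_real_add) (use insert.prems insert.IH in simp_all)
  then show ?case using insert.hyps by simp
qed (simp_all add: entire_real_const)

lemma entire_real_prod:
  assumes "\<And>i. i \<in> I \<Longrightarrow> entire_real (f i)"
  shows "entire_real (\<lambda>t. \<Prod>i\<in>I. f i t)"
  using assms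
proof (induction I rule: infinite_finite_induct)
  case (insert j I)
  have "entire_real (\<lambda>t. f j t * (\<Prod>i\<in>I. f i t))"
    by (rule entire_real_mult) (use insert.prems insert.IH in simp_all)
  then show ?case using insert.hyps by simp
qed (simp_all add: entire_real_const)

text \<open>The real interval accumulates at 0 in the complex plane, so the identity theorem applies
  to the extension.\<close>

lemma entire_real_zero:
  assumes "entire_real f" "d > 0" "\<And>t. \<bar>t\<bar> < d \<Longrightarrow> f t = 0"
  shows "f t = 0"
proof -
  obtain F where F: "F holomorphic_on UNIV" "\<And>t. F (of_real t) = of_real (f t)"
    using assms(1) by (auto simp: entire_real_def)
  have "F (of_real t) = 0"
  proof (rule analytic_continuation[OF F(1)])
    show "(0::complex) islimpt of_real ` {t. \<bar>t\<bar> < d}"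
      unfolding islimpt_approachable
    proof (intro allI impI)
      fix e :: real assume "e > 0"
      define r where "r = min e d / 2"
      have "0 < r" "r < e" "r < d" using \<open>e > 0\<close> assms(2) by (auto simp: r_def)
      then show "\<exists>x'\<in>complex_of_real ` {t. \<bar>t\<bar> < d}. x' \<noteq> 0 \<and> dist x' 0 < e"
        by (intro bexI[of _ "of_real r"]) auto
    qed
  qed (use F assms in auto)
  then show ?thesis using F(2) by simp
qed

lemma entire_real_continuous:
  assumes "entire_real f"
  shows "continuous_on UNIV f"
proof -
  obtain F where F: "F holomorphic_on UNIV" "\<And>t. F (of_real t) = of_real (f t)"
    using assms by (auto simp: entire_real_def)
  have "continuous_on UNIV (\<lambda>t. Re (F (of_real t)))"
    by (intro continuous_intros continuous_on_compose2[OF holomorphic_on_imp_continuous_on[OF F(1)]]) auto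
  then show ?thesis by (simp add: F(2))
qed

text \<open>A matrix coefficient is a power series in \<open>t\<close> that converges at every real
  \<open>t\<close>; such a series converges on the whole complex plane.\<close>

lemma entire_real_exp_lin:
  assumes "linear A"
  shows "entire_real (\<lambda>t. exp_lin (\<lambda>x. t *\<^sub>R A x) v \<bullet> w)"
proof -
  define a where "a n = ((A ^^ n) v \<bullet> w) / fact n" for n
  have sA: "((\<lambda>x. t *\<^sub>R A x) ^^ n) v = t ^ n *\<^sub>R (A ^^ n) v" for t n
    by (induction n) (simp_all add: linear_scale[OF assms])
  have sums: "(\<lambda>n. a n * t ^ n) sums (exp_lin (\<lambda>x. t *\<^sub>R A x) v \<bullet> w)" for t
  proof -
    have "(\<lambda>n. (((\<lambda>x. t *\<^sub>R A x) ^^ n) v /\<^sub>R fact n) \<bullet> w) sums (exp_lin (\<lambda>x. t *\<^sub>R A x) v \<bullet> w)"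
      by (rule bounded_linear.sums[OF bounded_linear_inner_left exp_lin_sums])
        (rule linear_compose_scale_right[OF assms])
    then show ?thesis by (simp add: sA a_def field_simps)
  qed
  \<comment> \<open>Convergence at the real point \<open>norm z + 1\<close>, which lies strictly
    farther from 0 than \<open>z\<close>, gives convergence at \<open>z\<close>.\<close>
  have summ: "summable (\<lambda>n. complex_of_real (a n) * z ^ n)" for z
  proof -
    have "summable (\<lambda>n. complex_of_real (a n) * of_real (norm z + 1) ^ n)"
      using sums_summable[OF sums_of_real[OF sums[of "norm z + 1"], where 'a = complex]] by simp
    then show ?thesis by (rule powser_inside) simp
  qed
  define F where "F z = (\<Sum>n. complex_of_real (a n) * z ^ n)" for z
  have Fs: "(\<lambda>n. complex_of_real (a n) * z ^ n) sums F z" for z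
    using summ[of z] by (simp add: F_def summable_sums)
  have "F holomorphic_on ball 0 r" for r
    by (rule power_series_holomorphic) (use Fs in simp)
  then have "F holomorphic_on (\<Union>r. ball 0 r)"
    by (intro holomorphic_on_UN_open) auto
  moreover have "(\<Union>r. ball (0::complex) r) = UNIV"
    by (auto intro: gt_ex)
  moreover have "F (of_real t) = of_real (exp_lin (\<lambda>x. t *\<^sub>R A x) v \<bullet> w)" for t
  proof (rule sums_unique2[OF Fs])
    show "(\<lambda>n. complex_of_real (a n) * of_real t ^ n) sums of_real (exp_lin (\<lambda>x. t *\<^sub>R A x) v \<bullet> w)"
      using sums_of_real[OF sums[of t], where 'a = complex] by simp
  qed
  ultimately show ?thesis unfolding entire_real_def by auto
qed

section \<open>Lie algebras and inner automorphisms\<close>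

lemma matrix_vector_matrix: "linear f \<Longrightarrow> matrix f *v v = f v" for f :: "real^'n \<Rightarrow> real^'m"
  by simp

lemma matrix_add: "matrix (\<lambda>x. f x + g x) = matrix f + matrix g"
  by (simp add: matrix_def vec_eq_iff)

lemma matrix_diff: "matrix (\<lambda>x. f x - g x) = matrix f - matrix g"
  by (simp add: matrix_def vec_eq_iff)

lemma matrix_scaleR: "matrix (\<lambda>x. r *\<^sub>R f x) = r *\<^sub>R matrix f"
  by (simp add: matrix_def vec_eq_iff)

lemma matrix_compose': "linear f \<Longrightarrow> linear g \<Longrightarrow> matrix (\<lambda>x. f (g x)) = matrix f ** matrix g"
  for f :: "real^'m \<Rightarrow> real^'k" and g :: "real^'n \<Rightarrow> real^'m"
  using matrix_compose[of g f] by (simp add: o_def)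

lemma continuous_on_matrix:
  fixes f :: "'a::topological_space \<Rightarrow> real^'n \<Rightarrow> real^'m"
  assumes "\<And>v. continuous_on S (\<lambda>x. f x v)"
  shows "continuous_on S (\<lambda>x. matrix (f x))"
  unfolding matrix_def
  by (intro continuous_on_vec_lambda continuous_on_component assms)

lemma has_derivative_matrix:
  fixes f :: "'a::real_normed_vector \<Rightarrow> real^'n \<Rightarrow> real^'m"
  assumes "\<And>v. ((\<lambda>x. f x v) has_derivative (\<lambda>h. f' h v)) (at a)"
  shows "((\<lambda>x. matrix (f x)) has_derivative (\<lambda>h. matrix (f' h))) (at a)"
proof (subst has_derivative_componentwise_within, intro ballI)
  fix b :: "real^'n^'m" assume "b \<in> Basis"
  then obtain i j where b: "b = axis i (axis j 1)" by (auto simp: Basis_vec_def)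
  have "matrix g \<bullet> b = g (axis j 1) $ i" for g :: "real^'n \<Rightarrow> real^'m"
    by (simp add: b inner_axis matrix_def)
  then show "((\<lambda>x. matrix (f x) \<bullet> b) has_derivative (\<lambda>h. matrix (f' h) \<bullet> b)) (at a)"
    using bounded_linear.has_derivative[OF bounded_linear_vec_nth[of i] assms[of "axis j 1"]] by simp
qed

lemma bounded_bilinear_matrix_mult:
  "bounded_bilinear ((**) :: real^'n^'m \<Rightarrow> real^'k^'n \<Rightarrow> real^'k^'m)"
proof -
  have "bilinear ((**) :: real^'n^'m \<Rightarrow> real^'k^'n \<Rightarrow> real^'k^'m)"
    unfolding bilinear_def
    by (auto simp: linear_iff matrix_add_ldistrib matrix_matrix_mult_def vec_eq_iff
        sum.distrib sum_distrib_left algebra_simps)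
  then show ?thesis by (simp add: bilinear_conv_bounded_bilinear)
qed

definition tr :: "(real^'n \<Rightarrow> real^'n) \<Rightarrow> real" where
  "tr f = trace (matrix f)"

lemma tr_add: "tr (\<lambda>x. f x + g x) = tr f + tr g"
  by (simp add: tr_def matrix_add trace_add)

lemma tr_diff: "tr (\<lambda>x. f x - g x) = tr f - tr g"
  by (simp add: tr_def matrix_diff trace_sub)

lemma tr_scaleR: "tr (\<lambda>x. r *\<^sub>R f x) = r * tr f"
  by (simp add: tr_def trace_def matrix_scaleR sum_distrib_left)

lemma tr_commute: "linear f \<Longrightarrow> linear g \<Longrightarrow> tr (\<lambda>x. f (g x)) = tr (\<lambda>x. g (f x))"
  using matrix_compose'[of f g] matrix_compose'[of g f] trace_mul_sym[of "matrix f" "matrix g"]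
  by (simp add: tr_def)

section \<open>Lie algebras and the Killing form\<close>

locale lie_algebra =
  fixes br :: "real^'n::finite \<Rightarrow> real^'n \<Rightarrow> real^'n"
  assumes bil: "bilinear br"
    and br_self: "br u u = 0"
    and jacobi: "br w (br u v) = br (br w u) v + br u (br w v)"
begin

lemma linear_br: "linear (br x)" and linear_br_left: "linear (\<lambda>x. br x y)"
  using bil by (simp_all add: bilinear_def)

lemma bbil: "bounded_bilinear br"
  using bil by (simp add: bilinear_conv_bounded_bilinear)

lemmas br_ladd = bilinear_ladd[OF bil] and br_radd = bilinear_radd[OF bil]
  and br_lsub = bilinear_lsub[OF bil] and br_rsub = bilinear_rsub[OF bil]
  and br_lmul = bilinear_lmul[OF bil] and br_rmul = bilinear_rmul[OF bil]
  and br_lneg = bilinear_lneg[OF bil] and br_rneg = bilinear_rneg[OF bil]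
  and br_lzero = bilinear_lzero[OF bil] and br_rzero = bilinear_rzero[OF bil]
lemmas br_simps = br_ladd br_radd br_lsub br_rsub br_lmul br_rmul br_lneg br_rneg br_lzero br_rzero

lemma br_anticommute: "br u v = - br v u"
proof -
  have "br (u + v) (u + v) = (br u u + br u v) + (br v u + br v v)"
    by (simp add: br_ladd br_radd)
  then have "br u v + br v u = 0" by (simp add: br_self)
  then show ?thesis by (simp add: eq_neg_iff_add_eq_0)
qed

lemma br_br_left: "br (br x y) z = br x (br y z) - br y (br x z)"
  using jacobi[of x y z] by simp

abbreviation "B \<equiv> killing br"

lemma B_tr: "B x y = tr (\<lambda>z. br x (br y z))"
  by (simp add: killing_def tr_def o_def)

lemma B_sym: "B x y = B y x"
  unfolding B_tr by (rule tr_commute[OF linear_br linear_br])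

lemma bilinear_B: "bilinear B"
proof -
  have 1: "linear (\<lambda>x. B x y)" for y
    by (rule linearI) (simp_all add: B_tr br_ladd br_lmul tr_add tr_scaleR)
  have "linear (B x)" for x using 1[of x] by (simp only: B_sym[of _ x])
  with 1 show ?thesis by (simp add: bilinear_def)
qed

lemmas B_simps = bilinear_ladd[OF bilinear_B] bilinear_radd[OF bilinear_B] bilinear_lsub[OF bilinear_B]
  bilinear_rsub[OF bilinear_B] bilinear_lmul[OF bilinear_B] bilinear_rmul[OF bilinear_B]
  bilinear_lneg[OF bilinear_B] bilinear_rneg[OF bilinear_B]
  bilinear_lzero[OF bilinear_B] bilinear_rzero[OF bilinear_B]

lemma linear_br_br: "linear (\<lambda>z. br x (br y z))"
  using linear_compose[OF linear_br linear_br] by (simp add: o_def)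

text \<open>Both sides expand into traces of triple products of adjoint maps, and these agree after
  one cyclic permutation.\<close>

lemma B_invariant: "B (br x y) z = B x (br y z)"
proof -
  have "B (br x y) z = tr (\<lambda>v. br x (br y (br z v))) - tr (\<lambda>v. br y (br x (br z v)))"
    unfolding B_tr br_br_left by (rule tr_diff)
  moreover have "B x (br y z) = tr (\<lambda>v. br x (br y (br z v))) - tr (\<lambda>v. br x (br z (br y v)))"
    unfolding B_tr br_br_left br_rsub by (rule tr_diff)
  moreover have "tr (\<lambda>v. br y (br x (br z v))) = tr (\<lambda>v. br x (br z (br y v)))"
    by (rule tr_commute[OF linear_br linear_br_br])
  ultimately show ?thesis by simp
qed

section \<open>Automorphisms and products of exponentials\<close>

abbreviation "finv \<equiv> inv_into UNIV"

definition aut :: "(real^'n \<Rightarrow> real^'n) \<Rightarrow> bool" where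
  "aut S \<longleftrightarrow> linear S \<and> bij S \<and> (\<forall>x y. S (br x y) = br (S x) (S y))"

lemma aut_id: "aut (\<lambda>x. x)"
  by (simp add: aut_def linear_iff bij_id[unfolded id_def])

lemma aut_compose: "aut S \<Longrightarrow> aut R \<Longrightarrow> aut (\<lambda>x. S (R x))"
  unfolding aut_def using bij_comp[of R S] linear_compose[of R S] by (simp add: o_def)

lemma aut_inv:
  assumes "aut S"
  shows "aut (finv S)" "S (finv S x) = x" "finv S (S x) = x"
proof -
  have b: "bij S" and l: "linear S" using assms by (auto simp: aut_def)
  show 1: "S (finv S x) = x" for x using b by (simp add: bij_is_surj surj_f_inv_f)
  show 2: "finv S (S x) = x" for x using b by (simp add: bij_is_inj)
  have "finv S (br x y) = br (finv S x) (finv S y)" for x y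
  proof -
    have "S (br (finv S x) (finv S y)) = br x y" using assms by (simp add: aut_def 1)
    then show ?thesis using 2 by metis
  qed
  moreover have "linear (finv S)"
    using l bij_is_inj[OF b] by (rule inj_linear_imp_inv_linear)
  ultimately show "aut (finv S)"
    using bij_imp_bij_inv[OF b] by (simp add: aut_def)
qed

lemma aut_linear: "aut S \<Longrightarrow> linear S" and aut_br: "aut S \<Longrightarrow> S (br x y) = br (S x) (S y)"
  and aut_inj: "aut S \<Longrightarrow> inj S"
  by (auto simp: aut_def bij_is_inj)

lemma aut_br': "aut S \<Longrightarrow> br (S x) y = S (br x (finv S y))"
  by (simp add: aut_br aut_inv)

text \<open>The map \<open>br (S x)\<close> is the conjugate of \<open>br x\<close> by
  \<open>S\<close>, and traces are invariant under conjugation.\<close>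

lemma B_aut:
  assumes "aut S"
  shows "B (S x) (S y) = B x y"
proof -
  have l: "linear S" "linear (finv S)" using assms aut_inv(1) aut_linear by blast+
  have "B (S x) (S y) = tr (\<lambda>z. S (br x (br y (finv S z))))"
    unfolding B_tr by (simp add: aut_br'[OF assms] aut_inv[OF assms])
  also have "\<dots> = tr (\<lambda>z. br x (br y (finv S (S z))))"
    using linear_compose[OF l(2) linear_br_br[of x y]] by (intro tr_commute[OF l(1)]) (simp add: o_def)
  finally show ?thesis by (simp add: B_tr aut_inv[OF assms])
qed

text \<open>Since \<open>br Y\<close> is a derivation, the bracket of the two flows solves the same
  linear differential equation as the flow of \<open>br u v\<close>, with the same initial
  value.\<close>

lemma aut_exp: "aut (exp_lin (br Y))"
proof -
  have "exp_lin (br Y) (br u v) = br (exp_lin (br Y) u) (exp_lin (br Y) v)" for u v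
  proof -
    let ?e = "\<lambda>t. exp_lin (\<lambda>x. t *\<^sub>R br Y x)"
    have "((\<lambda>t. br (?e t u) (?e t v)) has_vector_derivative br Y (br (?e t u) (?e t v))) (at t)" for t
      using bounded_bilinear.has_vector_derivative[OF bbil
          exp_lin_derivative[OF linear_br[of Y]] exp_lin_derivative[OF linear_br[of Y]]]
      by (simp add: jacobi[of Y] add.commute)
    from exp_lin_unique_solution[OF linear_br this, of 1]
    show ?thesis by (simp add: exp_lin_zero)
  qed
  moreover have "bij (exp_lin (br Y))"
    by (rule o_bij[of "exp_lin (\<lambda>x. - br Y x)"]) (simp_all add: fun_eq_iff exp_lin_minus linear_br)
  ultimately show ?thesis by (simp add: aut_def linear_exp_lin)
qed

lemma exp_lin_scaleR: "exp_lin (\<lambda>x. s *\<^sub>R br Y x) = exp_lin (br (s *\<^sub>R Y))"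
proof -
  have "br (s *\<^sub>R Y) = (\<lambda>x. s *\<^sub>R br Y x)" by (rule ext) (rule br_lmul)
  then show ?thesis by simp
qed

lemma exp_lin_br_zero: "exp_lin (br 0) v = v"
  by (rule exp_lin_fixed[OF linear_br]) (simp add: br_lzero)

lemma exp_lin_br_add: "exp_lin (br ((s + t) *\<^sub>R Y)) v = exp_lin (br (s *\<^sub>R Y)) (exp_lin (br (t *\<^sub>R Y)) v)"
  unfolding exp_lin_scaleR[symmetric] by (rule exp_lin_add[OF linear_br])

text \<open>The parameter \<open>s\<close> scales all exponents at once. For a fixed list this is an
  analytic path from the identity at \<open>s = 0\<close> to an arbitrary product of exponentials at
  \<open>s = 1\<close>.\<close>

primrec eprod :: "(real^'n) list \<Rightarrow> real \<Rightarrow> real^'n \<Rightarrow> real^'n" where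
  "eprod [] s v = v"
| "eprod (Y # Ys) s v = exp_lin (\<lambda>x. s *\<^sub>R br Y x) (eprod Ys s v)"

lemma eprod_append: "eprod (Xs @ Ys) s v = eprod Xs s (eprod Ys s v)"
  by (induction Xs) simp_all

lemma aut_eprod: "aut (eprod Ys s)"
proof (induction Ys)
  case (Cons Y Ys)
  have "eprod (Y # Ys) s = (\<lambda>v. exp_lin (br (s *\<^sub>R Y)) (eprod Ys s v))"
    by (simp add: fun_eq_iff exp_lin_scaleR)
  then show ?case using aut_compose[OF aut_exp Cons] by simp
next
  case Nil
  have "eprod [] s = (\<lambda>x. x)" by (simp add: fun_eq_iff)
  then show ?case using aut_id by simp
qed

lemma eprod_zero: "eprod Ys 0 v = v"
  by (induction Ys) (simp_all add: exp_lin_zero)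

lemma eprod_rev: "eprod (rev (map uminus Ys)) s (eprod Ys s v) = v"
proof (induction Ys arbitrary: v)
  case (Cons Y Ys)
  have "exp_lin (\<lambda>x. s *\<^sub>R br (- Y) x) (exp_lin (\<lambda>x. s *\<^sub>R br Y x) w) = w" for w
    using exp_lin_minus(2)[OF linear_compose_scale_right[OF linear_br, of s Y]] by (simp add: br_lneg)
  then show ?case by (simp add: eprod_append Cons)
qed simp

text \<open>Expanding the inner vector in the basis turns the coefficient into a sum of products of
  coefficients of the separate factors, so the induction stays inside the entire functions.\<close>

lemma entire_eprod: "entire_real (\<lambda>s. eprod Ys s v \<bullet> w)"
proof (induction Ys arbitrary: w)
  case (Cons Y Ys)
  have "eprod (Y # Ys) s v \<bullet> w =
      (\<Sum>b\<in>Basis. (eprod Ys s v \<bullet> b) * (exp_lin (\<lambda>x. s *\<^sub>R br Y x) b \<bullet> w))" for s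
  proof -
    have "eprod (Y # Ys) s v = exp_lin (\<lambda>x. s *\<^sub>R br Y x) (\<Sum>b\<in>Basis. (eprod Ys s v \<bullet> b) *\<^sub>R b)"
      by (simp add: euclidean_representation)
    also have "\<dots> = (\<Sum>b\<in>Basis. (eprod Ys s v \<bullet> b) *\<^sub>R exp_lin (\<lambda>x. s *\<^sub>R br Y x) b)"
      by (simp add: linear_sum[OF linear_exp_lin] linear_scale[OF linear_exp_lin])
    finally show ?thesis by (simp add: inner_sum_left)
  qed
  then show ?case
    by (simp del: eprod.simps add: entire_real_sum entire_real_mult Cons entire_real_exp_lin linear_br)
qed (simp add: entire_real_const)

lemma continuous_eprod: "continuous_on UNIV (\<lambda>s. eprod Ys s v)"
  by (rule continuous_on_componentwise[THEN iffD2]) (simp add: entire_real_continuous entire_eprod)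

text \<open>Inverses of exponentials are exponentials, so the finite products already form a group:
  the one generated by all \<open>exp_lin (br Y)\<close>.\<close>

definition inner_auts :: "(real^'n \<Rightarrow> real^'n) set" where
  "inner_auts = range (\<lambda>Ys. eprod Ys 1)"

lemma inner_aut: "S \<in> inner_auts \<Longrightarrow> aut S"
  by (auto simp: inner_auts_def aut_eprod)

lemma identity_inner: "(\<lambda>x. x) \<in> inner_auts"
proof -
  have "(\<lambda>x. x) = eprod [] 1" by (simp add: fun_eq_iff)
  then show ?thesis by (auto simp: inner_auts_def)
qed

lemma inner_compose: "S \<in> inner_auts \<Longrightarrow> R \<in> inner_auts \<Longrightarrow> (\<lambda>x. S (R x)) \<in> inner_auts"
  unfolding inner_auts_def using eprod_append[symmetric] by auto

lemma inner_exp: "exp_lin (br Y) \<in> inner_auts"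
proof -
  have "exp_lin (br Y) = eprod [Y] 1" by (simp add: fun_eq_iff)
  then show ?thesis by (auto simp: inner_auts_def)
qed

lemma inner_inv:
  assumes "S \<in> inner_auts"
  shows "finv S \<in> inner_auts"
proof -
  obtain Ys where S: "S = eprod Ys 1" using assms by (auto simp: inner_auts_def)
  have "finv S x = eprod (rev (map uminus Ys)) 1 x" for x
    using eprod_rev[of Ys 1 "finv S x"] aut_inv[OF inner_aut[OF assms]] S by simp
  then have "finv S = eprod (rev (map uminus Ys)) 1" by (rule ext)
  then show ?thesis by (auto simp: inner_auts_def)
qed

end

section \<open>Complements of subspaces\<close>

lemma complementary_projection:
  fixes W W' :: "'a::real_vector set"
  assumes W: "subspace W" "subspace W'" "W \<inter> W' = {0}"
    and ex: "\<And>v. \<exists>a\<in>W. \<exists>b\<in>W'. v = a + b"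
  obtains p where "linear p" "\<And>v. p v \<in> W" "\<And>v. v - p v \<in> W'"
    "\<And>v. v \<in> W \<Longrightarrow> p v = v" "\<And>v. v \<in> W' \<Longrightarrow> p v = 0"
proof -
  have "\<exists>p. \<forall>v. p v \<in> W \<and> v - p v \<in> W'"
  proof (rule choice, rule allI)
    fix v
    obtain a b where "a \<in> W" "b \<in> W'" "v = a + b" using ex by blast
    then show "\<exists>y. y \<in> W \<and> v - y \<in> W'" by (intro exI[of _ a]) simp
  qed
  then obtain p where p: "\<And>v. p v \<in> W" "\<And>v. v - p v \<in> W'" by blast
  \<comment> \<open>Uniqueness of the component gives linearity and the values on both subspaces at
    once.\<close>
  have uniq: "a = p v" if "a \<in> W" "v - a \<in> W'" for a v
  proof -
    have "a - p v \<in> W" using W(1) that(1) p(1) by (rule subspace_diff)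
    moreover have "(v - p v) - (v - a) \<in> W'" using W(2) p(2) that(2) by (rule subspace_diff)
    ultimately have "a - p v \<in> W \<inter> W'" by simp
    then show ?thesis using W(3) by simp
  qed
  show ?thesis
  proof (rule that[of p])
    show "linear p"
    proof
      show "p (x + y) = p x + p y" for x y
      proof (rule uniq[symmetric])
        have "(x - p x) + (y - p y) \<in> W'" by (intro subspace_add W p)
        then show "x + y - (p x + p y) \<in> W'" by (simp add: algebra_simps)
      qed (intro subspace_add W p)
      show "p (r *\<^sub>R x) = r *\<^sub>R p x" for r x
      proof (rule uniq[symmetric])
        have "r *\<^sub>R (x - p x) \<in> W'" by (intro subspace_scale W p)
        then show "r *\<^sub>R x - r *\<^sub>R p x \<in> W'" by (simp add: algebra_simps)
      qed (intro subspace_scale W p)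
    qed
    show "p v = v" if "v \<in> W" for v using uniq[of v v] that subspace_0[OF W(2)] by simp
    show "p v = 0" if "v \<in> W'" for v using uniq[of 0 v] that subspace_0[OF W(1)] by simp
  qed (use p in auto)
qed

lemma linear_inj_on_subspace_surj:
  fixes f :: "'a::euclidean_space \<Rightarrow> 'a"
  assumes "linear f" "subspace W" "\<And>w. w \<in> W \<Longrightarrow> f w \<in> W" "\<And>w. w \<in> W \<Longrightarrow> f w = 0 \<Longrightarrow> w = 0"
  shows "f ` W = W"
proof -
  have "inj_on f W"
  proof (rule inj_onI)
    fix x y assume xy: "x \<in> W" "y \<in> W" "f x = f y"
    then have "f (x - y) = 0" using linear_diff[OF assms(1)] by simp
    then show "x = y" using assms(4)[of "x - y"] subspace_diff[OF assms(2)] xy by simp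
  qed
  then have "dim (f ` W) = dim W"
    using dim_image_eq[OF assms(1), of W] span_eq_iff[THEN iffD2, OF assms(2)] by simp
  moreover have "subspace (f ` W)" using assms linear_subspace_image by blast
  moreover have "f ` W \<subseteq> W" using assms(3) by blast
  ultimately show ?thesis using subspace_dim_equal[of "f ` W" W] assms(2) by simp
qed

lemma norm_vec_le_sum: "norm (x :: 'a::real_normed_vector ^ 'n) \<le> (\<Sum>i\<in>UNIV. norm (x $ i))"
  unfolding norm_vec_def by (rule L2_set_le_sum) simp

lemma bounded_bilinear_matrix_vector_mult:
  "bounded_bilinear ((*v) :: real^'n^'m \<Rightarrow> real^'n \<Rightarrow> real^'m)"
proof -
  have "bilinear ((*v) :: real^'n^'m \<Rightarrow> real^'n \<Rightarrow> real^'m)"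
    unfolding bilinear_def
    by (auto simp: linear_iff matrix_vector_mult_def vec_eq_iff
        sum.distrib sum_distrib_left algebra_simps)
  then show ?thesis by (simp add: bilinear_conv_bounded_bilinear)
qed

section \<open>Derivations and small automorphisms\<close>

locale cartan_pair = lie_algebra br
  for br :: "real^'n::finite \<Rightarrow> real^'n \<Rightarrow> real^'n" +
  fixes \<theta> :: "real^'n \<Rightarrow> real^'n"
  assumes cinv: "cartan_involution br \<theta>"
begin

lemma linear_theta: "linear \<theta>" and theta_br: "\<theta> (br x y) = br (\<theta> x) (\<theta> y)"
  and theta_theta: "\<theta> (\<theta> x) = x" and B_theta_pos: "x \<noteq> 0 \<Longrightarrow> B x (\<theta> x) < 0"
  using cinv by (auto simp: cartan_involution_def)

text \<open>By definition of a Cartan involution, \<open>\<theta> x\<close> is a witness that pairs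
  nontrivially with \<open>x\<close>.\<close>

lemma nondegenerate: "(\<And>y. B x y = 0) \<Longrightarrow> x = 0"
  using B_theta_pos[of x] by force

lemma centerless:
  assumes "\<And>y. br x y = 0"
  shows "x = 0"
proof (rule nondegenerate)
  fix y
  have "B x y = tr (\<lambda>z::real^'n. 0)" by (simp add: B_tr assms)
  also have "tr (\<lambda>z::real^'n. 0) = 0" by (simp add: tr_def trace_def matrix_def)
  finally show "B x y = 0" .
qed

text \<open>Nondegeneracy represents the functional \<open>?\<phi>\<close>, the trace of
  \<open>D\<close> composed with \<open>br x\<close>, as pairing with some \<open>d\<close>. This
  \<open>d\<close> is the element sought.\<close>

lemma derivation_inner:
  assumes D: "linear D" "\<And>x y. D (br x y) = br (D x) y + br x (D y)"
  obtains d where "D = br d"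
proof -
  let ?J = "\<lambda>d. (\<chi> i. B d (axis i 1)) :: real^'n"
  let ?\<phi> = "\<lambda>x. tr (\<lambda>v. D (br x v))"
  have lin\<phi>: "linear ?\<phi>"
    by (rule linearI)
      (simp_all add: br_ladd br_lmul linear_add[OF D(1)] linear_scale[OF D(1)] tr_add tr_scaleR)
  have basis: "x = (\<Sum>i\<in>UNIV. (x $ i) *\<^sub>R axis i 1)" for x :: "real^'n"
    by (simp add: vec_eq_iff axis_def if_distrib sum.If_cases cong: if_cong)
  have J: "linear ?J"
    by (rule linearI) (simp_all add: vec_eq_iff B_simps)
  moreover have "inj ?J"
    unfolding linear_injective_0[OF J]
  proof (intro allI impI)
    fix d assume "?J d = 0"
    then have z: "B d (axis i 1) = 0" for i by (simp add: vec_eq_iff)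
    show "d = 0"
    proof (rule nondegenerate)
      fix y
      have "B d y = B d (\<Sum>i\<in>UNIV. (y $ i) *\<^sub>R axis i 1)" using basis[of y] by simp
      also have "\<dots> = (\<Sum>i\<in>UNIV. (y $ i) * B d (axis i 1))"
        using bilinear_B by (simp add: bilinear_def linear_sum linear_scale)
      finally show "B d y = 0" by (simp add: z)
    qed
  qed
  ultimately have "surj ?J" by (rule linear_injective_imp_surjective) simp
  from surjD[OF this, of "\<chi> i. ?\<phi> (axis i 1)"]
  obtain d where "(\<chi> i. ?\<phi> (axis i 1)) = ?J d" ..
  then have di: "B d (axis i 1) = ?\<phi> (axis i 1)" for i by (simp add: vec_eq_iff)
  have d: "B d x = ?\<phi> x" for x
  proof -
    have "B d (\<Sum>i\<in>UNIV. (x $ i) *\<^sub>R axis i 1) = (\<Sum>i\<in>UNIV. (x $ i) * B d (axis i 1))"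
      using bilinear_B by (simp add: bilinear_def linear_sum linear_scale)
    also have "\<dots> = ?\<phi> (\<Sum>i\<in>UNIV. (x $ i) *\<^sub>R axis i 1)"
      by (simp add: di linear_sum[OF lin\<phi>] linear_scale[OF lin\<phi>])
    finally show ?thesis using basis[of x] by simp
  qed
  have "D x = br d x" for x
  proof -
    have "D x - br d x = 0"
    proof (rule nondegenerate)
      fix y
      \<comment> \<open>For a derivation, \<open>br (D x)\<close> is the commutator of
        \<open>D\<close> and \<open>br x\<close>; cyclicity of the trace then moves \<open>D\<close>
        to the front, where the functional \<open>?\<phi>\<close> can be recognized.\<close>
      have "tr (\<lambda>v. br (D x) (br y v)) = tr (\<lambda>v. D (br x (br y v))) - tr (\<lambda>v. br x (D (br y v)))"
        by (subst tr_diff[symmetric]) (simp add: D(2))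
      also have "tr (\<lambda>v. br x (D (br y v))) = tr (\<lambda>v. D (br y (br x v)))"
        using linear_compose[OF linear_br D(1)] by (intro tr_commute[OF linear_br]) (simp add: o_def)
      also have "tr (\<lambda>v. D (br x (br y v))) - tr (\<lambda>v. D (br y (br x v))) = ?\<phi> (br x y)"
        by (subst tr_diff[symmetric]) (simp add: br_br_left linear_diff[OF D(1)])
      finally have "B (D x) y = B d (br x y)" by (simp only: d B_tr[of "D x"])
      then show "B (D x - br d x) y = 0" by (simp add: B_simps B_invariant)
    qed
    then show ?thesis by simp
  qed
  then show ?thesis using that by blast
qed

text \<open>The kernel of \<open>g\<close> serves as a linear complement to the inner derivations in
  the space of all matrices.\<close>

lemma ad_left_inverse:
  obtains g :: "real^'n^'n \<Rightarrow> real^'n" where "linear g" "\<And>u. g (matrix (br u)) = u"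
proof -
  have l: "linear (\<lambda>u. matrix (br u))"
    by (rule linearI) (simp_all add: matrix_def vec_eq_iff br_simps)
  have "inj (\<lambda>u. matrix (br u))"
    unfolding linear_injective_0[OF l]
  proof (intro allI impI)
    fix u assume "matrix (br u) = 0"
    then have "br u y = 0" for y using matrix_vector_matrix[OF linear_br, of u y] by simp
    then show "u = 0" by (rule centerless)
  qed
  then obtain g where "linear g" "g \<circ> (\<lambda>u. matrix (br u)) = id"
    using linear_injective_left_inverse[OF l] by blast
  then show ?thesis using that[of g] by (metis comp_apply id_apply)
qed

text \<open>A small automorphism \<open>1 + E\<close> fails to be a derivation only to second order in \<open>E\<close>, so
  it is trivial when \<open>E\<close> lies in a complement of the derivations.\<close>

lemma aut_near_id:
  assumes g: "linear g" "\<And>u. g (matrix (br u)) = u"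
  obtains \<eta> where "\<eta> > 0"
    "\<And>E. g E = 0 \<Longrightarrow> norm E < \<eta> \<Longrightarrow> aut (\<lambda>v. v + E *v v) \<Longrightarrow> E = 0"
proof -
  let ?e = "\<lambda>i::'n. axis i 1 :: real^'n"
  \<comment> \<open>The defect of \<open>E\<close> from being a derivation, tested on pairs of basis
    vectors; this makes it a linear map between finite-dimensional spaces.\<close>
  define \<Delta> :: "real^'n^'n \<Rightarrow> real^'n^'n^'n" where
    "\<Delta> E = (\<chi> i j. E *v br (?e i) (?e j) - br (E *v ?e i) (?e j) - br (?e i) (E *v ?e j))" for E
  have lin: "linear \<Delta>"
    by (rule linearI)
      (simp_all add: \<Delta>_def vec_eq_iff matrix_vector_mult_add_rdistrib scaleR_matrix_vector_assoc[symmetric]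
        br_simps algebra_simps)
  have sub: "subspace {E. g E = 0}" using g(1) by (rule linear_subspace_kernel)
  have basis: "x = (\<Sum>i\<in>UNIV. (x $ i) *\<^sub>R ?e i)" for x :: "real^'n"
    by (simp add: vec_eq_iff axis_def if_distrib sum.If_cases cong: if_cong)
  have inj: "E = 0" if "g E = 0" "\<Delta> E = 0" for E
  proof -
    let ?f = "\<lambda>x y. E *v br x y" and ?h = "\<lambda>x y. br (E *v x) y + br x (E *v y)"
    have 1: "bilinear ?f" "bilinear ?h"
      unfolding bilinear_def linear_iff
      by (simp_all add: br_simps matrix_vector_right_distrib algebra_simps)
    have "?f x y = ?h x y" for x y
    proof (rule bilinear_eq[OF 1, of UNIV Basis UNIV Basis])
      fix a b :: "real^'n" assume "a \<in> Basis" "b \<in> Basis"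
      then obtain i j where ij: "a = ?e i" "b = ?e j" by (auto simp: Basis_vec_def)
      have "\<Delta> E $ i $ j = 0" using that by simp
      then show "?f a b = ?h a b" by (simp add: \<Delta>_def ij algebra_simps)
    qed (simp_all add: span_Basis)
    then obtain d where d: "(*v) E = br d"
      using derivation_inner[of "(*v) E"] by auto
    then have "E = matrix (br d)" by (metis matrix_of_matrix_vector_mul)
    moreover have "d = 0" using that(1) g(2)[of d] calculation by simp
    ultimately show ?thesis by (simp add: d[symmetric] br_lzero matrix_def vec_eq_iff)
  qed
  \<comment> \<open>On the complement \<open>\<Delta>\<close> is injective, which in finite
    dimension amounts to a lower bound.\<close>
  obtain e where e: "e > 0" "\<And>E. g E = 0 \<Longrightarrow> norm (\<Delta> E) \<ge> e * norm E"
    using injective_imp_isometric[OF closed_subspace[OF sub] sub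
        lin[unfolded linear_conv_bounded_linear]] inj by auto
  obtain K where K: "K > 0" "\<And>x y. norm (br x y) \<le> norm x * norm y * K"
    using bounded_bilinear.pos_bounded[OF bbil] by blast
  obtain L where L: "L > 0" "\<And>E v. norm (E *v v :: real^'n) \<le> norm (E :: real^'n^'n) * norm v * L"
    using bounded_bilinear.pos_bounded[OF bounded_bilinear_matrix_vector_mult] by blast
  \<comment> \<open>The product \<open>L * L * K\<close> bounds the bracket of the images of two
    basis vectors under \<open>E\<close>, up to the square of \<open>norm E\<close>; the factors
    \<open>CARD('n)\<close> come from summing over the two indices.\<close>
  define C where "C = real (CARD('n)) * (real (CARD('n)) * (L * L * K))"
  have C: "C > 0" using L K by (simp add: C_def)
  have upper: "norm (\<Delta> E) \<le> C * (norm E * norm E)" if "aut (\<lambda>v. v + E *v v)" for E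
  proof -
    have eq: "E *v br x y - br (E *v x) y - br x (E *v y) = br (E *v x) (E *v y)" for x y
    proof -
      have "br x y + E *v br x y = br (x + E *v x) (y + E *v y)" using aut_br[OF that] by simp
      then show ?thesis by (simp add: br_simps algebra_simps)
    qed
    have "norm (br (E *v ?e i) (E *v ?e j)) \<le> norm E * norm E * (L * L * K)" for i j
    proof -
      have *: "norm (E *v ?e i) \<le> norm E * L" for i using L(2)[of E "?e i"] by (simp add: norm_axis_1)
      have "norm (br (E *v ?e i) (E *v ?e j)) \<le> norm (E *v ?e i) * norm (E *v ?e j) * K" by (rule K)
      also have "\<dots> \<le> (norm E * L) * (norm E * L) * K"
        using K L * by (intro mult_right_mono mult_mono) auto
      finally show ?thesis by (simp add: mult_ac)
    qed
    then have 1: "norm (\<Delta> E $ i $ j) \<le> norm E * norm E * (L * L * K)" for i j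
      by (simp add: \<Delta>_def eq)
    have 2: "norm (\<Delta> E $ i) \<le> real (CARD('n)) * (norm E * norm E * (L * L * K))" for i
      using order_trans[OF norm_vec_le_sum sum_bounded_above[of UNIV "\<lambda>j. norm (\<Delta> E $ i $ j)", OF 1]] by simp
    have "norm (\<Delta> E) \<le> real (CARD('n)) * (real (CARD('n)) * (norm E * norm E * (L * L * K)))"
      using order_trans[OF norm_vec_le_sum sum_bounded_above[of UNIV "\<lambda>i. norm (\<Delta> E $ i)", OF 2]] by simp
    then show ?thesis by (simp add: C_def mult_ac)
  qed
  \<comment> \<open>The lower bound is linear in \<open>norm E\<close> with constant
    \<open>e\<close>, the upper bound quadratic with constant \<open>C\<close>; together they
    exclude \<open>0 < norm E < e / C\<close>.\<close>
  show ?thesis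
  proof (rule that[of "e / C"])
    fix E assume E: "g E = 0" "norm E < e / C" "aut (\<lambda>v. v + E *v v)"
    show "E = 0"
    proof (rule ccontr)
      assume "E \<noteq> 0"
      have "e * norm E \<le> C * (norm E * norm E)" using e(2)[OF E(1)] upper[OF E(3)] by linarith
      then have "e \<le> C * norm E" using \<open>E \<noteq> 0\<close> by simp
      then show False using E(2) C by (simp add: field_simps)
    qed
  qed (use e C in simp)
qed

text \<open>The family is enlarged by factors \<open>1 + E\<close>, with \<open>E\<close> in the
  complement of the derivations, until it covers all matrices near \<open>f 0\<close>. The open
  mapping theorem used here asks for a right inverse of the derivative at one point only. For an
  automorphism the extra factor is itself an automorphism and is trivial by
  \<open>aut_near_id\<close>.\<close>

lemma aut_open_mapping:
  fixes f :: "'a::euclidean_space \<Rightarrow> real^'n \<Rightarrow> real^'n"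
  assumes S: "open S" "0 \<in> S" and cont: "\<And>v. continuous_on S (\<lambda>x. f x v)"
    and aut: "\<And>x. x \<in> S \<Longrightarrow> aut (f x)"
    and der: "\<And>v. ((\<lambda>x. f x v) has_derivative (\<lambda>h. f 0 (br (l h) v))) (at 0)"
    and l: "linear r" "\<And>y. l (r y) = y"
    and \<delta>: "\<delta> > 0"
  obtains \<epsilon> where "\<epsilon> > 0"
    "\<And>P. aut P \<Longrightarrow> norm (matrix P - matrix (f 0)) < \<epsilon> \<Longrightarrow> \<exists>x\<in>S. norm x < \<delta> \<and> P = f x"
proof -
  obtain g :: "real^'n^'n \<Rightarrow> real^'n" where g: "linear g" "\<And>u. g (matrix (br u)) = u"
    using ad_left_inverse by blast
  obtain \<eta> where \<eta>: "\<eta> > 0" "\<And>E. g E = 0 \<Longrightarrow> norm E < \<eta> \<Longrightarrow> aut (\<lambda>v. v + E *v v) \<Longrightarrow> E = 0"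
    using aut_near_id[OF g] by blast
  have l_ad: "linear (\<lambda>u. matrix (br u))"
    by (rule linearI) (simp_all add: matrix_def vec_eq_iff br_simps)
  define p where "p M = M - matrix (br (g M))" for M
  have p: "linear p"
    unfolding p_def using linear_compose[OF g(1) l_ad]
    by (intro linear_compose_sub linear_ident) (simp add: o_def)
  have gp: "g (p M) = 0" for M by (simp add: p_def linear_diff[OF g(1)] g(2))
  have bp: "bounded_linear p" using p by (simp add: linear_conv_bounded_linear)
  \<comment> \<open>Since \<open>p\<close> projects onto the kernel of \<open>g\<close>, the second
    argument contributes only to the complement of the inner derivations.\<close>
  define F :: "'a \<times> (real^'n^'n) \<Rightarrow> real^'n^'n" where
    "F z = matrix (f (fst z)) ** (mat 1 + p (snd z))" for z
  let ?D = "S \<times> (UNIV :: (real^'n^'n) set)"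
  have contF: "continuous_on ?D F"
  proof -
    have 1: "continuous_on ?D (\<lambda>z. matrix (f (fst z)))"
      by (rule continuous_on_compose2[OF continuous_on_matrix[OF cont]]) (auto intro: continuous_intros)
    have 2: "continuous_on ?D (\<lambda>z. mat 1 + p (snd z))"
      by (intro continuous_intros bounded_linear.continuous_on[OF bp])
    show ?thesis
      unfolding F_def[abs_def]
      by (rule bounded_bilinear.continuous_on[OF bounded_bilinear_matrix_mult 1 2])
  qed
  let ?F' = "\<lambda>h. matrix (f 0) ** p (snd h) + matrix (\<lambda>v. f 0 (br (l (fst h)) v)) ** mat 1"
  have derF: "(F has_derivative ?F') (at 0)"
  proof -
    have 1: "((\<lambda>z. matrix (f (fst z))) has_derivative (\<lambda>h. matrix (\<lambda>v. f 0 (br (l (fst h)) v))))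
        (at (0 :: 'a \<times> (real^'n^'n)))"
      by (rule has_derivative_compose[OF has_derivative_fst[OF has_derivative_ident]])
        (simp add: has_derivative_matrix[OF der])
    have 2: "((\<lambda>z. mat 1 + p (snd z)) has_derivative (\<lambda>h. p (snd h))) (at (0 :: 'a \<times> (real^'n^'n)))"
      by (auto intro!: derivative_eq_intros bounded_linear.has_derivative[OF bp])
    show ?thesis
      using bounded_bilinear.FDERIV[OF bounded_bilinear_matrix_mult 1 2]
      by (simp add: F_def[abs_def] linear_0[OF p])
  qed
  have aut0: "aut (f 0)" using aut S by blast
  define Qi where "Qi = matrix (finv (f 0))"
  have Qi: "matrix (f 0) ** Qi = mat 1"
    unfolding Qi_def using aut_linear[OF aut0] aut_linear[OF aut_inv(1)[OF aut0]]
    by (subst matrix_compose'[symmetric]) (simp_all add: aut_inv[OF aut0] matrix_id_mat_1[unfolded id_def])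
  \<comment> \<open>After division by \<open>f 0\<close>, the inner part of \<open>N\<close> is
    lifted through \<open>r\<close> to a parameter of the family, and \<open>p\<close> accounts for
    the rest.\<close>
  define G where "G N = (r (g (Qi ** N)), Qi ** N)" for N :: "real^'n^'n"
  have "linear G"
  proof -
    have q: "linear (\<lambda>N :: real^'n^'n. Qi ** N)"
      using bounded_bilinear.bounded_linear_right[OF bounded_bilinear_matrix_mult, of Qi]
      by (simp add: linear_conv_bounded_linear)
    show ?thesis
      by (rule linearI)
        (simp_all add: G_def linear_add[OF q] linear_scale[OF q] linear_add[OF g(1)] linear_scale[OF g(1)]
          linear_add[OF l(1)] linear_scale[OF l(1)])
  qed
  then have bG: "bounded_linear G" by (simp add: linear_conv_bounded_linear)
  have FG: "?F' \<circ> G = id"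
  proof
    fix N :: "real^'n^'n"
    have "matrix (\<lambda>v. f 0 (br (g (Qi ** N)) v)) = matrix (f 0) ** matrix (br (g (Qi ** N)))"
      by (rule matrix_compose'[OF aut_linear[OF aut0] linear_br])
    then have "(?F' \<circ> G) N = matrix (f 0) ** (p (Qi ** N) + matrix (br (g (Qi ** N))))"
      by (simp add: G_def l(2) matrix_add_ldistrib)
    also have "\<dots> = N" by (simp add: p_def matrix_mul_assoc Qi)
    finally show "(?F' \<circ> G) N = id N" by simp
  qed
  define T where "T = {z. fst z \<in> S \<and> norm (fst z) < \<delta> \<and> norm (p (snd z)) < \<eta>}"
  have "open T"
  proof -
    have "open {z :: 'a \<times> (real^'n^'n). norm (p (snd z)) < \<eta>}"
      by (intro open_Collect_less continuous_intros bounded_linear.continuous_on[OF bp])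
    moreover have "open {z :: 'a \<times> (real^'n^'n). norm (fst z) < \<delta>}"
      by (intro open_Collect_less continuous_intros)
    ultimately have "open (S \<times> UNIV \<inter> {z. norm (fst z) < \<delta>} \<inter> {z :: 'a \<times> (real^'n^'n). norm (p (snd z)) < \<eta>})"
      using S by (intro open_Int open_Times) auto
    moreover have "T = S \<times> UNIV \<inter> {z. norm (fst z) < \<delta>} \<inter> {z :: 'a \<times> (real^'n^'n). norm (p (snd z)) < \<eta>}"
      by (auto simp: T_def)
    ultimately show ?thesis by simp
  qed
  moreover have "0 \<in> T" using S \<delta> \<eta> by (simp add: T_def linear_0[OF p])
  ultimately have "F 0 \<in> interior (F ` T)"
    by (intro sussmann_open_mapping[OF _ contF _ derF bG FG])
      (use S in \<open>auto simp: T_def interior_open open_Times zero_prod_def\<close>)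
  moreover have "F 0 = matrix (f 0)" by (simp add: F_def linear_0[OF p])
  ultimately obtain \<epsilon> where \<epsilon>: "\<epsilon> > 0" "ball (matrix (f 0)) \<epsilon> \<subseteq> F ` T"
    by (auto simp: mem_interior)
  show ?thesis
  proof (rule that[OF \<epsilon>(1)])
    fix P assume P: "aut P" "norm (matrix P - matrix (f 0)) < \<epsilon>"
    then have "matrix P \<in> ball (matrix (f 0)) \<epsilon>" by (simp add: dist_norm norm_minus_commute)
    then obtain x M where xM: "matrix P = F (x, M)" "(x, M) \<in> T" using \<epsilon>(2) by auto
    then have x: "x \<in> S" "norm x < \<delta>" "norm (p M) < \<eta>" by (auto simp: T_def)
    note ax = aut[OF x(1)]
    have Pv: "P v = f x (v + p M *v v)" for v
    proof -
      have "P v = matrix P *v v" using aut_linear[OF P(1)] by simp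
      also have "\<dots> = matrix (f x) *v ((mat 1 + p M) *v v)"
        by (simp add: xM(1) F_def matrix_vector_mul_assoc)
      finally show ?thesis
        using aut_linear[OF ax] by (simp add: matrix_vector_mult_add_rdistrib)
    qed
    have "(\<lambda>v. v + p M *v v) = (\<lambda>v. finv (f x) (P v))"
      by (simp add: Pv aut_inv[OF ax])
    then have "aut (\<lambda>v. v + p M *v v)"
      using aut_compose[OF aut_inv(1)[OF ax] P(1)] by simp
    then have "p M = 0" using \<eta>(2)[OF gp x(3)] by blast
    then have "P = f x" using Pv by (simp add: fun_eq_iff)
    then show "\<exists>x\<in>S. norm x < \<delta> \<and> P = f x" using x by blast
  qed
qed

end

section \<open>Theta-stable Cartan subalgebras\<close>

lemma linear_funpow:
  fixes f :: "'a::real_vector \<Rightarrow> 'a"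
  assumes "linear f"
  shows "linear (f ^^ k)"
proof (induction k)
  case 0
  then show ?case by (simp add: linear_iff)
next
  case (Suc k)
  then show ?case using linear_compose[OF Suc assms] by (simp add: o_def)
qed

lemma funpow_kernel_stabilizes:
  fixes f :: "'a::euclidean_space \<Rightarrow> 'a"
  assumes f: "linear f"
  obtains N where "\<And>v. (f ^^ Suc N) v = 0 \<Longrightarrow> (f ^^ N) v = 0"
proof -
  have lin: "linear (f ^^ k)" for k by (rule linear_funpow[OF f])
  have sub: "subspace {v. (f ^^ k) v = 0}" for k by (rule linear_subspace_kernel[OF lin])
  \<comment> \<open>Choose \<open>N\<close> where the kernel has the largest dimension; as kernels
    of powers increase, the next one cannot be larger.\<close>
  have "\<exists>N. True \<and> (\<forall>k. True \<longrightarrow> dim {v. (f ^^ k) v = 0} \<le> dim {v. (f ^^ N) v = 0})"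
    by (rule ex_has_greatest_nat[of "\<lambda>_. True" 0 "\<lambda>k. dim {v. (f ^^ k) v = 0}" "Suc DIM('a)"])
      (simp_all add: less_Suc_eq_le dim_subset_UNIV)
  then obtain N where N: "\<And>k. dim {v. (f ^^ k) v = 0} \<le> dim {v. (f ^^ N) v = 0}" by blast
  have "{v. (f ^^ N) v = 0} \<subseteq> {v. (f ^^ Suc N) v = 0}" by (auto simp: linear_0[OF f])
  from subspace_dim_equal[OF sub sub this N]
  have "{v. (f ^^ N) v = 0} = {v. (f ^^ Suc N) v = 0}" .
  then show ?thesis using that[of N] by blast
qed

text \<open>Once the kernels of the powers have stabilized, \<open>f\<close> is injective on the
  range of that power, and injectivity in finite dimension gives a lower bound.\<close>

lemma funpow_range_bounded_below:
  fixes f :: "'a::euclidean_space \<Rightarrow> 'a"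
  assumes f: "linear f"
  obtains N c where "c > 0" "\<And>v. norm (f ((f ^^ N) v)) \<ge> c * norm ((f ^^ N) v)"
proof -
  obtain N where N: "\<And>v. (f ^^ Suc N) v = 0 \<Longrightarrow> (f ^^ N) v = 0"
    using funpow_kernel_stabilizes[OF f] by blast
  have lin: "linear (f ^^ N)" by (rule linear_funpow[OF f])
  have sub: "subspace (range (f ^^ N))" by (rule linear_subspace_image[OF lin subspace_UNIV])
  have "\<forall>x\<in>range (f ^^ N). f x = 0 \<longrightarrow> x = 0" using N by auto
  then obtain c where "c > 0" "\<forall>x\<in>range (f ^^ N). norm (f x) \<ge> c * norm x"
    using injective_imp_isometric[OF closed_subspace[OF sub] sub] f linear_conv_bounded_linear by blast
  then show ?thesis using that[of c N] by blast
qed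

section \<open>The splitting into a Cartan subalgebra and the range of \<open>br X\<close>\<close>

locale theta_cartan = cartan_pair br \<theta>
  for br :: "real^'n::finite \<Rightarrow> real^'n \<Rightarrow> real^'n" and \<theta> :: "real^'n \<Rightarrow> real^'n" +
  fixes X :: "real^'n"
  assumes tsc: "theta_stable_cartan br \<theta> (stabilizer_algebra br X)"
begin

definition "hh = stabilizer_algebra br X"
text \<open>After complexification this is the sum of the root spaces of \<open>hh\<close>. As a
  range it is visibly invariant under every map that commutes with \<open>br X\<close>.\<close>

definition "mm = range (br X)"

lemma hh_iff: "y \<in> hh \<longleftrightarrow> br X y = 0"
  by (simp add: hh_def stabilizer_algebra_def)

lemma subspace_hh: "subspace hh"
  unfolding hh_def stabilizer_algebra_def by (rule linear_subspace_kernel[OF linear_br])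

lemma subspace_mm: "subspace mm"
  unfolding mm_def by (rule linear_subspace_image[OF linear_br subspace_UNIV])

lemma X_hh: "X \<in> hh"
  by (simp add: hh_iff br_self)

lemma theta_hh: "y \<in> hh \<Longrightarrow> \<theta> y \<in> hh"
  using tsc unfolding theta_stable_cartan_def hh_def by blast

lemma nilpotent_hh: "\<exists>k. \<forall>H\<in>hh. \<forall>y\<in>hh. (br H ^^ k) y = 0"
proof -
  obtain k where k: "lower_central_series br hh k = {0}"
    using tsc by (auto simp: theta_stable_cartan_def cartan_subalgebra_def nilpotent_algebra_def hh_def)
  have "(br H ^^ j) y \<in> lower_central_series br hh j" if "H \<in> hh" "y \<in> hh" for H y j
  proof (induction j)
    case (Suc j)
    have "br H ((br H ^^ j) y) \<in> {br x y |x y. x \<in> hh \<and> y \<in> lower_central_series br hh j}"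
      using Suc that by blast
    from span_base[OF this] show ?case by simp
  qed (use that in simp)
  then show ?thesis using k by (intro exI[of _ k]) (metis singletonD)
qed

text \<open>When \<open>w\<close> commutes with \<open>\<theta> w\<close>, \<open>br w\<close> is a normal operator for the inner product
  \<open>- B x (\<theta> y)\<close>.\<close>

lemma normal_kernel:
  assumes w: "br w (\<theta> w) = 0" and v: "br w (br w v) = 0"
  shows "br w v = 0"
proof (rule ccontr)
  let ?u = "br w v"
  have adj: "B (br w x) (\<theta> y) = - B x (\<theta> (br (\<theta> w) y))" for w x y
  proof -
    have "B (br w x) (\<theta> y) = - B (br x w) (\<theta> y)" by (subst br_anticommute) (simp add: B_simps)
    also have "\<dots> = - B x (br w (\<theta> y))" by (simp add: B_invariant)
    finally show ?thesis by (simp add: theta_br theta_theta)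
  qed
  have com: "br w (br (\<theta> w) y) = br (\<theta> w) (br w y)" for y
    using jacobi[of w "\<theta> w" y] w by (simp add: br_lzero)
  have "B (br (\<theta> w) ?u) (\<theta> (br (\<theta> w) ?u)) = 0"
    using adj[of "\<theta> w" ?u "br (\<theta> w) ?u"] com[of ?u] v
    by (simp add: theta_theta br_rzero linear_0[OF linear_theta] B_simps)
  then have "br (\<theta> w) ?u = 0" using B_theta_pos by force
  then have "B ?u (\<theta> ?u) = 0"
    using adj[of w v ?u] by (simp add: linear_0[OF linear_theta] B_simps)
  moreover assume "?u \<noteq> 0"
  ultimately show False using B_theta_pos[of ?u] by simp
qed

lemma normal_kernel_funpow:
  assumes w: "br w (\<theta> w) = 0" and v: "(br w ^^ k) v = 0"
  shows "br w v = 0"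
  using v
proof (induction k)
  case (Suc k)
  show ?case
  proof (cases k)
    case (Suc j)
    have "br w ((br w ^^ j) v) = 0"
      by (rule normal_kernel[OF w]) (use Suc.prems Suc in simp)
    then show ?thesis using Suc.IH Suc by simp
  qed (use Suc.prems in simp)
qed (simp add: br_rzero)

text \<open>A Cartan subalgebra is nilpotent by definition; \<open>\<theta>\<close>-stability makes
  it abelian. Up to a factor, \<open>H + \<theta> H\<close> and \<open>H - \<theta> H\<close> are
  the components of \<open>H\<close> in the eigenspaces of \<open>\<theta>\<close>. Each commutes
  with its own image under \<open>\<theta>\<close>, so it acts normally, and a normal operator that
  is nilpotent on \<open>hh\<close> vanishes there.\<close>

lemma hh_commute:
  assumes "H \<in> hh" "y \<in> hh"
  shows "br H y = 0"
proof -
  obtain k where k: "\<And>H y. H \<in> hh \<Longrightarrow> y \<in> hh \<Longrightarrow> (br H ^^ k) y = 0"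
    using nilpotent_hh by blast
  have "H + \<theta> H \<in> hh" "H - \<theta> H \<in> hh"
    using assms theta_hh subspace_hh by (auto intro: subspace_add subspace_diff)
  moreover have "br (H + \<theta> H) (\<theta> (H + \<theta> H)) = 0"
    by (simp add: linear_add[OF linear_theta] theta_theta add.commute br_self)
  moreover have "br (H - \<theta> H) (\<theta> (H - \<theta> H)) = 0"
    using br_rneg[of "H - \<theta> H" "H - \<theta> H"]
    by (simp add: linear_diff[OF linear_theta] theta_theta br_self)
  ultimately have "br (H + \<theta> H) y = 0" "br (H - \<theta> H) y = 0"
    using k assms(2) normal_kernel_funpow by blast+
  then have "br ((H + \<theta> H) + (H - \<theta> H)) y = 0" by (simp only: br_ladd) simp
  moreover have "(H + \<theta> H) + (H - \<theta> H) = 2 *\<^sub>R H" by (simp add: scaleR_2)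
  ultimately show ?thesis by (simp only: br_lmul) simp
qed

lemma hh_normal: "w \<in> hh \<Longrightarrow> br w (\<theta> w) = 0"
  using hh_commute theta_hh by blast

lemma br_commute_hh:
  assumes "H \<in> hh" "K \<in> hh"
  shows "br H (br K v) = br K (br H v)"
  using jacobi[of H K v] hh_commute[OF assms] by (simp add: br_lzero)

text \<open>The operator \<open>br X\<close> is normal, so its kernel meets its range only in
  0.\<close>

lemma hh_mm: "y \<in> hh \<Longrightarrow> y \<in> mm \<Longrightarrow> y = 0"
  using normal_kernel[OF hh_normal[OF X_hh]] by (auto simp: mm_def hh_iff)

lemma br_hh_mm: "H \<in> hh \<Longrightarrow> y \<in> mm \<Longrightarrow> br H y \<in> mm"
  using br_commute_hh[OF _ X_hh] by (auto simp: mm_def)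

lemma br_X_mm_surj: "br X ` mm = mm"
  by (rule linear_inj_on_subspace_surj[OF linear_br subspace_mm])
    (use br_hh_mm[OF X_hh] hh_mm hh_iff in auto)

text \<open>As \<open>br X\<close> maps \<open>mm\<close> onto itself, \<open>br X v\<close> has a
  preimage in \<open>mm\<close>, which differs from \<open>v\<close> by an element of the kernel
  \<open>hh\<close>.\<close>

lemma hh_mm_decomposition: "\<exists>a\<in>hh. \<exists>b\<in>mm. v = a + b"
proof -
  have "br X v \<in> br X ` mm" by (simp only: br_X_mm_surj) (simp add: mm_def)
  then obtain b where b: "b \<in> mm" "br X v = br X b" by auto
  then have "v - b \<in> hh" by (simp add: hh_iff br_rsub)
  then show ?thesis using b(1) by (intro bexI[of _ "v - b"] bexI[of _ b]) simp_all
qed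

lemma hh_projection:
  obtains p where "linear p" "\<And>v. p v \<in> hh" "\<And>v. v - p v \<in> mm"
    "\<And>v. v \<in> hh \<Longrightarrow> p v = v" "\<And>v. v \<in> mm \<Longrightarrow> p v = 0"
proof -
  have "hh \<inter> mm = {0}" using hh_mm subspace_0 subspace_hh subspace_mm by blast
  from complementary_projection[OF subspace_hh subspace_mm this hh_mm_decomposition]
  show ?thesis using that by blast
qed

lemma aut_stabilizer:
  assumes "aut S" "S X = X"
  shows "y \<in> hh \<Longrightarrow> S y \<in> hh" "y \<in> mm \<Longrightarrow> S y \<in> mm"
proof -
  have c: "br X (S v) = S (br X v)" for v using aut_br[OF assms(1), of X v] assms(2) by simp
  show "y \<in> hh \<Longrightarrow> S y \<in> hh" by (simp add: hh_iff c linear_0[OF aut_linear[OF assms(1)]])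
  show "y \<in> mm \<Longrightarrow> S y \<in> mm" by (auto simp: mm_def c[symmetric])
qed

text \<open>
  If \<open>S X = X + Z\<close> with \<open>Z \<in> hh\<close>, then \<open>S\<close> satisfies \<open>A S - S A = - ad Z S\<close> for \<open>A = ad X\<close>.
  The commutator with \<open>A\<close> is bounded below on the range of a high power of itself, so for small
  \<open>Z\<close> this power annihilates \<open>S\<close>, that is \<open>ad Z\<close> is nilpotent.
\<close>

lemma orbit_meets_hh_discretely:
  obtains \<epsilon> where "\<epsilon> > 0"
    "\<And>S. aut S \<Longrightarrow> S X \<in> hh \<Longrightarrow> norm (S X - X) < \<epsilon> \<Longrightarrow> S X = X"
proof -
  let ?A = "matrix (br X)"
  define L where "L T = ?A ** T - T ** ?A" for T :: "real^'n^'n"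
  note bm = bounded_bilinear_matrix_mult
  have linL: "linear L"
    unfolding L_def
    by (rule linearI)
      (simp_all add: bounded_bilinear.add_left[OF bm] bounded_bilinear.add_right[OF bm]
        bounded_bilinear.scaleR_left[OF bm] bounded_bilinear.scaleR_right[OF bm] algebra_simps)
  obtain N c where c: "c > 0" "\<And>T. norm (L ((L ^^ N) T)) \<ge> c * norm ((L ^^ N) T)"
    using funpow_range_bounded_below[OF linL] by blast
  obtain K where K: "K > 0"
    "\<And>Z T. norm (matrix (br Z) ** (T :: real^'n^'n)) \<le> norm Z * norm T * K"
  proof -
    have "bilinear (\<lambda>Z T. matrix (br Z) ** (T :: real^'n^'n))"
    proof -
      have "linear (\<lambda>Z. matrix (br Z) ** T)" for T :: "real^'n^'n"
      proof -
        have "linear (\<lambda>Z. matrix (br Z))"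
          by (rule linearI) (simp_all add: matrix_def vec_eq_iff br_simps)
        from linear_compose[OF this, of "\<lambda>M. M ** T"] show ?thesis
          using bounded_bilinear.bounded_linear_left[OF bm, of T]
          by (simp add: linear_conv_bounded_linear o_def)
      qed
      moreover have "linear (\<lambda>T :: real^'n^'n. M ** T)" for M :: "real^'n^'n"
        using bounded_bilinear.bounded_linear_right[OF bm, of M]
        by (simp add: linear_conv_bounded_linear)
      ultimately show ?thesis by (simp add: bilinear_def)
    qed
    then show ?thesis
      using that bounded_bilinear.pos_bounded bilinear_conv_bounded_bilinear by blast
  qed
  \<comment> \<open>Below \<open>c / K\<close>, multiplication by \<open>matrix (br Z)\<close> is
    weaker than the lower bound of \<open>L\<close> on the range of \<open>L ^^ N\<close>.\<close>
  show ?thesis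
  proof (rule that[of "c / K"])
    fix S assume S: "aut S" "S X \<in> hh" "norm (S X - X) < c / K"
    define Z where "Z = X - S X"
    have Z: "Z \<in> hh" unfolding Z_def using X_hh S(2) by (intro subspace_diff subspace_hh)
    define D where "D T = matrix (br Z) ** T" for T :: "real^'n^'n"
    have comm: "matrix (br Z) ** ?A = ?A ** matrix (br Z)"
      by (simp add: matrix_compose'[OF linear_br linear_br, symmetric] br_commute_hh[OF Z X_hh])
    have DL: "L (D T) = D (L T)" for T
      by (simp add: L_def D_def bounded_bilinear.diff_right[OF bm] matrix_mul_assoc comm)
    let ?S = "matrix S"
    have LS: "L ?S = D ?S"
    proof -
      have "?S ** ?A = matrix (\<lambda>v. S (br X v))"
        by (rule matrix_compose'[OF aut_linear[OF S(1)] linear_br, symmetric])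
      also have "\<dots> = matrix (\<lambda>v. br (S X) (S v))" by (simp add: aut_br[OF S(1)])
      also have "\<dots> = matrix (br (S X)) ** ?S"
        by (rule matrix_compose'[OF linear_br aut_linear[OF S(1)]])
      finally have "L ?S = (?A - matrix (br (S X))) ** ?S"
        by (simp add: L_def bounded_bilinear.diff_left[OF bm])
      also have "?A - matrix (br (S X)) = matrix (br Z)"
        by (simp add: Z_def br_lsub matrix_def vec_eq_iff)
      finally show ?thesis by (simp add: D_def)
    qed
    have LkD: "(L ^^ k) (D T) = D ((L ^^ k) T)" for k T by (induction k) (simp_all add: DL)
    \<comment> \<open>\<open>L\<close> and \<open>D\<close> agree on \<open>?S\<close> and commute,
      so they agree on \<open>(L ^^ N) ?S\<close> too; there the lower bound for \<open>L\<close>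
      conflicts with the upper bound for \<open>D\<close> unless the matrix is 0.\<close>
    have "norm (L ((L ^^ N) ?S)) = norm (D ((L ^^ N) ?S))"
      using LkD[of N ?S] LS by (metis funpow_swap1)
    also have "\<dots> \<le> norm Z * norm ((L ^^ N) ?S) * K" unfolding D_def by (rule K)
    finally have le: "c * norm ((L ^^ N) ?S) \<le> norm Z * K * norm ((L ^^ N) ?S)"
      using c(2)[of ?S] by (simp add: mult_ac)
    have "norm Z * K < c"
      using S(3) K(1) by (simp add: Z_def norm_minus_commute pos_less_divide_eq)
    then have "(L ^^ N) ?S = 0" using le by (metis mult_le_cancel_right norm_le_zero_iff not_le)
    moreover have "(L ^^ k) ?S = (D ^^ k) ?S" for k
    proof (induction k)
      case (Suc k)
      have "(L ^^ Suc k) ?S = (L ^^ k) (D ?S)" using LS by (simp add: funpow_swap1)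
      then show ?case using LkD[of k ?S] Suc by simp
    qed simp
    ultimately have "(D ^^ N) ?S = 0" by simp
    moreover have "(D ^^ k) T *v v = (br Z ^^ k) (T *v v)" for k T v
      by (induction k) (simp_all add: D_def matrix_vector_mul_assoc[symmetric] linear_br)
    ultimately have "(br Z ^^ N) (S v) = 0" for v
      using aut_linear[OF S(1)] by (metis matrix_vector_matrix matrix_vector_mult_0)
    then have "(br Z ^^ N) v = 0" for v using aut_inv(2)[OF S(1), of v] by metis
    \<comment> \<open>A nilpotent normal operator is 0, and the center is trivial.\<close>
    then have "br Z v = 0" for v using normal_kernel_funpow[OF hh_normal[OF Z]] by blast
    then have "Z = 0" by (rule centerless)
    then show "S X = X" by (simp add: Z_def)
  qed (use c K in simp)
qed

end

section \<open>The stabilizer of a regular element\<close>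

lemma has_derivative_apply:
  fixes f :: "'a::real_normed_vector \<Rightarrow> real^'n \<Rightarrow> real^'m"
  assumes f: "\<And>v. ((\<lambda>x. f x v) has_derivative (\<lambda>h. f' h v)) (at a)" "\<And>x. linear (f x)" "\<And>h. linear (f' h)"
    and g: "(g has_derivative g') (at a)"
  shows "((\<lambda>x. f x (g x)) has_derivative (\<lambda>h. f a (g' h) + f' h (g a))) (at a)"
proof -
  have "((\<lambda>x. matrix (f x)) has_derivative (\<lambda>h. matrix (f' h))) (at a)"
    by (rule has_derivative_matrix[OF f(1)])
  from bounded_bilinear.FDERIV[OF bounded_bilinear_matrix_vector_mult this g]
  show ?thesis by (simp add: f(2,3))
qed

lemma continuous_on_apply:
  fixes f :: "'a::topological_space \<Rightarrow> real^'n \<Rightarrow> real^'m"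
  assumes f: "\<And>v. continuous_on S (\<lambda>x. f x v)" "\<And>x. linear (f x)" and g: "continuous_on S g"
  shows "continuous_on S (\<lambda>x. f x (g x))"
proof -
  have "continuous_on S (\<lambda>x. matrix (f x))" by (rule continuous_on_matrix[OF f(1)])
  from bounded_bilinear.continuous_on[OF bounded_bilinear_matrix_vector_mult this g]
  show ?thesis by (simp add: f(2))
qed

lemma subspaces_meet:
  fixes A B :: "'a::euclidean_space set"
  assumes "subspace A" "subspace B" "dim A + dim B > DIM('a)"
  obtains v where "v \<in> A" "v \<in> B" "v \<noteq> 0"
proof -
  have "dim {x + y |x y. x \<in> A \<and> y \<in> B} + dim (A \<inter> B) = dim A + dim B"
    by (rule dim_sums_Int[OF assms(1,2)])
  moreover have "dim {x + y |x y. x \<in> A \<and> y \<in> B} \<le> DIM('a)" by (rule dim_subset_UNIV)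
  ultimately have "dim (A \<inter> B) > 0" using assms(3) by simp
  then have "\<not> A \<inter> B \<subseteq> {0}" using dim_eq_0 by (metis less_irrefl)
  then show ?thesis using that by blast
qed

text \<open>\<open>R\<close> maps the kernel of \<open>M\<close> isomorphically onto the orthogonal
  complement of the range of \<open>M\<close> and vanishes on a complement of that kernel. It
  repairs invertibility while keeping its own kernel as large as possible.\<close>

lemma rank_correction:
  fixes M :: "'a::euclidean_space \<Rightarrow> 'a"
  assumes M: "linear M"
  obtains R where "linear R" "inj (\<lambda>v. M v + R v)"
    "DIM('a) \<le> dim {v. R v = 0} + dim {v. M v = 0}"
proof -
  define K where "K = {v. M v = 0}"
  have sK: "subspace K" unfolding K_def by (rule linear_subspace_kernel[OF M])
  define K' where "K' = {y \<in> UNIV. \<forall>x\<in>K. orthogonal x y}"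
  have sK': "subspace K'" unfolding K'_def using subspace_orthogonal_to_vectors[of K] by simp
  have dK: "dim K' + dim K = DIM('a)"
    using dim_subspace_orthogonal_to_vectors[OF sK subspace_UNIV] by (simp add: K'_def)
  have KK: "K \<inter> K' = {0}"
    using subspace_0[OF sK] subspace_0[OF sK'] by (auto simp: K'_def orthogonal_def)
  have dec: "\<exists>a\<in>K. \<exists>b\<in>K'. v = a + b" for v
  proof -
    obtain y z where "y \<in> span K" "\<And>w. w \<in> span K \<Longrightarrow> orthogonal z w" "v = y + z"
      using orthogonal_subspace_decomp_exists[of K v] by blast
    then show ?thesis
      using sK span_superset[of K]
      by (intro bexI[of _ y] bexI[of _ z]) (auto simp: K'_def orthogonal_commute span_eq_iff[THEN iffD2])
  qed
  obtain p where p: "linear p" "\<And>v. p v \<in> K" "\<And>v. v \<in> K \<Longrightarrow> p v = v" "\<And>v. v \<in> K' \<Longrightarrow> p v = 0"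
    using complementary_projection[OF sK sK' KK dec] by metis
  let ?I = "range M"
  have sI: "subspace ?I" by (rule linear_subspace_image[OF M subspace_UNIV])
  have "M ` K' = ?I"
  proof
    show "?I \<subseteq> M ` K'"
    proof
      fix w assume "w \<in> ?I"
      then obtain v where "w = M v" by blast
      moreover obtain a b where "a \<in> K" "b \<in> K'" "v = a + b" using dec by blast
      ultimately show "w \<in> M ` K'" by (simp add: K_def linear_add[OF M])
    qed
  qed auto
  moreover have "inj_on M (span K')"
  proof (rule inj_onI)
    fix x y assume xy: "x \<in> span K'" "y \<in> span K'" "M x = M y"
    then have "x - y \<in> K'" using sK' by (simp add: span_eq_iff[THEN iffD2] subspace_diff)
    moreover have "x - y \<in> K" using xy by (simp add: K_def linear_diff[OF M])
    ultimately have "x - y \<in> K \<inter> K'" by (rule IntI[rotated])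
    then show "x = y" unfolding KK by simp
  qed
  then have "dim (M ` K') = dim K'" by (rule dim_image_eq[OF M])
  ultimately have dI: "dim ?I = dim K'" by simp
  define C where "C = {y \<in> UNIV. \<forall>x\<in>?I. orthogonal x y}"
  have sC: "subspace C" unfolding C_def using subspace_orthogonal_to_vectors[of ?I] by simp
  have "dim C + dim ?I = DIM('a)"
    using dim_subspace_orthogonal_to_vectors[OF sI subspace_UNIV] by (simp add: C_def)
  then have "dim K = dim C" using dI dK by simp
  then obtain f where f: "linear f" "f ` K = C" "inj_on f K"
    using subspace_isomorphism[OF sK sC] by blast
  define R where "R v = f (p v)" for v
  have R: "linear R" unfolding R_def using linear_compose[OF p(1) f(1)] by (simp add: o_def)
  have l: "linear (\<lambda>v. M v + R v)" using M R by (rule linear_compose_add)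
  have "v = 0" if v: "M v + R v = 0" for v
  proof -
    have "R v \<in> C" using f(2) p(2) by (auto simp: R_def)
    moreover have "R v = M (- v)" using v by (simp add: linear_neg[OF M] eq_neg_iff_add_eq_0 add.commute)
    ultimately have "orthogonal (R v) (R v)" by (auto simp: C_def)
    then have Rv: "R v = 0" by (simp add: orthogonal_self)
    then have "v \<in> K" using v by (simp add: K_def)
    then have "f v = f 0" using Rv p(3) by (simp add: R_def linear_0[OF f(1)])
    then show ?thesis using f(3) \<open>v \<in> K\<close> subspace_0[OF sK] by (auto dest: inj_onD)
  qed
  then have "inj (\<lambda>v. M v + R v)" using linear_injective_0[OF l] by blast
  moreover have "K' \<subseteq> {v. R v = 0}" using p(4) by (auto simp: R_def linear_0[OF f(1)])
  then have "dim K' \<le> dim {v. R v = 0}" by (rule dim_subset)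
  then have "DIM('a) \<le> dim {v. R v = 0} + dim {v. M v = 0}" using dK by (simp add: K_def)
  ultimately show ?thesis using that[OF R] by blast
qed

text \<open>By dimension, the kernel of \<open>R\<close> meets the fixed space of \<open>P\<close>
  in a nonzero vector, which the map then annihilates. A large fixed space is thus detected by a
  determinant.\<close>

lemma det_fixed_space_zero:
  fixes P R :: "real^'n \<Rightarrow> real^'n"
  assumes "linear P" "linear R" "dim {v. R v = 0} + dim {v. P v = v} > CARD('n)"
  shows "det (matrix (\<lambda>v. P v - v + R v)) = 0"
proof -
  have lP: "linear (\<lambda>v. P v - v)" using assms(1) by (intro linear_compose_sub linear_ident)
  have "subspace {v. P v - v = 0}" by (rule linear_subspace_kernel[OF lP])
  then have "subspace {v. P v = v}" by simp
  then obtain v where v: "R v = 0" "P v = v" "v \<noteq> 0"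
    using subspaces_meet[OF linear_subspace_kernel[OF assms(2)]] assms(3) by auto
  have l: "linear (\<lambda>v. P v - v + R v)" using lP assms(2) by (rule linear_compose_add)
  have "P v - v + R v = 0" using v by simp
  then have "\<not> inj (\<lambda>v. P v - v + R v)"
    using v(3) linear_injective_0[OF l] by blast
  then show ?thesis using det_nz_iff_inj[OF l] by simp
qed

section \<open>Fixed vectors near the one-parameter group of \<open>X\<close>\<close>

context theta_cartan
begin

lemma exp_fixes_hh: "c \<in> hh \<Longrightarrow> y \<in> hh \<Longrightarrow> exp_lin (br c) y = y"
  by (rule exp_lin_fixed[OF linear_br hh_commute])

text \<open>A perturbation that fixes \<open>hh\<close> pointwise and commutes with every
  automorphism fixing \<open>X\<close>; for small \<open>t \<noteq> 0\<close>, unlike the identity,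
  it fixes nothing else.\<close>

definition "Q t = exp_lin (br (t *\<^sub>R X))"

lemma aut_Q: "aut (Q t)"
  by (simp add: Q_def aut_exp)

lemma Q_fixes_hh: "y \<in> hh \<Longrightarrow> Q t y = y"
  unfolding Q_def using exp_fixes_hh subspace_scale[OF subspace_hh X_hh] by blast

lemma Q_add: "Q (s + t) v = Q s (Q t v)"
  unfolding Q_def exp_lin_scaleR[symmetric] by (rule exp_lin_add[OF linear_br])

lemma Q_mm: "y \<in> mm \<Longrightarrow> Q t y \<in> mm"
  using aut_stabilizer(2)[OF aut_Q Q_fixes_hh[OF X_hh]] .

text \<open>To first order \<open>Q t - 1\<close> is \<open>t\<close> times \<open>br X\<close>,
  which is bounded below on \<open>mm\<close>; the remainder is too small to compensate.\<close>

lemma Q_moves_mm: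
  obtains \<delta> where "\<delta> > 0" "\<forall>t v. t \<noteq> 0 \<longrightarrow> \<bar>t\<bar> < \<delta> \<longrightarrow> v \<in> mm \<longrightarrow> Q t v = v \<longrightarrow> v = 0"
proof -
  have "\<forall>x\<in>mm. br X x = 0 \<longrightarrow> x = 0" using hh_mm hh_iff by blast
  then obtain c where c: "c > 0" "\<And>v. v \<in> mm \<Longrightarrow> norm (br X v) \<ge> c * norm v"
    using injective_imp_isometric[OF closed_subspace[OF subspace_mm] subspace_mm]
      linear_br linear_conv_bounded_linear by blast
  obtain L where L: "L > 0" "\<And>E v. norm (E *v v :: real^'n) \<le> norm (E :: real^'n^'n) * norm v * L"
    using bounded_bilinear.pos_bounded[OF bounded_bilinear_matrix_vector_mult] by blast
  have d: "((\<lambda>t. matrix (Q t)) has_derivative (\<lambda>h. matrix (\<lambda>v. h *\<^sub>R br X v))) (at 0)"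
  proof (rule has_derivative_matrix)
    show "((\<lambda>t. Q t v) has_derivative (\<lambda>h. h *\<^sub>R br X v)) (at 0)" for v
      using exp_lin_derivative[OF linear_br, of X v 0]
      by (simp add: Q_def has_vector_derivative_def exp_lin_zero exp_lin_scaleR[symmetric])
  qed
  \<comment> \<open>With this accuracy the remainder, after \<open>L\<close> has entered through the
    operator bound, is at most half of the lower bound \<open>c\<close>.\<close>
  have "c / (2 * L) > 0" using c L by simp
  then obtain \<delta> where \<delta>: "\<delta> > 0" "\<And>t. norm (t - 0) < \<delta> \<Longrightarrow>
      norm (matrix (Q t) - matrix (Q 0) - matrix (\<lambda>v. (t - 0) *\<^sub>R br X v)) \<le> c / (2 * L) * norm (t - 0)"
    using d unfolding has_derivative_at_alt by blast
  have Q0: "Q 0 v = v" for v by (simp add: Q_def exp_lin_br_zero)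
  show ?thesis
  proof (rule that[OF \<delta>(1)], intro allI impI)
    fix t v assume t: "t \<noteq> 0" "\<bar>t\<bar> < \<delta>" and v: "v \<in> mm" "Q t v = v"
    let ?E = "matrix (Q t) - matrix (Q 0) - matrix (\<lambda>v. t *\<^sub>R br X v)"
    have "?E *v v = Q t v - Q 0 v - t *\<^sub>R br X v"
      using aut_linear[OF aut_Q] linear_compose_scale_right[OF linear_br]
      by (simp add: matrix_vector_mult_diff_rdistrib)
    then have "norm (t *\<^sub>R br X v) = norm (?E *v v)" using v(2) Q0 by simp
    also have "\<dots> \<le> norm ?E * norm v * L" by (rule L)
    also have "\<dots> \<le> (c / (2 * L) * \<bar>t\<bar>) * norm v * L"
      using \<delta>(2)[of t] t L by (intro mult_right_mono) auto
    also have "\<dots> = \<bar>t\<bar> * (c / 2 * norm v)" using L by simp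
    finally have "norm (br X v) \<le> c / 2 * norm v" using t(1) by simp
    then have "c * norm v \<le> c / 2 * norm v" using c(2)[OF v(1)] by linarith
    then show "v = 0" using c(1) by (simp add: mult_le_cancel_right)
  qed
qed

lemma aut_commute_Q:
  assumes "aut S" "S X = X"
  shows "S (Q t v) = Q t (S v)"
proof -
  have "S (br (t *\<^sub>R X) x) = br (t *\<^sub>R X) (S x)" for x
    using aut_br[OF assms(1)] assms(2) by (simp add: linear_scale[OF aut_linear[OF assms(1)]])
  then show ?thesis
    unfolding Q_def by (rule exp_lin_commute[OF linear_br aut_linear[OF assms(1)]])
qed

text \<open>The subspaces of \<open>mm\<close> on which \<open>S\<close> equals \<open>Q (- t)\<close> are independent for different small \<open>t\<close>,
  so that all but finitely many of them vanish.\<close>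

lemma generic_parameter:
  assumes S: "aut S" "S X = X"
    and \<delta>: "\<delta> > 0" "\<forall>t v. t \<noteq> 0 \<longrightarrow> \<bar>t\<bar> < \<delta> \<longrightarrow> v \<in> mm \<longrightarrow> Q t v = v \<longrightarrow> v = 0"
  shows "\<exists>t. 0 < t \<and> t < \<delta> \<and> (\<forall>v\<in>mm. S (Q t v) = v \<longrightarrow> v = 0)"
proof (rule ccontr)
  assume nt: "\<not> ?thesis"
  let ?J = "{0<..<\<delta>}"
  note com = aut_commute_Q[OF S]
  have lin: "linear S" "\<And>t. linear (Q t)" using aut_linear S(1) aut_Q by blast+
  have QQ: "Q s (Q t v) = Q t (Q s v)" for s t v by (metis Q_add add.commute)
  have ind: "\<forall>v. (\<forall>t\<in>F. v t \<in> mm \<and> S (Q t (v t)) = v t) \<and> (\<Sum>t\<in>F. v t) = 0 \<longrightarrow> (\<forall>t\<in>F. v t = 0)"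
    if "finite F" "F \<subseteq> ?J" for F
    using that
  proof (induction F)
    case (insert s F)
    show ?case
    proof (intro allI impI)
      fix v assume v: "(\<forall>t\<in>insert s F. v t \<in> mm \<and> S (Q t (v t)) = v t) \<and> (\<Sum>t\<in>insert s F. v t) = 0"
      \<comment> \<open>As for eigenvectors, \<open>S \<circ> Q s - 1\<close> removes the component
        for \<open>s\<close>. On the component for \<open>t\<close> it acts as
        \<open>Q (s - t) - 1\<close>, which is injective on \<open>mm\<close> because
        \<open>s - t\<close> is small and nonzero.\<close>
      define u where "u t = S (Q s (v t)) - v t" for t
      have u_eq: "u t = Q (s - t) (v t) - v t" if "t \<in> F" for t
      proof -
        have "S (Q s (v t)) = S (Q (s - t) (Q t (v t)))" using Q_add[of "s - t" t] by simp
        also have "\<dots> = Q (s - t) (S (Q t (v t)))" by (rule com)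
        finally show ?thesis using v that by (simp add: u_def)
      qed
      have "u t \<in> mm \<and> S (Q t (u t)) = u t" if "t \<in> F" for t
      proof
        show "u t \<in> mm"
          using v that by (simp add: u_eq Q_mm subspace_diff[OF subspace_mm])
        have "S (Q t (S (Q s (v t)))) = S (Q s (S (Q t (v t))))"
          by (simp only: com[symmetric] QQ[of t s])
        then show "S (Q t (u t)) = u t"
          using v that by (simp add: u_def linear_diff[OF lin(1)] linear_diff[OF lin(2)])
      qed
      moreover have "(\<Sum>t\<in>F. u t) = 0"
      proof -
        have "v s + (\<Sum>t\<in>F. v t) = 0" using v insert.hyps by simp
        then have F: "(\<Sum>t\<in>F. v t) = - v s" by (simp add: eq_neg_iff_add_eq_0 add.commute)
        have "(\<Sum>t\<in>F. u t) = S (Q s (\<Sum>t\<in>F. v t)) - (\<Sum>t\<in>F. v t)"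
          by (simp add: u_def sum_subtractf linear_sum[OF lin(1)] linear_sum[OF lin(2)])
        also have "\<dots> = - S (Q s (v s)) + v s"
          by (simp add: F linear_neg[OF lin(1)] linear_neg[OF lin(2)])
        finally show ?thesis using v by simp
      qed
      ultimately have u0: "\<forall>t\<in>F. u t = 0" using insert by blast
      have F0: "v t = 0" if "t \<in> F" for t
      proof (rule \<delta>(2)[rule_format, of "s - t"])
        show "s - t \<noteq> 0" using that insert.hyps by auto
        have "t \<in> ?J" "s \<in> ?J" using insert.prems that by blast+
        then show "\<bar>s - t\<bar> < \<delta>" by auto
        show "v t \<in> mm" using v that by blast
        show "Q (s - t) (v t) = v t" using u_eq[OF that] u0 that by simp
      qed
      moreover have "v s = 0" using v insert.hyps F0 by simp
      ultimately show "\<forall>t\<in>insert s F. v t = 0" by blast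
    qed
  qed simp
  have "\<exists>v. v \<in> mm \<and> S (Q t v) = v \<and> v \<noteq> 0" if "t \<in> ?J" for t
    using nt that by auto
  then obtain w where w: "\<And>t. t \<in> ?J \<Longrightarrow> w t \<in> mm \<and> S (Q t (w t)) = w t \<and> w t \<noteq> 0"
    by metis
  have inj: "inj_on w ?J"
  proof (rule inj_onI, rule ccontr)
    fix s t assume st: "s \<in> ?J" "t \<in> ?J" "w s = w t" "s \<noteq> t"
    let ?v = "\<lambda>x. if x = s then w s else - w t"
    have "(\<forall>x\<in>{s, t}. ?v x \<in> mm \<and> S (Q x (?v x)) = ?v x) \<and> (\<Sum>x\<in>{s, t}. ?v x) = 0"
      using w[OF st(1)] w[OF st(2)] st(3,4) by (simp add: subspace_neg[OF subspace_mm] linear_neg[OF lin(1)] linear_neg[OF lin(2)])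
    moreover have a: "finite {s, t}" "{s, t} \<subseteq> ?J" using st by auto
    ultimately have "\<forall>x\<in>{s, t}. ?v x = 0" by (intro spec[OF ind[OF a], of ?v, THEN mp])
    then show False using w[OF st(1)] by simp
  qed
  \<comment> \<open>Were every parameter bad, choosing one more parameter than the dimension would
    give too many independent vectors.\<close>
  have "infinite ?J" using \<delta>(1) by simp
  then obtain F where F: "finite F" "card F = Suc DIM(real^'n)" "F \<subseteq> ?J"
    using infinite_arbitrarily_large by blast
  have injF: "inj_on w F" using inj F(3) by (rule inj_on_subset)
  have "dependent (w ` F)"
    by (rule dependent_biggerset) (simp add: card_image[OF injF] F(2) del: DIM_cart)
  moreover have "independent (w ` F)"
    unfolding independent_explicit
  proof (intro conjI allI impI)
    fix c assume "(\<Sum>v\<in>w ` F. c v *\<^sub>R v) = 0"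
    then have "(\<Sum>t\<in>F. c (w t) *\<^sub>R w t) = 0" by (simp add: sum.reindex[OF injF])
    moreover have "\<forall>t\<in>F. c (w t) *\<^sub>R w t \<in> mm \<and> S (Q t (c (w t) *\<^sub>R w t)) = c (w t) *\<^sub>R w t"
      using w F(3) by (auto simp: subspace_scale[OF subspace_mm] linear_scale[OF lin(1)] linear_scale[OF lin(2)])
    ultimately have "\<forall>t\<in>F. c (w t) *\<^sub>R w t = 0"
      by (intro spec[OF ind[OF F(1,3)], of "\<lambda>t. c (w t) *\<^sub>R w t", THEN mp] conjI)
    moreover have "w t \<noteq> 0" if "t \<in> F" for t using w[of t] F(3) that by blast
    ultimately show "\<forall>v\<in>w ` F. c v = 0" by simp
  qed (simp add: F)
  ultimately show False by blast
qed

text \<open>Automorphisms near \<open>Q t\<close> are conjugate to \<open>Q t\<close> times the exponential of an element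
  of \<open>hh\<close>.\<close>

lemma fixed_space_near_Q:
  assumes t: "\<forall>v\<in>mm. Q t v = v \<longrightarrow> v = 0"
  obtains \<epsilon> where "\<epsilon> > 0"
    "\<And>P. aut P \<Longrightarrow> norm (matrix P - matrix (Q t)) < \<epsilon> \<Longrightarrow> dim hh \<le> dim {v. P v = v}"
proof -
  obtain p where p: "linear p" "\<And>v. p v \<in> hh" "\<And>v. v - p v \<in> mm"
    "\<And>v. v \<in> hh \<Longrightarrow> p v = v" "\<And>v. v \<in> mm \<Longrightarrow> p v = 0"
    using hh_projection by metis
  define q where "q v = v - p v" for v
  have q: "linear q" unfolding q_def by (intro linear_compose_sub linear_ident p(1))
  have bil_br: "bilinear (\<lambda>x. br (m x))" if "linear m" for m :: "real^'n \<Rightarrow> real^'n"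
    using that unfolding bilinear_def
    by (auto simp: linear_br) (simp add: linear_iff br_simps)
  let ?E = "\<lambda>m x. exp_lin (br (m x))"
  \<comment> \<open>The factor \<open>?E p x\<close> varies \<open>Q t\<close> by exponentials of
    elements of \<open>hh\<close>, and conjugation by \<open>?E q x\<close> moves the result away
    from the pointwise stabilizer of \<open>hh\<close>.\<close>
  define f where "f x v = ?E q x (Q t (?E p x (?E (\<lambda>x. - q x) x v)))" for x v
  \<comment> \<open>The logarithmic derivative of \<open>f\<close> at 0. It is injective: on
    \<open>hh\<close> it is the identity, and on \<open>mm\<close> it is the inverse of
    \<open>Q t\<close> minus 1, whose kernel in \<open>mm\<close> is trivial by the choice of
    \<open>t\<close>.\<close>
  define l where "l h = finv (Q t) (q h) - q h + p h" for h
  have nq: "linear (\<lambda>x. - q x)" using q by (rule linear_compose_neg)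
  have lQ: "linear (Q t)" and lQi: "linear (finv (Q t))"
    using aut_linear aut_Q aut_inv(1) by blast+
  note E0 = exp_lin_br_zero linear_0[OF q] linear_0[OF p(1)]
  have f0: "f 0 v = Q t v" for v by (simp add: f_def E0)
  have blQ: "bounded_linear (Q t)" using lQ by (simp add: linear_conv_bounded_linear)
  have cE: "continuous_on UNIV (\<lambda>x. ?E m x v)" if "linear m" for m :: "real^'n \<Rightarrow> real^'n" and v
    by (rule continuous_on_exp_lin[OF bil_br[OF that]])
  have cont: "continuous_on UNIV (\<lambda>x. f x v)" for v
  proof -
    have 1: "continuous_on UNIV (\<lambda>x. ?E p x (?E (\<lambda>x. - q x) x v))"
      by (rule continuous_on_apply[OF cE[OF p(1)] linear_exp_lin cE[OF nq]])
    show ?thesis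
      unfolding f_def
      by (rule continuous_on_apply[OF cE[OF q] linear_exp_lin bounded_linear.continuous_on[OF blQ 1]])
  qed
  have aut: "aut (f x)" for x
  proof -
    have "aut (\<lambda>v. ?E q x (Q t (?E p x (?E (\<lambda>x. - q x) x v))))"
      using aut_compose[OF aut_exp aut_compose[OF aut_Q aut_compose[OF aut_exp aut_exp]]] .
    then show ?thesis by (simp add: f_def[abs_def])
  qed
  have dE: "((\<lambda>x. ?E m x v) has_derivative (\<lambda>h. br (m h) v)) (at 0)" if "linear m" for m :: "real^'n \<Rightarrow> real^'n" and v
    by (rule exp_lin_derivative_0[OF bil_br[OF that]])
  have der: "((\<lambda>x. f x v) has_derivative (\<lambda>h. f 0 (br (l h) v))) (at 0)" for v
  proof -
    have 1: "((\<lambda>x. ?E p x (?E (\<lambda>x. - q x) x v)) has_derivative (\<lambda>h. br (- q h) v + br (p h) v)) (at 0)"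
      using has_derivative_apply[OF dE[OF p(1)] linear_exp_lin linear_br dE[OF nq]]
      by (simp add: E0)
    have 2: "((\<lambda>x. Q t (?E p x (?E (\<lambda>x. - q x) x v))) has_derivative
        (\<lambda>h. Q t (br (- q h) v + br (p h) v))) (at 0)"
      by (rule bounded_linear.has_derivative[OF blQ 1])
    have 3: "((\<lambda>x. f x v) has_derivative
        (\<lambda>h. Q t (br (- q h) v + br (p h) v) + br (q h) (Q t v))) (at 0)"
      unfolding f_def
      using has_derivative_apply[OF dE[OF q] linear_exp_lin linear_br 2]
      by (simp add: E0)
    have "br (q h) (Q t v) = Q t (br (finv (Q t) (q h)) v)" for h
      by (simp add: aut_br[OF aut_Q] aut_inv[OF aut_Q])
    then have "Q t (br (- q h) v + br (p h) v) + br (q h) (Q t v) = f 0 (br (l h) v)" for h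
      by (simp add: f0 l_def br_simps linear_add[OF lQ] linear_diff[OF lQ] linear_neg[OF lQ] algebra_simps)
    with 3 show ?thesis by simp
  qed
  have ll: "linear l"
  proof -
    have "linear (\<lambda>h. finv (Q t) (q h))" using linear_compose[OF q lQi] by (simp add: o_def)
    then show ?thesis
      unfolding l_def by (intro linear_compose_add linear_compose_sub p(1) q)
  qed
  have "inj l"
    unfolding linear_injective_0[OF ll]
  proof (intro allI impI)
    fix h assume h: "l h = 0"
    have qm: "q h \<in> mm" using p(3) by (simp add: q_def)
    have "finv (Q t) (q h) \<in> mm"
    proof -
      have "finv (Q t) X = X" using Q_fixes_hh[OF X_hh, of t] aut_inv(3)[OF aut_Q, of t X] by simp
      then show ?thesis using aut_stabilizer(2)[OF aut_inv(1)[OF aut_Q]] qm by blast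
    qed
    then have dm: "finv (Q t) (q h) - q h \<in> mm" using qm by (rule subspace_diff[OF subspace_mm])
    have "p h + (finv (Q t) (q h) - q h) = 0" using h by (simp only: l_def add.commute)
    then have ph: "p h = - (finv (Q t) (q h) - q h)" by (rule eq_neg_iff_add_eq_0[THEN iffD2])
    have "p h \<in> mm" unfolding ph by (rule subspace_neg[OF subspace_mm dm])
    then have p0: "p h = 0" using hh_mm p(2) by blast
    then have "finv (Q t) (q h) = q h" using ph by simp
    then have "Q t (q h) = q h" using aut_inv(2)[OF aut_Q, of t "q h"] by simp
    then have "q h = 0" using t qm by blast
    then show "h = 0" using p0 by (simp add: q_def)
  qed
  then obtain r where r: "linear r" "\<And>y. l (r y) = y"
    using linear_injective_isomorphism[OF ll] by auto
  obtain \<epsilon> where \<epsilon>: "\<epsilon> > 0"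
    "\<And>P. aut P \<Longrightarrow> norm (matrix P - matrix (f 0)) < \<epsilon> \<Longrightarrow> \<exists>x\<in>UNIV. norm x < 1 \<and> P = f x"
    using aut_open_mapping[OF open_UNIV UNIV_I cont aut der r zero_less_one] by blast
  show ?thesis
  proof (rule that[OF \<epsilon>(1)])
    fix P assume P: "aut P" "norm (matrix P - matrix (Q t)) < \<epsilon>"
    have "f 0 = Q t" using f0 by (rule ext)
    then obtain x where x: "P = f x" using \<epsilon>(2)[OF P(1)] P(2) by auto
    let ?C = "?E q x"
    \<comment> \<open>Both \<open>Q t\<close> and \<open>?E p x\<close> fix \<open>hh\<close>
      pointwise, so their conjugate fixes the image of \<open>hh\<close> under
      \<open>?C\<close>.\<close>
    have "?C ` hh \<subseteq> {v. P v = v}"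
    proof
      fix w assume "w \<in> ?C ` hh"
      then obtain y where y: "y \<in> hh" "w = ?C y" by blast
      have "?E (\<lambda>x. - q x) x w = y"
        using exp_lin_minus(2)[OF linear_br, of "q x" y] y(2) by (simp add: br_lneg[abs_def])
      then have "f x w = w" using y p(2) by (simp add: f_def exp_fixes_hh Q_fixes_hh)
      then show "w \<in> {v. P v = v}" by (simp add: x)
    qed
    then have "dim (?C ` hh) \<le> dim {v. P v = v}" by (rule dim_subset)
    moreover have "dim (?C ` hh) = dim hh"
      by (rule dim_image_eq[OF linear_exp_lin]) (rule inj_on_subset[OF aut_inj[OF aut_exp]], simp)
    ultimately show "dim hh \<le> dim {v. P v = v}" by simp
  qed
qed

text \<open>
  Along the path \<open>s \<mapsto> Q t \<circ> eprod Ys s\<close> the dimension of the fixed space is at least \<open>dim hh\<close> for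
  small \<open>s\<close>, hence for all \<open>s\<close> by analyticity.  At the end point \<open>Q t \<circ> S\<close> no vector of \<open>mm\<close> is fixed.
\<close>

lemma inner_stabilizer_fixes_hh:
  assumes S: "S \<in> inner_auts" "S X = X" and y: "y \<in> hh"
  shows "S y = y"
proof (rule ccontr)
  assume Sy: "S y \<noteq> y"
  have aS: "aut S" using S(1) by (rule inner_aut)
  obtain \<delta> where \<delta>: "\<delta> > 0" "\<forall>t v. t \<noteq> 0 \<longrightarrow> \<bar>t\<bar> < \<delta> \<longrightarrow> v \<in> mm \<longrightarrow> Q t v = v \<longrightarrow> v = 0"
    using Q_moves_mm by blast
  obtain t where t: "0 < t" "t < \<delta>" "\<And>v. v \<in> mm \<Longrightarrow> S (Q t v) = v \<Longrightarrow> v = 0"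
    using generic_parameter[OF aS S(2) \<delta>] by blast
  have "\<bar>t\<bar> < \<delta>" "t \<noteq> 0" using t by auto
  then have "\<forall>v\<in>mm. Q t v = v \<longrightarrow> v = 0" using \<delta>(2) by blast
  then obtain \<epsilon> where \<epsilon>: "\<epsilon> > 0"
    "\<And>P. aut P \<Longrightarrow> norm (matrix P - matrix (Q t)) < \<epsilon> \<Longrightarrow> dim hh \<le> dim {v. P v = v}"
    using fixed_space_near_Q by blast
  obtain Ys where Ys: "S = eprod Ys 1" using S(1) by (auto simp: inner_auts_def)
  define P where "P s v = Q t (eprod Ys s v)" for s v
  have lQ: "linear (Q t)" using aut_linear aut_Q by blast
  have aP: "aut (P s)" for s
    using aut_compose[OF aut_Q aut_eprod] by (simp add: P_def[abs_def])
  have "continuous_on UNIV (\<lambda>s. matrix (P s))"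
    unfolding P_def
    by (rule continuous_on_matrix, rule bounded_linear.continuous_on[OF _ continuous_eprod])
      (use lQ in \<open>simp add: linear_conv_bounded_linear\<close>)
  then have "isCont (\<lambda>s. matrix (P s)) 0" by (simp add: continuous_on_eq_continuous_at)
  then obtain d where d: "d > 0" "\<And>s. dist s 0 < d \<Longrightarrow> dist (matrix (P s)) (matrix (P 0)) < \<epsilon>"
    using \<epsilon>(1) unfolding continuous_at_eps_delta by blast
  have "P 0 = Q t" by (simp add: P_def[abs_def] eprod_zero fun_eq_iff)
  then have near: "dim hh \<le> dim {v. P s v = v}" if "\<bar>s\<bar> < d" for s
    using d(2)[of s] that \<epsilon>(2)[OF aP] by (simp add: dist_norm)
  define M where "M v = Q t (S v) - v" for v
  have lM: "linear M"
  proof -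
    have "linear (\<lambda>v. Q t (S v))" using linear_compose[OF aut_linear[OF aS] lQ] by (simp add: o_def)
    then show ?thesis unfolding M_def by (intro linear_compose_sub linear_ident)
  qed
  \<comment> \<open>\<open>R\<close> is adapted to the end point \<open>s = 1\<close>, where
    \<open>M + R\<close> is invertible. The vector \<open>y\<close>, which is not fixed there, makes
    the kernel of \<open>M\<close> smaller than \<open>hh\<close>, so the kernel of \<open>R\<close>
    is large enough to meet every fixed space of dimension at least \<open>dim hh\<close>, as near
    \<open>s = 0\<close>.\<close>
  obtain R where R: "linear R" "inj (\<lambda>v. M v + R v)"
    "DIM(real^'n) \<le> dim {v. R v = 0} + dim {v. M v = 0}"
    using rank_correction[OF lM] by blast
  have "{v. M v = 0} \<subseteq> hh"
  proof
    fix v assume v: "v \<in> {v. M v = 0}"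
    obtain a b where ab: "a \<in> hh" "b \<in> mm" "v = a + b" using hh_mm_decomposition by blast
    have Sa: "S a \<in> hh" "S b \<in> mm" using aut_stabilizer[OF aS S(2)] ab by auto
    have "S a + Q t (S b) = a + b"
      using v by (simp add: ab M_def linear_add[OF aut_linear[OF aS]] linear_add[OF lQ] Q_fixes_hh[OF Sa(1)])
    then have sum: "(S a - a) + (Q t (S b) - b) = 0" by (simp add: algebra_simps)
    have "S a - a \<in> hh" using subspace_diff[OF subspace_hh Sa(1) ab(1)] .
    moreover have "Q t (S b) - b \<in> mm" using subspace_diff[OF subspace_mm Q_mm[OF Sa(2)] ab(2)] .
    moreover have "S a - a = - (Q t (S b) - b)" using sum by (rule eq_neg_iff_add_eq_0[THEN iffD2])
    ultimately have "S a - a = 0" using hh_mm subspace_neg[OF subspace_mm] by metis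
    then have "Q t (S b) = b" using sum by simp
    then have "b = 0" using t(3)[OF ab(2)] aut_commute_Q[OF aS S(2)] by simp
    then show "v \<in> hh" using ab by simp
  qed
  moreover have "M y \<noteq> 0"
    using Sy Q_fixes_hh[OF aut_stabilizer(1)[OF aS S(2) y]] by (simp add: M_def)
  ultimately have "{v. M v = 0} \<subset> hh" using y by blast
  then have "dim {v. M v = 0} < dim hh"
    using subspace_hh linear_subspace_kernel[OF lM] by (intro dim_psubset) (simp add: span_eq_iff[THEN iffD2])
  then have big: "dim {v. R v = 0} + dim hh > CARD('n)" using R(3) by simp
  define D where "D s = det (matrix (\<lambda>v. P s v - v + R v))" for s
  have "entire_real D"
  proof -
    have "entire_real (\<lambda>s. matrix (\<lambda>v. P s v - v + R v) $ i $ j)" for i j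
    proof -
      \<comment> \<open>Moving \<open>Q t\<close> to the other side of the inner product leaves a
        coefficient of \<open>eprod\<close>, which is entire.\<close>
      have "P s v $ i = eprod Ys s v \<bullet> adjoint (Q t) (axis i 1)" for s v
        by (simp add: P_def adjoint_works[OF lQ] inner_axis)
      then have "matrix (\<lambda>v. P s v - v + R v) $ i $ j =
          eprod Ys s (axis j 1) \<bullet> adjoint (Q t) (axis i 1) + (R (axis j 1) - axis j 1) $ i" for s
        by (simp add: matrix_def)
      then show ?thesis
        using entire_real_add[OF entire_eprod entire_real_const] by simp
    qed
    then show ?thesis
      unfolding D_def det_def
      by (intro entire_real_sum entire_real_mult entire_real_const entire_real_prod)
  qed
  moreover have "D s = 0" if "\<bar>s\<bar> < d" for s
    unfolding D_def using near[OF that] big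
    by (intro det_fixed_space_zero aut_linear[OF aP] R(1)) linarith
  ultimately have "D 1 = 0" using entire_real_zero[OF _ d(1)] by blast
  moreover have "D 1 = det (matrix (\<lambda>v. M v + R v))" by (simp add: D_def M_def P_def Ys)
  ultimately show False
    using R(2) det_nz_iff_inj[OF linear_compose_add[OF lM R(1)]] by simp
qed

end

section \<open>Restricted roots\<close>

lemma span_linear_image:
  assumes "linear f" "\<And>s. s \<in> S \<Longrightarrow> f s \<in> W" "subspace W" "v \<in> span S"
  shows "f v \<in> W"
  using assms(4)
proof (induction rule: span_induct)
  case base
  show ?case
    using assms(3) by (simp add: subspace_def linear_0[OF assms(1)] linear_add[OF assms(1)] linear_scale[OF assms(1)])
next
  case (step x)
  then show ?case by (rule assms(2))
qed

lemma subspace_projection: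
  fixes W :: "'a::euclidean_space set"
  assumes "subspace W"
  obtains p where "linear p" "\<And>v. p v \<in> W" "\<And>v. v \<in> W \<Longrightarrow> p v = v"
proof -
  let ?W' = "{y. \<forall>x\<in>W. orthogonal x y}"
  have W': "subspace ?W'" by (rule subspace_orthogonal_to_vectors)
  have int: "W \<inter> ?W' = {0}"
    using subspace_0[OF assms] subspace_0[OF W'] by (auto simp: orthogonal_def)
  have dec: "\<exists>a\<in>W. \<exists>b\<in>?W'. v = a + b" for v
  proof -
    obtain y z where yz: "y \<in> span W" "\<And>w. w \<in> span W \<Longrightarrow> orthogonal z w" "v = y + z"
      using orthogonal_subspace_decomp_exists[of W v] by blast
    have "y \<in> W" using yz(1) assms by (simp add: span_eq_iff[THEN iffD2])
    moreover have "z \<in> ?W'" using yz(2) span_base by (auto simp: orthogonal_commute)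
    ultimately show ?thesis using yz(3) by blast
  qed
  obtain p where "linear p" "\<And>v. p v \<in> W" "\<And>v. v \<in> W \<Longrightarrow> p v = v"
    using complementary_projection[OF assms W' int dec] by metis
  then show ?thesis by (rule that)
qed

section \<open>Restricted root spaces and the sum of the positive ones\<close>

locale theta_cartan_roots = theta_cartan br \<theta> X
  for br :: "real^'n::finite \<Rightarrow> real^'n \<Rightarrow> real^'n" and \<theta> :: "real^'n \<Rightarrow> real^'n" and X :: "real^'n" +
  fixes \<Sigma>p :: "(real^'n \<Rightarrow> real) set"
  assumes roots: "positive_restricted_roots br (stabilizer_algebra br X \<inter> minus_eigenspace \<theta>) \<Sigma>p"
begin

definition "aa = stabilizer_algebra br X \<inter> minus_eigenspace \<theta>"
definition "nn = nilpotent_part br aa \<Sigma>p"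
abbreviation "gg \<equiv> root_space br aa"

lemma aa_hh: "A \<in> aa \<Longrightarrow> A \<in> hh"
  by (simp add: aa_def hh_def)

text \<open>One ordering behind the choice of positive roots is fixed. It compares all functionals
  on \<open>aa\<close>, including sums of roots that are not roots.\<close>

definition "P = (SOME P. positivity_on aa P \<and> \<Sigma>p = restricted_roots br aa \<inter> P)"

lemma P: "positivity_on aa P" "\<Sigma>p = restricted_roots br aa \<inter> P"
proof -
  have "\<exists>P. positivity_on aa P \<and> \<Sigma>p = restricted_roots br aa \<inter> P"
    using roots by (simp add: positive_restricted_roots_def aa_def)
  from someI_ex[OF this]
  show "positivity_on aa P" "\<Sigma>p = restricted_roots br aa \<inter> P" by (auto simp: P_def)
qed

lemma P_dual: "\<alpha> \<in> P \<Longrightarrow> \<alpha> \<in> dual_on aa" and P_zero: "(\<lambda>H\<in>aa. 0) \<notin> P"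
  and P_add: "\<alpha> \<in> P \<Longrightarrow> \<beta> \<in> P \<Longrightarrow> (\<lambda>H\<in>aa. \<alpha> H + \<beta> H) \<in> P"
  and P_total: "\<alpha> \<in> dual_on aa \<Longrightarrow> \<alpha> \<noteq> (\<lambda>H\<in>aa. 0) \<Longrightarrow> \<alpha> \<in> P \<or> (\<lambda>H\<in>aa. - \<alpha> H) \<in> P"
  using P(1) unfolding positivity_on_def by blast+

lemma dual_ext: "\<alpha> \<in> dual_on aa \<Longrightarrow> \<beta> \<in> dual_on aa \<Longrightarrow> (\<And>A. A \<in> aa \<Longrightarrow> \<alpha> A = \<beta> A) \<Longrightarrow> \<alpha> = \<beta>"
  unfolding dual_on_def by (auto intro: extensionalityI)

lemma dual_diff: "\<alpha> \<in> dual_on aa \<Longrightarrow> \<beta> \<in> dual_on aa \<Longrightarrow> (\<lambda>H\<in>aa. \<alpha> H - \<beta> H) \<in> dual_on aa"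
proof -
  assume ab: "\<alpha> \<in> dual_on aa" "\<beta> \<in> dual_on aa"
  have "subspace (minus_eigenspace \<theta>)"
    unfolding minus_eigenspace_def subspace_def
    by (simp add: linear_0[OF linear_theta] linear_add[OF linear_theta] linear_scale[OF linear_theta])
  then have "subspace aa"
    unfolding aa_def using subspace_hh subspace_inter hh_def by metis
  then show ?thesis
    using ab by (simp add: dual_on_def subspace_add subspace_scale algebra_simps)
qed

lemma gg_iff: "v \<in> gg \<alpha> \<longleftrightarrow> (\<forall>A\<in>aa. br A v = \<alpha> A *\<^sub>R v)"
  by (simp add: root_space_def)

lemma subspace_gg: "subspace (gg \<alpha>)"
  unfolding subspace_def by (simp add: gg_iff br_simps algebra_simps)

lemma gg_hh:
  assumes "y \<in> hh" "v \<in> gg \<alpha>"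
  shows "br y v \<in> gg \<alpha>"
  unfolding gg_iff
proof
  fix A assume A: "A \<in> aa"
  have "br A (br y v) = br y (br A v)" by (rule br_commute_hh[OF aa_hh[OF A] assms(1)])
  then show "br A (br y v) = \<alpha> A *\<^sub>R br y v" using assms(2) A by (simp add: gg_iff br_rmul)
qed

lemma gg_br:
  assumes "u \<in> gg \<alpha>" "v \<in> gg \<beta>"
  shows "br u v \<in> gg (\<lambda>H\<in>aa. \<alpha> H + \<beta> H)"
  unfolding gg_iff
proof
  fix A assume A: "A \<in> aa"
  have "br A (br u v) = br (br A u) v + br u (br A v)" by (rule jacobi)
  then show "br A (br u v) = (\<lambda>H\<in>aa. \<alpha> H + \<beta> H) A *\<^sub>R br u v"
    using assms A by (simp add: gg_iff br_simps scaleR_add_left)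
qed

text \<open>The eigenvector argument: choose \<open>A\<close> with
  \<open>\<kappa> A \<noteq> \<mu> A\<close> and apply \<open>br A - \<mu> A\<close>, which kills
  the component for \<open>\<mu>\<close> and rescales the others.\<close>

lemma gg_disjoint_sum:
  assumes "finite F" "F \<subseteq> dual_on aa"
  shows "(\<And>\<kappa>. \<kappa> \<in> F \<Longrightarrow> f \<kappa> \<in> gg \<kappa>) \<Longrightarrow> (\<Sum>\<kappa>\<in>F. f \<kappa>) = 0 \<Longrightarrow> \<kappa> \<in> F \<Longrightarrow> f \<kappa> = 0"
  using assms
proof (induction F arbitrary: f \<kappa>)
  case (insert \<mu> F)
  have sum: "(\<Sum>\<kappa>\<in>F. f \<kappa>) = - f \<mu>"
    using insert by (simp add: eq_neg_iff_add_eq_0 add.commute)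
  have 0: "f \<kappa> = 0" if l: "\<kappa> \<in> F" for \<kappa>
  proof -
    have "\<kappa> \<noteq> \<mu>" "\<kappa> \<in> dual_on aa" "\<mu> \<in> dual_on aa" using l insert by auto
    then obtain A where A: "A \<in> aa" "\<kappa> A \<noteq> \<mu> A" using dual_ext by blast
    have "(\<Sum>\<nu>\<in>F. (\<nu> A - \<mu> A) *\<^sub>R f \<nu>) = br A (\<Sum>\<nu>\<in>F. f \<nu>) - \<mu> A *\<^sub>R (\<Sum>\<nu>\<in>F. f \<nu>)"
    proof -
      have "br A (f \<nu>) = \<nu> A *\<^sub>R f \<nu>" if "\<nu> \<in> F" for \<nu>
        using insert.prems(1)[of \<nu>] that A(1) by (simp add: gg_iff)
      then show ?thesis
        by (simp add: linear_sum[OF linear_br] scaleR_sum_right scaleR_diff_left sum_subtractf)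
    qed
    also have "\<dots> = 0"
      using insert.prems(1)[of \<mu>] A(1) by (simp add: sum gg_iff br_rneg)
    finally have s0: "(\<Sum>\<nu>\<in>F. (\<nu> A - \<mu> A) *\<^sub>R f \<nu>) = 0" .
    have "(\<kappa> A - \<mu> A) *\<^sub>R f \<kappa> = 0"
    proof (rule insert.IH[OF _ s0 l])
      show "(\<nu> A - \<mu> A) *\<^sub>R f \<nu> \<in> gg \<nu>" if "\<nu> \<in> F" for \<nu>
        using insert.prems(1) that by (intro subspace_scale subspace_gg) auto
    qed (use insert.prems in auto)
    then show ?thesis using A(2) by simp
  qed
  then have "f \<mu> = 0" using sum by simp
  then show ?case using 0 insert.prems(3) by auto
qed simp

lemma span_gg_sum:
  assumes "v \<in> span (\<Union>\<alpha>\<in>\<Lambda>. gg \<alpha>)"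
  obtains F f where "finite F" "F \<subseteq> \<Lambda>" "\<And>\<kappa>. \<kappa> \<in> F \<Longrightarrow> f \<kappa> \<in> gg \<kappa>" "v = (\<Sum>\<kappa>\<in>F. f \<kappa>)"
proof -
  define W where "W = {v. \<exists>F f. finite F \<and> F \<subseteq> \<Lambda> \<and> (\<forall>\<kappa>\<in>F. f \<kappa> \<in> gg \<kappa>) \<and> v = (\<Sum>\<kappa>\<in>F. f \<kappa>)}"
  have "subspace W"
    unfolding subspace_def
  proof (intro conjI ballI allI)
    show "0 \<in> W" unfolding W_def by (intro CollectI exI[of _ "{}"] exI[of _ "\<lambda>_. 0"]) simp
  next
    fix x y assume "x \<in> W" "y \<in> W"
    then obtain F f F' f' where 1: "finite F" "F \<subseteq> \<Lambda>" "\<forall>\<kappa>\<in>F. f \<kappa> \<in> gg \<kappa>" "x = (\<Sum>\<kappa>\<in>F. f \<kappa>)"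
      and 2: "finite F'" "F' \<subseteq> \<Lambda>" "\<forall>\<kappa>\<in>F'. f' \<kappa> \<in> gg \<kappa>" "y = (\<Sum>\<kappa>\<in>F'. f' \<kappa>)"
      unfolding W_def by blast
    let ?h = "\<lambda>\<kappa>. (if \<kappa> \<in> F then f \<kappa> else 0) + (if \<kappa> \<in> F' then f' \<kappa> else 0)"
    have "x = (\<Sum>\<kappa>\<in>F \<union> F'. if \<kappa> \<in> F then f \<kappa> else 0)" "y = (\<Sum>\<kappa>\<in>F \<union> F'. if \<kappa> \<in> F' then f' \<kappa> else 0)"
      using 1(1,4) 2(1,4) by (simp_all add: sum.inter_restrict[symmetric] Int_absorb1)
    then have "x + y = (\<Sum>\<kappa>\<in>F \<union> F'. ?h \<kappa>)" by (simp add: sum.distrib)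
    moreover have "\<forall>\<kappa>\<in>F \<union> F'. ?h \<kappa> \<in> gg \<kappa>"
      using 1(3) 2(3) subspace_0[OF subspace_gg] by (auto intro!: subspace_add[OF subspace_gg])
    ultimately show "x + y \<in> W"
      unfolding W_def using 1(1,2) 2(1,2) by (intro CollectI exI[of _ "F \<union> F'"] exI[of _ ?h]) simp
  next
    fix c x assume "x \<in> W"
    then obtain F f where 1: "finite F" "F \<subseteq> \<Lambda>" "\<forall>\<kappa>\<in>F. f \<kappa> \<in> gg \<kappa>" "x = (\<Sum>\<kappa>\<in>F. f \<kappa>)"
      unfolding W_def by blast
    then show "c *\<^sub>R x \<in> W"
      unfolding W_def
      by (intro CollectI exI[of _ F] exI[of _ "\<lambda>\<kappa>. c *\<^sub>R f \<kappa>"])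
        (simp add: scaleR_sum_right subspace_scale[OF subspace_gg])
  qed
  moreover have "(\<Union>\<alpha>\<in>\<Lambda>. gg \<alpha>) \<subseteq> W"
  proof
    fix v assume "v \<in> (\<Union>\<alpha>\<in>\<Lambda>. gg \<alpha>)"
    then obtain \<alpha> where "\<alpha> \<in> \<Lambda>" "v \<in> gg \<alpha>" by blast
    then show "v \<in> W"
      unfolding W_def by (intro CollectI exI[of _ "{\<alpha>}"] exI[of _ "\<lambda>_. v"]) simp
  qed
  ultimately have "v \<in> W" using assms span_minimal[of _ W] by (meson subsetD)
  then obtain F f where "finite F" "F \<subseteq> \<Lambda>" "\<forall>\<kappa>\<in>F. f \<kappa> \<in> gg \<kappa>" "v = (\<Sum>\<kappa>\<in>F. f \<kappa>)"
    unfolding W_def by auto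
  then show ?thesis by (intro that[of F f]) auto
qed

lemma gg_span_disjoint:
  assumes "v \<in> gg \<alpha>" "\<alpha> \<in> dual_on aa" "\<Lambda> \<subseteq> dual_on aa" "\<alpha> \<notin> \<Lambda>" "v \<in> span (\<Union>\<beta>\<in>\<Lambda>. gg \<beta>)"
  shows "v = 0"
proof -
  obtain F f where F: "finite F" "F \<subseteq> \<Lambda>" "\<And>\<kappa>. \<kappa> \<in> F \<Longrightarrow> f \<kappa> \<in> gg \<kappa>" "v = (\<Sum>\<kappa>\<in>F. f \<kappa>)"
    using span_gg_sum[OF assms(5)] by blast
  have a: "\<alpha> \<notin> F" using F(2) assms(4) by blast
  let ?h = "\<lambda>\<kappa>. if \<kappa> = \<alpha> then - v else f \<kappa>"
  have "(\<Sum>\<kappa>\<in>F. ?h \<kappa>) = v" unfolding F(4) using a by (intro sum.cong) auto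
  then have "(\<Sum>\<kappa>\<in>insert \<alpha> F. ?h \<kappa>) = 0" using F(1) a by simp
  moreover have "?h \<kappa> \<in> gg \<kappa>" if "\<kappa> \<in> insert \<alpha> F" for \<kappa>
    using that F(3) assms(1) subspace_neg[OF subspace_gg] by auto
  ultimately have "?h \<alpha> = 0"
    using F(1,2) assms(2,3) by (intro gg_disjoint_sum[of "insert \<alpha> F" ?h]) auto
  then show ?thesis by simp
qed

lemma nn_span: "nn = span (\<Union>\<alpha>\<in>\<Sigma>p. gg \<alpha>)"
  by (simp add: nn_def nilpotent_part_def)

lemma subspace_nn: "subspace nn"
  by (simp add: nn_span subspace_span)

text \<open>If the positive functional is not a restricted root, its space is zero; brackets can
  therefore be handled without asking whether a sum of roots is a root.\<close>

lemma gg_nn: "\<alpha> \<in> P \<Longrightarrow> v \<in> gg \<alpha> \<Longrightarrow> v \<in> nn"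
proof (cases "v = 0")
  case False
  assume a: "\<alpha> \<in> P" "v \<in> gg \<alpha>"
  then have "\<alpha> \<in> restricted_roots br aa"
    using False P_dual P_zero by (auto simp: restricted_roots_def)
  then show ?thesis using a P(2) by (auto simp: nn_span intro: span_base)
qed (simp add: subspace_0[OF subspace_nn])

lemma nn_invariant:
  assumes "linear f" "\<And>\<alpha> v. \<alpha> \<in> P \<Longrightarrow> v \<in> gg \<alpha> \<Longrightarrow> f v \<in> nn" "v \<in> nn"
  shows "f v \<in> nn"
proof (rule span_linear_image[OF assms(1) _ subspace_nn])
  show "v \<in> span (\<Union>\<alpha>\<in>\<Sigma>p. gg \<alpha>)" using assms(3) by (simp only: nn_span)
  fix w assume "w \<in> (\<Union>\<alpha>\<in>\<Sigma>p. gg \<alpha>)"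
  then obtain \<alpha> where "\<alpha> \<in> P" "w \<in> gg \<alpha>" using P(2) by blast
  then show "f w \<in> nn" by (rule assms(2))
qed

lemma br_hh_nn: "y \<in> hh \<Longrightarrow> v \<in> nn \<Longrightarrow> br y v \<in> nn"
  by (rule nn_invariant[OF linear_br]) (use gg_hh gg_nn in blast)+

lemma br_nn_nn:
  assumes "u \<in> nn" "v \<in> nn"
  shows "br u v \<in> nn"
proof (rule nn_invariant[OF linear_br _ assms(2)])
  fix \<beta> v assume v: "\<beta> \<in> P" "v \<in> gg \<beta>"
  show "br u v \<in> nn"
    by (rule nn_invariant[OF linear_br_left _ assms(1)]) (use gg_br v P_add gg_nn in blast)
qed

lemma aut_nn:
  assumes S: "aut S" "\<And>y. y \<in> hh \<Longrightarrow> S y = y" and v: "v \<in> nn"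
  shows "S v \<in> nn"
proof (rule nn_invariant[OF aut_linear[OF S(1)] _ v])
  fix \<alpha> v assume v: "\<alpha> \<in> P" "v \<in> gg \<alpha>"
  have "S v \<in> gg \<alpha>"
    unfolding gg_iff
  proof
    fix A assume A: "A \<in> aa"
    have "br A (S v) = S (br A v)" using aut_br[OF S(1), of A v] S(2)[OF aa_hh[OF A]] by simp
    then show "br A (S v) = \<alpha> A *\<^sub>R S v"
      using v(2) A by (simp add: gg_iff linear_scale[OF aut_linear[OF S(1)]])
  qed
  then show "S v \<in> nn" using gg_nn v(1) by blast
qed

text \<open>For a root pick \<open>A\<close> with \<open>\<alpha> A \<noteq> 0\<close>: then
  \<open>br A\<close> kills the \<open>hh\<close> component of \<open>v\<close>, keeps the other in
  \<open>mm\<close>, and multiplies \<open>v\<close> by \<open>\<alpha> A\<close>.\<close>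

lemma nn_mm:
  assumes "v \<in> nn"
  shows "v \<in> mm"
  using assms unfolding nn_span
proof (rule span_linear_image[OF linear_ident _ subspace_mm, rotated])
  fix v assume "v \<in> (\<Union>\<alpha>\<in>\<Sigma>p. gg \<alpha>)"
  then obtain \<alpha> where a: "\<alpha> \<in> P" "v \<in> gg \<alpha>" using P(2) by blast
  have z: "(\<lambda>H\<in>aa. 0) \<in> dual_on aa" using dual_diff[OF P_dual[OF a(1)] P_dual[OF a(1)]] by simp
  have "\<alpha> \<noteq> (\<lambda>H\<in>aa. 0)" using a(1) P_zero by blast
  then obtain A where A: "A \<in> aa" "\<alpha> A \<noteq> 0"
    using dual_ext[OF P_dual[OF a(1)] z] by auto
  obtain y w where yw: "y \<in> hh" "w \<in> mm" "v = y + w" using hh_mm_decomposition by blast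
  have "br A v = br A w" using hh_commute[OF aa_hh[OF A(1)] yw(1)] yw(3) by (simp add: br_radd)
  then have "\<alpha> A *\<^sub>R v \<in> mm" using a(2) A(1) br_hh_mm[OF aa_hh[OF A(1)] yw(2)] by (simp add: gg_iff)
  then have "(1 / \<alpha> A) *\<^sub>R \<alpha> A *\<^sub>R v \<in> mm" by (rule subspace_scale[OF subspace_mm])
  then show "v \<in> mm" using A(2) by simp
qed

lemma nn_hh: "v \<in> nn \<Longrightarrow> v \<in> hh \<Longrightarrow> v = 0"
  using nn_mm hh_mm by blast

lemma br_X_nn: "br X ` nn = nn"
  by (rule linear_inj_on_subspace_surj[OF linear_br subspace_nn])
    (use br_hh_nn[OF X_hh] nn_hh hh_iff in auto)

text \<open>Write \<open>v = br X w\<close> and use invariance: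
  \<open>B X (br X w) = B (br X X) w\<close>.\<close>

lemma B_X_nn:
  assumes "v \<in> nn"
  shows "B X v = 0"
proof -
  obtain w where "v = br X w" using assms br_X_nn by blast
  then show ?thesis using B_invariant[of X X w] by (simp add: br_self B_simps)
qed

section \<open>The action on the affine space \<open>H + nn\<close>\<close>

lemma finite_minimal:
  assumes "finite F" "F \<noteq> {}" "\<And>x y z. r x y \<Longrightarrow> r y z \<Longrightarrow> r x z" "\<And>x. \<not> r x x"
  shows "\<exists>m\<in>F. \<forall>x\<in>F. \<not> r x m"
  using assms(1,2)
proof (induction F rule: finite_ne_induct)
  case (singleton x)
  then show ?case using assms(4) by simp
next
  case (insert x F)
  then obtain m where "m \<in> F" "\<forall>y\<in>F. \<not> r y m" by blast
  then show ?case using assms(3,4) by (cases "r x m") blast+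
qed

text \<open>Compare the components of lowest weight.\<close>

lemma br_injective_nn:
  assumes H: "H \<in> hh" "\<And>v. v \<in> nn \<Longrightarrow> br H v = 0 \<Longrightarrow> v = 0"
    and V: "V \<in> nn" and U: "U \<in> nn" "br (H + V) U = 0"
  shows "U = 0"
proof (rule ccontr)
  assume U0: "U \<noteq> 0"
  define r where "r \<alpha> \<beta> \<longleftrightarrow> \<alpha> \<in> dual_on aa \<and> \<beta> \<in> dual_on aa \<and> (\<lambda>H\<in>aa. \<beta> H - \<alpha> H) \<in> P" for \<alpha> \<beta>
  have trans: "r \<alpha> \<gamma>" if "r \<alpha> \<beta>" "r \<beta> \<gamma>" for \<alpha> \<beta> \<gamma>
  proof -
    have "(\<lambda>H\<in>aa. \<beta> H - \<alpha> H) \<in> P" "(\<lambda>H\<in>aa. \<gamma> H - \<beta> H) \<in> P"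
      using that unfolding r_def by blast+
    then have "(\<lambda>H\<in>aa. (\<lambda>H\<in>aa. \<beta> H - \<alpha> H) H + (\<lambda>H\<in>aa. \<gamma> H - \<beta> H) H) \<in> P"
      by (rule P_add)
    moreover have "(\<lambda>H\<in>aa. (\<lambda>H\<in>aa. \<beta> H - \<alpha> H) H + (\<lambda>H\<in>aa. \<gamma> H - \<beta> H) H) = (\<lambda>H\<in>aa. \<gamma> H - \<alpha> H)"
      by (auto simp: restrict_def)
    ultimately show ?thesis using that by (simp add: r_def)
  qed
  have irrefl: "\<not> r \<alpha> \<alpha>" for \<alpha> using P_zero by (simp add: r_def)
  have total: "r \<alpha> \<beta> \<or> r \<beta> \<alpha>" if "\<alpha> \<in> P" "\<beta> \<in> P" "\<alpha> \<noteq> \<beta>" for \<alpha> \<beta>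
  proof -
    let ?d = "\<lambda>H\<in>aa. \<beta> H - \<alpha> H"
    have d: "\<alpha> \<in> dual_on aa" "\<beta> \<in> dual_on aa" using that P_dual by blast+
    have "?d \<noteq> (\<lambda>H\<in>aa. 0)"
    proof
      assume e: "?d = (\<lambda>H\<in>aa. 0)"
      have "\<alpha> A = \<beta> A" if "A \<in> aa" for A using fun_cong[OF e, of A] that by simp
      then show False using dual_ext[OF d] \<open>\<alpha> \<noteq> \<beta>\<close> by blast
    qed
    then have "?d \<in> P \<or> (\<lambda>H\<in>aa. - ?d H) \<in> P" by (rule P_total[OF dual_diff[OF d(2,1)]])
    moreover have "(\<lambda>H\<in>aa. - ?d H) = (\<lambda>H\<in>aa. \<alpha> H - \<beta> H)" by (auto simp: restrict_def)
    ultimately show ?thesis using d by (simp add: r_def)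
  qed
  obtain F f where F: "finite F" "F \<subseteq> \<Sigma>p" "\<And>\<kappa>. \<kappa> \<in> F \<Longrightarrow> f \<kappa> \<in> gg \<kappa>" "U = (\<Sum>\<kappa>\<in>F. f \<kappa>)"
    using span_gg_sum U(1) unfolding nn_span by blast
  define F0 where "F0 = {\<kappa>\<in>F. f \<kappa> \<noteq> 0}"
  have U_eq: "U = (\<Sum>\<kappa>\<in>F0. f \<kappa>)"
    unfolding F(4) F0_def using F(1) by (intro sum.mono_neutral_right) auto
  have F0: "finite F0" "F0 \<noteq> {}" using F(1) U0 U_eq by (simp add: F0_def) (use U0 U_eq in force)
  obtain m where m: "m \<in> F0" "\<And>x. x \<in> F0 \<Longrightarrow> \<not> r x m"
    using finite_minimal[OF F0, of r] trans irrefl by blast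
  have FP: "\<kappa> \<in> P" if "\<kappa> \<in> F0" for \<kappa> using that F(2) P(2) by (auto simp: F0_def)
  \<comment> \<open>The weights strictly above the lowest weight \<open>m\<close> of
    \<open>U\<close>. All terms of \<open>br (H + V) U\<close> except \<open>br H (f m)\<close> have
    such weights, while that term has weight \<open>m\<close>, so it must vanish.\<close>
  let ?L = "{\<nu>. r m \<nu>}"
  let ?W = "span (\<Union>\<nu>\<in>?L. gg \<nu>)"
  have Wg: "v \<in> ?W" if "v \<in> gg \<nu>" "r m \<nu>" for v \<nu> using that by (intro span_base) blast
  have Hf: "br H (f \<kappa>) \<in> gg \<kappa>" if "\<kappa> \<in> F0" for \<kappa>
    using that F(3) gg_hh[OF H(1)] by (simp add: F0_def)
  have 1: "br H (f \<kappa>) \<in> ?W" if "\<kappa> \<in> F0 - {m}" for \<kappa>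
  proof -
    have "r m \<kappa>" using total[of \<kappa> m] m FP that by blast
    then show ?thesis using Wg Hf that by blast
  qed
  have 2: "br V (f \<kappa>) \<in> ?W" if "\<kappa> \<in> F0" for \<kappa>
    using V unfolding nn_span
  proof (rule span_linear_image[OF linear_br_left _ subspace_span, rotated])
    fix w assume "w \<in> (\<Union>\<alpha>\<in>\<Sigma>p. gg \<alpha>)"
    then obtain \<mu> where mu: "\<mu> \<in> P" "w \<in> gg \<mu>" using P(2) by blast
    let ?n = "\<lambda>H\<in>aa. \<mu> H + \<kappa> H"
    have "br w (f \<kappa>) \<in> gg ?n" using gg_br[OF mu(2)] F(3) that by (simp add: F0_def)
    moreover have "r m ?n"
    proof -
      have n: "?n \<in> P" using P_add[OF mu(1) FP[OF that]] .
      have "(\<lambda>H\<in>aa. ?n H - m H) \<in> P"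
      proof (cases "\<kappa> = m")
        case True
        have "(\<lambda>H\<in>aa. ?n H - m H) = \<mu>"
          using P_dual[OF mu(1)] True by (auto simp: dual_on_def extensional_def restrict_def)
        then show ?thesis using mu(1) by simp
      next
        case False
        then have "r m \<kappa>" using total[of \<kappa> m] m FP that by blast
        then have "(\<lambda>H\<in>aa. \<kappa> H - m H) \<in> P" unfolding r_def by blast
        then have "(\<lambda>H\<in>aa. \<mu> H + (\<lambda>H\<in>aa. \<kappa> H - m H) H) \<in> P" by (rule P_add[OF mu(1)])
        moreover have "(\<lambda>H\<in>aa. \<mu> H + (\<lambda>H\<in>aa. \<kappa> H - m H) H) = (\<lambda>H\<in>aa. ?n H - m H)"
          by (auto simp: restrict_def)
        ultimately show ?thesis by simp
      qed
      then show ?thesis using P_dual[OF n] P_dual[OF FP[OF m(1)]] by (simp add: r_def)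
    qed
    ultimately show "br w (f \<kappa>) \<in> ?W" by (rule Wg)
  qed
  have "br H (f m) + (\<Sum>\<kappa>\<in>F0 - {m}. br H (f \<kappa>)) + (\<Sum>\<kappa>\<in>F0. br V (f \<kappa>)) = br (H + V) U"
    unfolding U_eq br_ladd linear_sum[OF linear_br] using sum.remove[OF F0(1) m(1), of "\<lambda>\<kappa>. br H (f \<kappa>)"]
    by (simp add: sum.distrib)
  then have "br H (f m) = - ((\<Sum>\<kappa>\<in>F0 - {m}. br H (f \<kappa>)) + (\<Sum>\<kappa>\<in>F0. br V (f \<kappa>)))"
    by (intro eq_neg_iff_add_eq_0[THEN iffD2]) (simp add: U(2) add.assoc)
  moreover have "- ((\<Sum>\<kappa>\<in>F0 - {m}. br H (f \<kappa>)) + (\<Sum>\<kappa>\<in>F0. br V (f \<kappa>))) \<in> ?W"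
    using 1 2 by (intro span_neg span_add span_sum)
  ultimately have "br H (f m) \<in> ?W" by simp
  then have "br H (f m) = 0"
    by (intro gg_span_disjoint[OF Hf[OF m(1)] P_dual[OF FP[OF m(1)]]]) (auto simp: r_def P_zero)
  moreover have "f m \<in> nn" using gg_nn[OF FP[OF m(1)]] F(3) m(1) by (simp add: F0_def)
  ultimately have "f m = 0" using H(2) by blast
  then show False using m(1) by (simp add: F0_def)
qed

text \<open>Stated for \<open>H\<close> and not only for \<open>X\<close>, because the charts also
  need it at points of \<open>hh\<close> close to \<open>X\<close>.\<close>

lemma nn_transitive:
  assumes H: "H \<in> hh" "\<And>v. v \<in> nn \<Longrightarrow> br H v = 0 \<Longrightarrow> v = 0" and V: "V \<in> nn"
  obtains S where "S \<in> inner_auts" "\<And>v. v \<in> nn \<Longrightarrow> S v \<in> nn" "S H = H + V"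
proof -
  \<comment> \<open>Asking for invariance of \<open>nn\<close> under the inverse too makes the
    relation \<open>R\<close> symmetric, and the automorphism finally obtained still preserves
    \<open>nn\<close>.\<close>
  define N where "N = {S \<in> inner_auts. \<forall>v\<in>nn. S v \<in> nn \<and> finv S v \<in> nn}"
  define R where "R y z \<longleftrightarrow> (\<exists>S\<in>N. S y = z)" for y z
  obtain p where p: "linear p" "\<And>v. p v \<in> nn" "\<And>v. v \<in> nn \<Longrightarrow> p v = v"
    using subspace_projection[OF subspace_nn] by blast
  have expN: "exp_lin (br u) \<in> N" if u: "u \<in> nn" for u
  proof -
    have inv: "finv (exp_lin (br u)) v = exp_lin (br (- u)) v" for v
    proof -
      have "exp_lin (br u) (exp_lin (br (- u)) v) = v"
        using exp_lin_minus(1)[OF linear_br, of u v] by (simp add: br_lneg[abs_def])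
      then show ?thesis using aut_inv(3)[OF aut_exp[of u], of "exp_lin (br (- u)) v"] by simp
    qed
    have "exp_lin (br w) v \<in> nn" if "w \<in> nn" "v \<in> nn" for w v
      by (rule exp_lin_invariant[OF linear_br subspace_nn _ that(2)]) (rule br_nn_nn[OF that(1)])
    then show ?thesis
      using u inner_exp subspace_neg[OF subspace_nn] by (auto simp: N_def inv)
  qed
  let ?C = "(\<lambda>v. H + v) ` nn"
  have "R H (H + V)"
  proof (rule connected_equivalence_relation[of ?C])
    show "connected ?C"
      using subspace_imp_convex[OF subspace_nn] convex_connected convex_translation by blast
    show "H \<in> ?C" using subspace_0[OF subspace_nn] by force
    show "H + V \<in> ?C" using V by blast
    show "R z y" if yz: "R y z" for y z
    proof -
      obtain S where S: "S \<in> N" "S y = z" using yz by (auto simp: R_def)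
      then have a: "aut S" using inner_aut by (auto simp: N_def)
      have "finv (finv S) = S" using a by (simp add: aut_def inv_inv_eq)
      then have "finv S \<in> N" using S(1) inner_inv by (simp add: N_def)
      moreover have "finv S z = y" using S(2) aut_inv(3)[OF a] by blast
      ultimately show ?thesis by (auto simp: R_def)
    qed
    show "R x z" if xyz: "R x y" "R y z" for x y z
    proof -
      obtain S S' where S: "S \<in> N" "S x = y" "S' \<in> N" "S' y = z"
        using xyz unfolding R_def by blast
      then have a: "aut S" "aut S'" using inner_aut by (auto simp: N_def)
      let ?T = "\<lambda>v. S' (S v)"
      have "finv ?T v = finv S (finv S' v)" for v
      proof -
        have "?T (finv S (finv S' v)) = v" by (simp add: aut_inv[OF a(1)] aut_inv[OF a(2)])
        then show ?thesis using aut_inv(3)[OF aut_compose[OF a(2,1)], of "finv S (finv S' v)"] by simp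
      qed
      then have "?T \<in> N" using S inner_compose by (auto simp: N_def)
      then show ?thesis using S by (auto simp: R_def)
    qed
    show "\<exists>T. openin (top_of_set ?C) T \<and> y \<in> T \<and> (\<forall>x\<in>T. R y x)" if y: "y \<in> ?C" for y
    proof -
      obtain W where W: "W \<in> nn" "y = H + W" using y by blast
      have by_nn: "br u y \<in> nn" if "u \<in> nn" for u
      proof -
        have "br u y = - br H u + br u W"
          unfolding W(2) br_radd by (subst br_anticommute) simp
        then show ?thesis
          using br_hh_nn[OF H(1) that] br_nn_nn[OF that W(1)] subspace_nn
          by (simp add: subspace_diff)
      qed
      have inj_y: "u = 0" if "u \<in> nn" "br u y = 0" for u
        using br_injective_nn[OF H W(1) that(1)] that(2) br_anticommute[of u y] W(2) by simp
      have bil_br: "bilinear (\<lambda>x. br (p x))"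
        using p(1) unfolding bilinear_def by (auto simp: linear_br) (simp add: linear_iff br_simps)
      \<comment> \<open>The summand \<open>x - p x\<close> fills up the directions outside
        \<open>nn\<close>, so that the open mapping theorem applies in the whole space. Whenever
        \<open>f x\<close> lies in \<open>nn\<close>, so does \<open>x - p x\<close>; as
        \<open>p\<close> fixes \<open>nn\<close> and kills this vector, it is 0 and the exponential
        alone realizes the displacement.\<close>
      define f where "f x = (exp_lin (br (p x)) y - y) + (x - p x)" for x
      have bp: "bounded_linear p" using p(1) by (simp add: linear_conv_bounded_linear)
      have cont: "continuous_on UNIV f"
        unfolding f_def
        by (intro continuous_intros continuous_on_exp_lin[OF bil_br] bounded_linear.continuous_on[OF bp])
      let ?f' = "\<lambda>h. br (p h) y + (h - p h)"
      have der: "(f has_derivative ?f') (at 0)"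
      proof -
        have 1: "((\<lambda>x. exp_lin (br (p x)) y - y) has_derivative (\<lambda>h. br (p h) y - 0)) (at 0)"
          by (rule has_derivative_diff[OF exp_lin_derivative_0[OF bil_br] has_derivative_const])
        have 2: "((\<lambda>x. x - p x) has_derivative (\<lambda>h. h - p h)) (at 0)"
          by (rule has_derivative_diff[OF has_derivative_ident bounded_linear_imp_has_derivative[OF bp]])
        show ?thesis unfolding f_def using has_derivative_add[OF 1 2] by simp
      qed
      have lf': "linear ?f'"
        using der has_derivative_linear by blast
      have "inj ?f'"
        unfolding linear_injective_0[OF lf']
      proof (intro allI impI)
        fix h assume h: "?f' h = 0"
        then have e: "h - p h = - br (p h) y" by (simp add: eq_neg_iff_add_eq_0 add.commute)
        then have "h - p h \<in> nn" using by_nn[OF p(2)] subspace_neg[OF subspace_nn] by simp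
        then have "p (h - p h) = h - p h" by (rule p(3))
        moreover have "p (h - p h) = 0" using p(3)[OF p(2)] by (simp add: linear_diff[OF p(1)])
        ultimately have hp: "h = p h" by simp
        then have "br (p h) y = 0" using e by simp
        then have "p h = 0" by (rule inj_y[OF p(2)])
        then show "h = 0" by (subst hp)
      qed
      then obtain g where g: "linear g" "\<And>x. ?f' (g x) = x"
        using linear_injective_isomorphism[OF lf'] by auto
      have "f 0 \<in> interior (f ` UNIV)"
        by (rule sussmann_open_mapping[OF open_UNIV cont UNIV_I der])
          (use g in \<open>auto simp: linear_conv_bounded_linear fun_eq_iff\<close>)
      moreover have "f 0 = 0" by (simp add: f_def linear_0[OF p(1)] exp_lin_br_zero)
      ultimately obtain e where e: "e > 0" "ball 0 e \<subseteq> range f"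
        by (auto simp: mem_interior)
      have Ry: "R y x" if x: "x \<in> ?C" "dist x y < e" for x
      proof -
        obtain W' where W': "W' \<in> nn" "x = H + W'" using x(1) by blast
        have d: "x - y \<in> nn" using W W' subspace_diff[OF subspace_nn W'(1) W(1)] by simp
        have "x - y \<in> ball 0 e" using x(2) by (simp add: dist_norm norm_minus_commute)
        then obtain z where z: "x - y = f z" using e(2) by blast
        have "exp_lin (br (p z)) y - y \<in> nn"
          by (rule exp_lin_displacement[OF linear_br subspace_nn br_nn_nn[OF p(2)] by_nn[OF p(2)]])
        then have "(x - y) - (exp_lin (br (p z)) y - y) \<in> nn" by (rule subspace_diff[OF subspace_nn d])
        then have "z - p z \<in> nn" by (simp add: z f_def)
        then have "p (z - p z) = z - p z" by (rule p(3))
        moreover have "p (z - p z) = 0" using p(3)[OF p(2)] by (simp add: linear_diff[OF p(1)])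
        ultimately have "exp_lin (br (p z)) y = x" using z by (simp add: f_def)
        then show ?thesis using expN[OF p(2)] by (auto simp: R_def)
      qed
      show ?thesis
        by (rule exI[of _ "?C \<inter> ball y e"]) (use y e(1) Ry in \<open>auto simp: dist_commute\<close>)
    qed
  qed
  then show ?thesis using that by (auto simp: R_def N_def)
qed

end

section \<open>The leaves\<close>

text \<open>Projecting the displacement onto \<open>W\<close> changes nothing, so projecting the
  velocity changes nothing either.\<close>

lemma vector_derivative_in_subspace:
  fixes \<gamma> :: "real \<Rightarrow> 'a::euclidean_space"
  assumes W: "subspace W" and e: "e > 0" and \<gamma>: "\<And>t. \<bar>t\<bar> < e \<Longrightarrow> \<gamma> t - \<gamma> 0 \<in> W"
    and d: "(\<gamma> has_vector_derivative v) (at 0)"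
  shows "v \<in> W"
proof -
  obtain p where p: "linear p" "\<And>v. p v \<in> W" "\<And>v. v \<in> W \<Longrightarrow> p v = v"
    using subspace_projection[OF W] by metis
  have bp: "bounded_linear p" using p(1) by (simp add: linear_conv_bounded_linear)
  have 1: "((\<lambda>t. \<gamma> t - \<gamma> 0) has_vector_derivative v) (at 0)"
    using has_vector_derivative_diff_const[of \<gamma> "\<gamma> 0" v "at 0"] d by simp
  have "((\<lambda>t. p (\<gamma> t - \<gamma> 0)) has_vector_derivative p v) (at 0)"
    by (rule bounded_linear.has_vector_derivative[OF bp 1])
  then have "((\<lambda>t. \<gamma> t - \<gamma> 0) has_vector_derivative p v) (at 0)"
  proof (rule has_vector_derivative_transform_within_open[of _ _ _ "{-e<..<e}"])
    fix t assume "t \<in> {-e<..<e}"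
    then show "p (\<gamma> t - \<gamma> 0) = \<gamma> t - \<gamma> 0" by (intro p(3) \<gamma>) auto
  qed (use e in auto)
  then have "p v = v" using 1 by (rule vector_derivative_unique_at)
  then show ?thesis using p(2) by metis
qed

section \<open>The partition of the orbit into leaves, their tangent spaces and isotropy\<close>

context theta_cartan_roots
begin

definition "leaf S = (\<lambda>v. S (X + v)) ` nn"
definition "orbit = (\<lambda>S. S X) ` inner_auts"
definition "leaves = leaf ` inner_auts"

lemma inner_linear: "S \<in> inner_auts \<Longrightarrow> linear S"
  using inner_aut aut_linear by blast

lemma X_injective_nn: "v \<in> nn \<Longrightarrow> br X v = 0 \<Longrightarrow> v = 0"
  using nn_hh hh_iff by blast

lemma orbit_inner:
  assumes "S \<in> inner_auts" "y \<in> orbit"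
  shows "S y \<in> orbit"
proof -
  obtain R where R: "R \<in> inner_auts" "y = R X" using assms(2) by (auto simp: orbit_def)
  then show ?thesis using inner_compose[OF assms(1) R(1)] by (force simp: orbit_def)
qed

lemma X_orbit: "X \<in> orbit"
  using identity_inner by (force simp: orbit_def)

lemma X_nn_orbit:
  assumes "H \<in> hh" "\<And>v. v \<in> nn \<Longrightarrow> br H v = 0 \<Longrightarrow> v = 0" "v \<in> nn"
  shows "H + v \<in> orbit \<longleftrightarrow> H \<in> orbit"
proof -
  obtain S where S: "S \<in> inner_auts" "S H = H + v" using nn_transitive[OF assms] by metis
  have "finv S (H + v) = H" using S aut_inv(3)[OF inner_aut] by metis
  then show ?thesis using S orbit_inner inner_inv by metis
qed

lemma leaf_orbit:
  assumes "S \<in> inner_auts"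
  shows "leaf S \<subseteq> orbit"
  using orbit_inner[OF assms] X_nn_orbit[OF X_hh X_injective_nn] X_orbit by (auto simp: leaf_def)

lemma aut_onto_nn:
  assumes "aut S" "\<And>v. v \<in> nn \<Longrightarrow> S v \<in> nn"
  shows "S ` nn = nn"
proof (rule linear_inj_on_subspace_surj[OF aut_linear[OF assms(1)] subspace_nn assms(2)])
  fix w assume "S w = 0"
  then show "w = 0" using aut_inv(3)[OF assms(1), of w] linear_0[OF aut_linear[OF aut_inv(1)[OF assms(1)]]] by simp
qed

lemma stabilizer_nn:
  assumes "S \<in> inner_auts" "S X = X" "v \<in> nn"
  shows "S v \<in> nn"
  by (rule aut_nn[OF inner_aut[OF assms(1)] inner_stabilizer_fixes_hh[OF assms(1,2)] assms(3)])

lemma leaf_compose: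
  assumes S: "S \<in> inner_auts" and R: "R \<in> inner_auts" "\<And>v. v \<in> nn \<Longrightarrow> R v \<in> nn" "R X - X \<in> nn"
  shows "leaf (\<lambda>x. S (R x)) = leaf S"
proof -
  have Rnn: "R ` nn = nn" by (rule aut_onto_nn[OF inner_aut[OF R(1)] R(2)])
  have "(\<lambda>v. R (X + v)) ` nn = (\<lambda>v. X + v) ` nn"
  proof (intro Set.set_eqI iffI)
    fix z assume "z \<in> (\<lambda>v. R (X + v)) ` nn"
    then obtain v where v: "v \<in> nn" "z = R (X + v)" by blast
    have "(R X - X) + R v \<in> nn" using R v(1) by (intro subspace_add[OF subspace_nn]) auto
    moreover have "z = X + ((R X - X) + R v)" using v(2) linear_add[OF inner_linear[OF R(1)]] by simp
    ultimately show "z \<in> (\<lambda>v. X + v) ` nn" by blast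
  next
    fix z assume "z \<in> (\<lambda>v. X + v) ` nn"
    then obtain v where v: "v \<in> nn" "z = X + v" by blast
    have "v - (R X - X) \<in> R ` nn" unfolding Rnn by (rule subspace_diff[OF subspace_nn v(1) R(3)])
    then obtain w where w: "w \<in> nn" "v - (R X - X) = R w" by blast
    have "z = R (X + w)"
      using v(2) w(2) linear_add[OF inner_linear[OF R(1)], of X w] by (simp add: algebra_simps flip: w(2))
    then show "z \<in> (\<lambda>v. R (X + v)) ` nn" using w(1) by blast
  qed
  then have "S ` ((\<lambda>v. R (X + v)) ` nn) = S ` ((\<lambda>v. X + v) ` nn)" by simp
  then show ?thesis unfolding leaf_def image_image .
qed

text \<open>Transitivity on \<open>X + nn\<close> replaces \<open>S\<close> and \<open>S'\<close> by
  \<open>K\<close> and \<open>K'\<close>, which send \<open>X\<close> to the common point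
  \<open>z\<close> without changing the leaves. The quotient \<open>Z\<close> fixes \<open>X\<close>
  and hence preserves \<open>nn\<close>.\<close>

lemma leaf_eq:
  assumes S: "S \<in> inner_auts" "S' \<in> inner_auts" and z: "z \<in> leaf S" "z \<in> leaf S'"
  shows "leaf S = leaf S'" "S ` nn = S' ` nn"
proof -
  obtain v where v: "v \<in> nn" "z = S (X + v)" using z(1) by (auto simp: leaf_def)
  obtain v' where v': "v' \<in> nn" "z = S' (X + v')" using z(2) by (auto simp: leaf_def)
  obtain R where R: "R \<in> inner_auts" "\<And>v. v \<in> nn \<Longrightarrow> R v \<in> nn" "R X = X + v"
    using nn_transitive[OF X_hh X_injective_nn v(1)] by metis
  obtain R' where R': "R' \<in> inner_auts" "\<And>v. v \<in> nn \<Longrightarrow> R' v \<in> nn" "R' X = X + v'"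
    using nn_transitive[OF X_hh X_injective_nn v'(1)] by metis
  define K where "K x = S (R x)" for x
  define K' where "K' x = S' (R' x)" for x
  have K: "K \<in> inner_auts" "K' \<in> inner_auts"
    unfolding K_def K'_def using inner_compose S R(1) R'(1) by blast+
  note aK' = aut_inv[OF inner_aut[OF K(2)]]
  have KX: "K X = z" "K' X = z"
    using v(2) v'(2) by (simp_all only: K_def K'_def R(3) R'(3))
  define Z where "Z x = finv K' (K x)" for x
  have Z: "Z \<in> inner_auts" unfolding Z_def using inner_compose inner_inv K by blast
  have ZX: "Z X = X" using KX aK'(3)[of X] by (simp add: Z_def)
  have Znn: "Z v \<in> nn" if "v \<in> nn" for v using stabilizer_nn[OF Z ZX that] .
  have KZ: "K = (\<lambda>x. K' (Z x))" by (simp add: Z_def aK'(2) fun_eq_iff)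
  have "leaf K = leaf S"
    unfolding K_def using R v(1) by (intro leaf_compose S) auto
  moreover have "leaf K' = leaf S'"
    unfolding K'_def using R' v'(1) by (intro leaf_compose S) auto
  moreover have "leaf K = leaf K'"
    unfolding KZ using Znn ZX subspace_0[OF subspace_nn] by (intro leaf_compose K Z) auto
  ultimately show "leaf S = leaf S'" by simp
  have "K ` nn = S ` nn"
    using aut_onto_nn[OF inner_aut[OF R(1)] R(2)] unfolding K_def by (simp add: image_image[symmetric, of S R])
  moreover have "K' ` nn = S' ` nn"
    using aut_onto_nn[OF inner_aut[OF R'(1)] R'(2)] unfolding K'_def by (simp add: image_image[symmetric, of S' R'])
  moreover have "K ` nn = K' ` nn"
    using aut_onto_nn[OF inner_aut[OF Z] Znn] unfolding KZ by (simp add: image_image[symmetric, of K' Z])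
  ultimately show "S ` nn = S' ` nn" by simp
qed

lemma self_leaf: "S X \<in> leaf S"
  unfolding leaf_def using subspace_0[OF subspace_nn] by force

lemma leaf_diff:
  assumes S: "S \<in> inner_auts"
  shows "z \<in> leaf S \<longleftrightarrow> z - S X \<in> S ` nn"
proof
  assume "z \<in> leaf S"
  then show "z - S X \<in> S ` nn" using linear_add[OF inner_linear[OF S]] by (auto simp: leaf_def)
next
  assume "z - S X \<in> S ` nn"
  then obtain v where v: "v \<in> nn" "z - S X = S v" by blast
  then have "z = S (X + v)" using linear_add[OF inner_linear[OF S], of X v] by (simp add: algebra_simps)
  then show "z \<in> leaf S" using v(1) by (auto simp: leaf_def)
qed

lemma partition_leaves: "partition_on orbit leaves"
  unfolding partition_on_def
proof (intro conjI)
  show "\<Union> leaves = orbit"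
    using leaf_orbit self_leaf by (auto simp: leaves_def orbit_def)
  show "disjoint leaves"
    unfolding pairwise_def disjnt_def using leaf_eq(1) by (auto simp: leaves_def)
  show "{} \<notin> leaves"
    using self_leaf by (auto simp: leaves_def)
qed

lemma path_connected_leaf:
  assumes "L \<in> leaves"
  shows "path_connected L"
proof -
  obtain S where S: "S \<in> inner_auts" "L = leaf S" using assms by (auto simp: leaves_def)
  have "convex ((\<lambda>v. X + v) ` nn)"
    by (rule convex_translation[OF subspace_imp_convex[OF subspace_nn]])
  then have "convex (S ` ((\<lambda>v. X + v) ` nn))" by (rule convex_linear_image[OF inner_linear[OF S(1)]])
  then show ?thesis unfolding S(2) leaf_def image_image by (rule convex_imp_path_connected)
qed

lemma leaf_tangent_leaves:
  assumes S: "S \<in> inner_auts"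
  shows "leaf_tangent leaves (S X) = S ` nn"
proof (intro Set.set_eqI iffI)
  have W: "subspace (S ` nn)" by (rule linear_subspace_image[OF inner_linear[OF S] subspace_nn])
  fix v
  {
    assume "v \<in> leaf_tangent leaves (S X)"
    then obtain L e \<gamma> where g: "L \<in> leaves" "e > 0" "\<gamma> ` {-e<..<e} \<subseteq> L" "\<gamma> 0 = S X"
      "(\<gamma> has_vector_derivative v) (at (0::real))"
      unfolding leaf_tangent_def by blast
    obtain R where R: "R \<in> inner_auts" "L = leaf R" using g(1) by (auto simp: leaves_def)
    have "S X \<in> leaf R" using g(2,3,4) R(2) by force
    then have L: "L = leaf S" using leaf_eq(1)[OF R(1) S] self_leaf R(2) by blast
    have "\<gamma> t - \<gamma> 0 \<in> S ` nn" if "\<bar>t\<bar> < e" for t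
    proof -
      have "t \<in> {-e<..<e}" using that by auto
      then have "\<gamma> t \<in> leaf S" using g(3) L by blast
      then show ?thesis by (simp add: leaf_diff[OF S] g(4))
    qed
    then show "v \<in> S ` nn" by (rule vector_derivative_in_subspace[OF W g(2) _ g(5)])
  next
    assume v: "v \<in> S ` nn"
    define \<gamma> where "\<gamma> t = S X + t *\<^sub>R v" for t :: real
    have lin: "linear (\<lambda>t::real. t *\<^sub>R v)" by (simp add: linear_iff scaleR_add_left)
    have "smooth_on {-1<..<1} \<gamma>"
      unfolding \<gamma>_def by (intro smooth_on_add smooth_on_const smooth_on_linear lin)
    moreover have "\<gamma> ` {-1<..<1} \<subseteq> leaf S"
      using subspace_scale[OF W v] by (auto simp: \<gamma>_def leaf_diff[OF S])
    moreover have "(\<gamma> has_vector_derivative v) (at 0)"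
      unfolding \<gamma>_def by (auto intro!: derivative_eq_intros)
    moreover have "leaf S \<in> leaves" "\<gamma> 0 = S X" using S by (auto simp: leaves_def \<gamma>_def)
    ultimately show "v \<in> leaf_tangent leaves (S X)"
      unfolding leaf_tangent_def
      by (intro CollectI bexI[of _ "leaf S"] exI[of _ 1] exI[of _ \<gamma>]) auto
  }
qed

text \<open>\<open>kirillov_form\<close> is a definite description, so the value 0 has to be
  established for all lifts of the two tangent vectors. Carried back to \<open>X\<close>, a lift is
  determined up to \<open>hh\<close>, and \<open>br\<close> maps two elements of
  \<open>hh + nn\<close> into \<open>nn\<close>, on which \<open>B X\<close> vanishes.\<close>

lemma isotropic_leaves: "isotropic_foliation br orbit leaves"
  unfolding isotropic_foliation_def
proof (intro ballI)
  fix y \<xi> \<eta> assume y: "y \<in> orbit" and t: "\<xi> \<in> leaf_tangent leaves y" "\<eta> \<in> leaf_tangent leaves y"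
  obtain S where S: "S \<in> inner_auts" "y = S X" using y by (auto simp: orbit_def)
  note aS = inner_aut[OF S(1)]
  have \<xi>\<eta>: "\<xi> \<in> S ` nn" "\<eta> \<in> S ` nn"
    using t unfolding S(2) leaf_tangent_leaves[OF S(1)] by -
  obtain u where u: "\<xi> = S u" "u \<in> nn" using \<xi>\<eta>(1) by (rule imageE)
  obtain w where w: "\<eta> = S w" "w \<in> nn" using \<xi>\<eta>(2) by (rule imageE)
  have lift: "\<exists>a\<in>nn. v = br a X" if v: "v \<in> nn" for v
  proof -
    have "v \<in> br X ` nn" using v by (simp only: br_X_nn)
    then obtain a where a: "v = br X a" "a \<in> nn" by (rule imageE)
    have "v = br (- a) X" unfolding a(1) br_lneg by (rule br_anticommute)
    then show ?thesis using subspace_neg[OF subspace_nn a(2)] by blast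
  qed
  obtain a where a: "a \<in> nn" "u = br a X" using lift[OF u(2)] by blast
  obtain b where b: "b \<in> nn" "w = br b X" using lift[OF w(2)] by blast
  have split: "\<exists>h\<in>hh. finv S U = h + a" if "S (br a X) = br U y" for U a
  proof -
    have "S (br (finv S U) X) = S (br a X)"
      using that by (simp add: aut_br[OF aS] aut_inv[OF aS] S(2))
    then have "br (finv S U) X = br a X" using aut_inj[OF aS] by (simp add: inj_eq)
    then have "br (finv S U - a) X = 0" by (simp add: br_lsub)
    then have "br X (finv S U - a) = 0" by (subst br_anticommute) simp
    then show ?thesis using hh_iff by (intro bexI[of _ "finv S U - a"]) simp_all
  qed
  have zero: "B y (br U' V') = 0" if UV: "\<xi> = br U' y" "\<eta> = br V' y" for U' V'
  proof -
    have "S (br a X) = br U' y" using UV(1) u(1) a(2) by simp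
    from split[OF this] obtain h where h: "h \<in> hh" "finv S U' = h + a" by blast
    have "S (br b X) = br V' y" using UV(2) w(1) b(2) by simp
    from split[OF this] obtain k where k: "k \<in> hh" "finv S V' = k + b" by blast
    have "br (h + a) (k + b) = br h b - br k a + br a b"
      using hh_commute[OF h(1) k(1)] br_anticommute[of a k] by (simp add: br_ladd br_radd)
    moreover have "br h b - br k a + br a b \<in> nn"
      by (intro subspace_add subspace_diff subspace_nn br_hh_nn br_nn_nn h k a b)
    ultimately have "B X (br (finv S U') (finv S V')) = 0" using B_X_nn h(2) k(2) by simp
    then have "B (S X) (S (br (finv S U') (finv S V'))) = 0" by (simp add: B_aut[OF aS])
    then show ?thesis by (simp add: aut_br[OF aS] aut_inv[OF aS] S(2))
  qed
  have "\<xi> = br (S a) y" "\<eta> = br (S b) y"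
    by (simp_all add: u(1) w(1) a(2) b(2) aut_br[OF aS] S(2))
  then show "kirillov_form br y \<xi> \<eta> = 0"
    unfolding kirillov_form_def using zero[of "S a" "S b"] zero
    by (intro the_equality exI[of _ "S a"] exI[of _ "S b"]) auto
qed

section \<open>Plaques and foliated charts\<close>

definition "plaque S e = (\<lambda>v. S (X + v)) ` (nn \<inter> ball 0 e)"

lemma plaque_subset_leaf: "plaque S e \<subseteq> leaf S"
  by (auto simp: plaque_def leaf_def)

lemma openin_plaque:
  assumes S: "S \<in> inner_auts"
  shows "openin (top_of_set (leaf S)) (plaque S e)"
proof -
  note a = inner_aut[OF S]
  have li: "bounded_linear (finv S)"
    using aut_linear[OF aut_inv(1)[OF a]] by (simp add: linear_conv_bounded_linear)
  let ?O = "{z. norm (finv S z - X) < e}"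
  have "open ?O"
    by (intro open_Collect_less continuous_intros bounded_linear.continuous_on[OF li])
  moreover have "plaque S e = leaf S \<inter> ?O"
  proof (intro Set.set_eqI iffI)
    fix z assume "z \<in> plaque S e"
    then obtain v where "v \<in> nn" "norm v < e" "z = S (X + v)" by (auto simp: plaque_def)
    then show "z \<in> leaf S \<inter> ?O" by (auto simp: leaf_def aut_inv(3)[OF a])
  next
    fix z assume z: "z \<in> leaf S \<inter> ?O"
    then obtain v where v: "v \<in> nn" "z = S (X + v)" by (auto simp: leaf_def)
    then have "norm v < e" using z by (simp add: aut_inv(3)[OF a])
    then show "z \<in> plaque S e" using v by (auto simp: plaque_def)
  qed
  ultimately show ?thesis by (auto simp: openin_open)
qed

lemma path_connected_plaque:
  assumes "S \<in> inner_auts"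
  shows "path_connected (plaque S e)"
proof -
  have "convex (nn \<inter> ball 0 e)"
    by (intro convex_Int subspace_imp_convex subspace_nn convex_ball)
  then have "convex ((\<lambda>v. X + v) ` (nn \<inter> ball 0 e))" by (rule convex_translation)
  then have "convex (S ` ((\<lambda>v. X + v) ` (nn \<inter> ball 0 e)))"
    by (rule convex_linear_image[OF inner_linear[OF assms]])
  then show ?thesis unfolding plaque_def image_image by (rule convex_imp_path_connected)
qed

text \<open>The plaques contained in a leaf are disjoint and open in it.\<close>

lemma path_component_plaque:
  assumes S: "\<And>b. b \<in> J \<Longrightarrow> S b \<in> inner_auts"
    and disj: "\<And>b b'. b \<in> J \<Longrightarrow> b' \<in> J \<Longrightarrow> b \<noteq> b' \<Longrightarrow> plaque (S b) e \<inter> plaque (S b') e = {}"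
    and L: "L \<in> leaves" and b: "b \<in> J" "y \<in> plaque (S b) e" "y \<in> L"
  shows "path_component_set (L \<inter> (\<Union>b\<in>J. plaque (S b) e)) y = plaque (S b) e"
    (is "path_component_set ?M y = _")
proof
  have in_L: "plaque (S b') e \<subseteq> L \<and> L = leaf (S b')" if b': "b' \<in> J" "z \<in> plaque (S b') e" "z \<in> L" for b' z
  proof -
    obtain K where K: "K \<in> inner_auts" "L = leaf K" using L by (auto simp: leaves_def)
    have "z \<in> leaf (S b')" using b'(2) plaque_subset_leaf by (rule subsetD[rotated])
    moreover have "z \<in> leaf K" using b'(3) K(2) by simp
    ultimately have "leaf (S b') = leaf K" by (rule leaf_eq(1)[OF S[OF b'(1)] K(1)])
    then show ?thesis using K(2) plaque_subset_leaf[of "S b'" e] by simp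
  qed
  show "plaque (S b) e \<subseteq> path_component_set ?M y"
    by (rule path_component_maximal[OF b(2) path_connected_plaque[OF S[OF b(1)]]])
      (use in_L[OF b] b(1) in blast)
  define C where "C = path_component_set ?M y"
  have CM: "C \<subseteq> ?M" unfolding C_def by (rule path_component_subset)
  have conn: "connected C" unfolding C_def by (intro path_connected_imp_connected path_connected_path_component)
  have yC: "y \<in> C" unfolding C_def using b by (auto simp: path_component_refl_eq)
  \<comment> \<open>Plaques that meet \<open>L\<close> lie in \<open>L\<close> and are open there;
    the others are disjoint from \<open>C\<close>.\<close>
  define J' where "J' = {b' \<in> J. plaque (S b') e \<inter> L \<noteq> {}}"
  have op: "openin (top_of_set L) (plaque (S b') e)" if b': "b' \<in> J'" for b'
  proof -
    obtain z where "b' \<in> J" "z \<in> plaque (S b') e" "z \<in> L" using b' by (auto simp: J'_def)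
    then have "L = leaf (S b')" "S b' \<in> inner_auts" using in_L S by blast+
    then show ?thesis using openin_plaque by simp
  qed
  have bJ: "b \<in> J'" using b by (auto simp: J'_def)
  let ?A = "C \<inter> plaque (S b) e" and ?B = "C \<inter> (\<Union>b'\<in>J' - {b}. plaque (S b') e)"
  have op_C: "openin (top_of_set C) (C \<inter> T)" if T: "openin (top_of_set L) T" for T
  proof -
    obtain O' where O': "open O'" "T = L \<inter> O'" using T by (auto simp: openin_open)
    have "C \<inter> T = C \<inter> O'" using O'(2) CM by blast
    then show ?thesis using O'(1) by (simp add: openin_open_Int)
  qed
  have A: "openin (top_of_set C) ?A" by (rule op_C[OF op[OF bJ]])
  have B: "openin (top_of_set C) ?B" by (intro op_C openin_Union) (use op in auto)
  have cover: "C \<subseteq> ?A \<union> ?B"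
  proof
    fix z assume z: "z \<in> C"
    then obtain b' where "b' \<in> J" "z \<in> plaque (S b') e" "z \<in> L" using CM by auto
    then show "z \<in> ?A \<union> ?B" using z by (cases "b' = b") (auto simp: J'_def)
  qed
  have AB: "?A \<inter> ?B = {}" using disj[OF b(1)] by (auto simp: J'_def disjoint_iff)
  have "?A \<noteq> {}" using yC b(2) by blast
  then have "?B = {}" using conn A B cover AB unfolding connected_openin by meson
  then show "path_component_set ?M y \<subseteq> plaque (S b) e"
    using cover unfolding C_def by blast
qed

text \<open>\<open>nn\<close> gives the directions along the leaf, \<open>F\<close> supplies the
  parameters for moving across the leaves within the orbit, and \<open>hh\<close> the directions
  leaving the orbit.\<close>

lemma three_projections:
  obtains F pn pf ph where "subspace F" "linear pn" "linear pf" "linear ph"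
    "\<And>x. pn x \<in> nn" "\<And>x. pf x \<in> F" "\<And>x. ph x \<in> hh" "\<And>x. x = pn x + pf x + ph x"
    "\<And>x. x \<in> nn \<Longrightarrow> pn x = x \<and> pf x = 0 \<and> ph x = 0"
    "\<And>x. x \<in> F \<Longrightarrow> pn x = 0 \<and> pf x = x \<and> ph x = 0"
    "F \<subseteq> mm"
proof -
  define F where "F = {y \<in> mm. \<forall>x\<in>nn. orthogonal x y}"
  have F: "subspace F"
    using subspace_inter[OF subspace_mm subspace_orthogonal_to_vectors[of nn]]
    by (simp add: F_def Int_def)
  obtain ph where ph: "linear ph" "\<And>v. ph v \<in> hh" "\<And>v. v - ph v \<in> mm"
    "\<And>v. v \<in> hh \<Longrightarrow> ph v = v" "\<And>v. v \<in> mm \<Longrightarrow> ph v = 0"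
    using hh_projection by metis
  let ?O = "{y. \<forall>x\<in>nn. orthogonal x y}"
  have O: "subspace ?O" by (rule subspace_orthogonal_to_vectors)
  have int: "nn \<inter> ?O = {0}"
    using subspace_0[OF subspace_nn] subspace_0[OF O] by (auto simp: orthogonal_def)
  have dec: "\<exists>a\<in>nn. \<exists>b\<in>?O. v = a + b" for v
  proof -
    obtain y z where yz: "y \<in> span nn" "\<And>w. w \<in> span nn \<Longrightarrow> orthogonal z w" "v = y + z"
      using orthogonal_subspace_decomp_exists[of nn v] by blast
    have "y \<in> nn" using yz(1) subspace_nn by (simp add: span_eq_iff[THEN iffD2])
    moreover have "z \<in> ?O" using yz(2) span_base by (auto simp: orthogonal_commute)
    ultimately show ?thesis using yz(3) by blast
  qed
  obtain q where q: "linear q" "\<And>v. q v \<in> nn" "\<And>v. v - q v \<in> ?O" "\<And>v. v \<in> nn \<Longrightarrow> q v = v"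
    "\<And>v. v \<in> ?O \<Longrightarrow> q v = 0"
    by (rule complementary_projection[OF subspace_nn O int dec]) (rule that)
  define m where "m x = x - ph x" for x
  have lm: "linear m" unfolding m_def by (intro linear_compose_sub linear_ident ph(1))
  have lqm: "linear (\<lambda>x. q (m x))" using linear_compose[OF lm q(1)] by (simp add: o_def)
  have mm: "m x \<in> mm" for x using ph(3) by (simp add: m_def)
  have m_id: "m x = x" if "x \<in> mm" for x using ph(5)[OF that] by (simp add: m_def)
  have Fm: "F \<subseteq> mm" "F \<subseteq> ?O" by (auto simp: F_def)
  show ?thesis
  proof (rule that[of F "\<lambda>x. q (m x)" "\<lambda>x. m x - q (m x)" ph])
    show "linear (\<lambda>x. m x - q (m x))" using lm lqm by (rule linear_compose_sub)
    show "m x - q (m x) \<in> F" for x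
      using q(3)[of "m x"] subspace_diff[OF subspace_mm mm nn_mm[OF q(2)]] by (simp add: F_def)
    show "x = q (m x) + (m x - q (m x)) + ph x" for x by (simp add: m_def)
    show "q (m x) = x \<and> m x - q (m x) = 0 \<and> ph x = 0" if "x \<in> nn" for x
      using q(4)[OF that] m_id[OF nn_mm[OF that]] ph(5)[OF nn_mm[OF that]] by simp
    show "q (m x) = 0 \<and> m x - q (m x) = x \<and> ph x = 0" if "x \<in> F" for x
    proof -
      have x: "x \<in> mm" "x \<in> ?O" using that Fm by blast+
      then show ?thesis using q(5)[OF x(2)] m_id[OF x(1)] ph(5)[OF x(1)] by simp
    qed
  qed (use F lqm ph q Fm in auto)
qed

text \<open>\<open>br X\<close> is bounded below on \<open>nn\<close> by \<open>e\<close>, and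
  \<open>br c\<close> is bounded by \<open>K * norm c\<close>; for \<open>norm c < e / K\<close> the
  former wins.\<close>

lemma nearby_injective_nn:
  obtains \<epsilon> where "\<epsilon> > 0" "\<And>c v. norm c < \<epsilon> \<Longrightarrow> v \<in> nn \<Longrightarrow> br (X + c) v = 0 \<Longrightarrow> v = 0"
proof -
  have "\<forall>x\<in>nn. br X x = 0 \<longrightarrow> x = 0" using X_injective_nn by blast
  then obtain e where e: "e > 0" "\<And>v. v \<in> nn \<Longrightarrow> norm (br X v) \<ge> e * norm v"
    using injective_imp_isometric[OF closed_subspace[OF subspace_nn] subspace_nn]
      linear_br linear_conv_bounded_linear by blast
  obtain K where K: "K > 0" "\<And>x y. norm (br x y) \<le> norm x * norm y * K"
    using bounded_bilinear.pos_bounded[OF bbil] by blast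
  show ?thesis
  proof (rule that[of "e / K"])
    fix c v assume c: "norm c < e / K" and v: "v \<in> nn" "br (X + c) v = 0"
    show "v = 0"
    proof (rule ccontr)
      assume "v \<noteq> 0"
      have "br X v = - br c v" using v(2) by (simp add: br_ladd eq_neg_iff_add_eq_0)
      then have "e * norm v \<le> norm c * norm v * K" using e(2)[OF v(1)] K(2)[of c v] by simp
      then have "e \<le> norm c * K" using \<open>v \<noteq> 0\<close> by (simp add: mult_ac)
      then show False using c K(1) by (simp add: pos_less_divide_eq)
    qed
  qed (use e K in simp)
qed

text \<open>The chart is cut out of a local diffeomorphism \<open>\<Phi>\<close> of the whole Lie
  algebra: the orbit is where the \<open>hh\<close> component vanishes, and a plaque is where the
  \<open>F\<close> component is constant. Of the family \<open>\<psi>\<close> only its smoothness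
  near 0 and its first order behaviour there enter, besides its values being inner.\<close>

lemma foliated_chart_exists:
  fixes \<psi> :: "real^'n \<Rightarrow> real^'n \<Rightarrow> real^'n"
  assumes \<psi>: "\<And>b. \<psi> b \<in> inner_auts" "\<And>v. \<psi> 0 v = v"
    and \<rho>: "\<rho> > 0" "\<And>v. smooth_on (ball 0 \<rho>) (\<lambda>b. \<psi> b v)"
    and d\<psi>: "\<And>v. ((\<lambda>b. \<psi> b v) has_derivative (\<lambda>b. br b v)) (at 0)"
    and R: "R \<in> inner_auts"
  obtains F \<phi> where "foliated_chart orbit leaves nn F \<phi>"
    "R X \<in> \<phi> ` ((nn \<inter> ball 0 1) \<times> (F \<inter> ball 0 1))"
proof -
  obtain F pn pf ph where sF: "subspace F" and lp: "linear pn" "linear pf" "linear ph"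
    and pin: "\<And>x. pn x \<in> nn" "\<And>x. pf x \<in> F" "\<And>x. ph x \<in> hh"
    and psum: "\<And>x. x = pn x + pf x + ph x"
    and pnn: "\<And>x. x \<in> nn \<Longrightarrow> pn x = x \<and> pf x = 0 \<and> ph x = 0"
    and pF: "\<And>x. x \<in> F \<Longrightarrow> pn x = 0 \<and> pf x = x \<and> ph x = 0"
    and Fmm: "F \<subseteq> mm"
    by (rule three_projections) (rule that)
  have bp: "bounded_linear pn" "bounded_linear pf" "bounded_linear ph"
    using lp by (simp_all add: linear_conv_bounded_linear)
  have aR: "aut R" and lR: "linear R" using R inner_aut inner_linear by blast+
  have l\<psi>: "linear (\<psi> b)" for b using \<psi>(1) inner_linear by blast
  have lR\<psi>: "linear (\<lambda>v. R (\<psi> b v))" for b using linear_compose[OF l\<psi> lR] by (simp add: o_def)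
  have bR: "bounded_linear R" using lR by (simp add: linear_conv_bounded_linear)
  define O0 where "O0 = {x. pf x \<in> ball 0 \<rho>}"
  have "O0 = {x. norm (pf x) < \<rho>}" by (auto simp: O0_def)
  then have oO0: "open O0"
    by (simp only:) (intro open_Collect_less continuous_intros bounded_linear.continuous_on[OF bp(2)])
  have zO0: "0 \<in> O0" using \<rho>(1) by (simp add: O0_def linear_0[OF lp(2)])
  define q where "q x = x - pf x" for x
  have lq: "linear q" unfolding q_def by (intro linear_compose_sub linear_ident lp)
  define \<Phi> where "\<Phi> x = R (\<psi> (pf x) (X + q x))" for x
  have smooth\<Phi>: "smooth_on O0 \<Phi>"
  proof -
    have 1: "smooth_on O0 (\<lambda>x. (X + q x) \<bullet> b)" for b :: "real^'n"
    proof (rule smooth_on_compose_linear[where L = "\<lambda>w. w \<bullet> b" and f = "\<lambda>x. X + q x"])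
      show "linear (\<lambda>w. w \<bullet> b)" by (simp add: linear_iff inner_add_left)
      show "smooth_on O0 (\<lambda>x. X + q x)"
        by (intro smooth_on_add smooth_on_const smooth_on_linear lq)
    qed
    have 2: "smooth_on O0 (\<lambda>x. R (\<psi> (pf x) b))" for b
    proof (rule smooth_on_compose_linear[OF lR])
      show "smooth_on O0 (\<lambda>x. \<psi> (pf x) b)"
        by (rule smooth_on_compose[OF oO0 smooth_on_linear[OF lp(2)] \<rho>(2)]) (auto simp: O0_def)
    qed
    have 3: "smooth_on O0 (\<lambda>x. \<Sum>b\<in>Basis. ((X + q x) \<bullet> b) *\<^sub>R R (\<psi> (pf x) b))"
      by (rule smooth_on_sum, rule smooth_on_scaleR[OF 1 2])
    show ?thesis
    proof (rule smooth_on_cong[OF oO0 _ 3])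
      fix x
      have "R (\<psi> (pf x) (\<Sum>b\<in>Basis. ((X + q x) \<bullet> b) *\<^sub>R b)) =
          (\<Sum>b\<in>Basis. ((X + q x) \<bullet> b) *\<^sub>R R (\<psi> (pf x) b))"
        by (simp only: linear_sum[OF lR\<psi>[of "pf x"]] linear_scale[OF lR\<psi>[of "pf x"]])
      then show "(\<Sum>b\<in>Basis. ((X + q x) \<bullet> b) *\<^sub>R R (\<psi> (pf x) b)) = \<Phi> x"
        by (simp only: euclidean_representation \<Phi>_def)
    qed
  qed
  let ?D = "\<lambda>x. frechet_derivative \<Phi> (at x)"
  have d\<Phi>: "(\<Phi> has_derivative ?D x) (at x)" if "x \<in> O0" for x
    by (rule smooth_on_has_derivative[OF smooth\<Phi> that])
  have D0: "?D 0 = (\<lambda>h. R (br (pf h) X + q h))"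
  proof -
    have dp: "((\<lambda>x. pf x) has_derivative pf) (at 0)" by (rule bounded_linear_imp_has_derivative[OF bp(2)])
    have "((\<lambda>x. \<psi> (pf x) v) has_derivative (\<lambda>h. br (pf h) v)) (at 0)" for v
      using has_derivative_compose[OF dp, of "\<lambda>b. \<psi> b v" "\<lambda>b. br b v"] d\<psi>[of v]
      by (simp add: linear_0[OF lp(2)])
    then have 1: "((\<lambda>x. R (\<psi> (pf x) v)) has_derivative (\<lambda>h. R (br (pf h) v))) (at 0)" for v
      by (rule bounded_linear.has_derivative[OF bR])
    have 2: "linear (\<lambda>v. R (br (pf h) v))" for h using linear_compose[OF linear_br lR] by (simp add: o_def)
    have 3: "((\<lambda>x. X + q x) has_derivative q) (at 0)"
      using has_derivative_add[OF has_derivative_const bounded_linear_imp_has_derivative[of q]]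
        lq by (simp add: linear_conv_bounded_linear)
    have "(\<Phi> has_derivative (\<lambda>h. R (\<psi> (pf 0) (q h)) + R (br (pf h) (X + q 0)))) (at 0)"
      unfolding \<Phi>_def by (rule has_derivative_apply[OF 1 lR\<psi> 2 3])
    then have "(\<Phi> has_derivative (\<lambda>h. R (br (pf h) X + q h))) (at 0)"
      by (simp add: linear_0[OF lp(2)] linear_0[OF lq] \<psi>(2) linear_add[OF lR] add.commute)
    then show ?thesis by (rule frechet_derivative_at[symmetric])
  qed
  have lD: "linear (?D x)" if "x \<in> O0" for x using d\<Phi>[OF that] has_derivative_linear by blast
  \<comment> \<open>\<open>br X\<close> has range \<open>mm\<close>, so the \<open>hh\<close>
    component vanishes. Since \<open>br X\<close> is onto on \<open>nn\<close> and injective on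
    \<open>mm\<close>, \<open>pf h\<close> agrees with an element of \<open>nn\<close>, and
    \<open>nn\<close> and \<open>F\<close> meet only in 0.\<close>
  have "inj (?D 0)"
    unfolding linear_injective_0[OF lD[OF zO0]]
  proof (intro allI impI)
    fix h assume "?D 0 h = 0"
    then have "R (br (pf h) X + q h) = R 0" by (simp add: D0 linear_0[OF lR])
    then have "br (pf h) X + q h = 0" using aut_inj[OF aR] by (simp add: inj_eq)
    moreover have "q h = pn h + ph h" using psum[of h] by (simp add: q_def algebra_simps)
    ultimately have e: "br X (pf h) = pn h + ph h"
      using br_anticommute[of X "pf h"] by (simp add: neg_eq_iff_add_eq_0)
    have eh: "ph h = br X (pf h) - pn h" using e by simp
    have "ph h \<in> mm"
      unfolding eh by (rule subspace_diff[OF subspace_mm _ nn_mm[OF pin(1)]]) (simp add: mm_def)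
    then have ph0: "ph h = 0" by (rule hh_mm[OF pin(3)])
    have "pn h \<in> br X ` nn" using pin(1) by (simp only: br_X_nn)
    then obtain w where w: "pn h = br X w" "w \<in> nn" by (rule imageE)
    have "br X (pf h - w) = 0" using e w(1) ph0 by (simp add: br_rsub)
    then have "pf h - w \<in> hh" by (simp add: hh_iff)
    moreover have "pf h - w \<in> mm"
      using Fmm pin(2)[of h] nn_mm[OF w(2)] by (intro subspace_diff[OF subspace_mm]) auto
    ultimately have "pf h - w = 0" by (rule hh_mm)
    then have pw: "pf h = w" by simp
    then have "pf h = 0" using pF[OF pin(2), of h] pnn[OF w(2)] by simp
    then have "pn h = 0" using e ph0 by (simp add: br_rzero)
    then show "h = 0" using psum[of h] \<open>pf h = 0\<close> ph0 by simp
  qed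
  then obtain gi where gi: "linear gi" "gi \<circ> ?D 0 = id"
    using linear_injective_left_inverse[OF lD[OF zO0]] by blast
  define f' where "f' x = Blinfun (?D x)" for x
  have f': "blinfun_apply (f' x) = ?D x" if "x \<in> O0" for x
    unfolding f'_def using lD[OF that] by (simp add: bounded_linear_Blinfun_apply linear_conv_bounded_linear)
  have contf': "continuous_on O0 f'"
  proof (rule continuous_on_blinfun_componentwise)
    fix i :: "real^'n"
    have "continuous_on O0 (\<lambda>x. ?D x i)"
      by (rule smooth_on_imp_continuous_on[OF smooth_on_derivative[OF smooth\<Phi> oO0]])
    then show "continuous_on O0 (\<lambda>x. blinfun_apply (f' x) i)"
      by (rule continuous_on_eq) (simp add: f')
  qed
  have inv0: "Blinfun gi o\<^sub>L f' 0 = id_blinfun"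
  proof (rule blinfun_eqI)
    fix v
    have "gi (?D 0 v) = v" using fun_cong[OF gi(2), of v] by (simp only: o_apply id_apply)
    then show "blinfun_apply (Blinfun gi o\<^sub>L f' 0) v = blinfun_apply id_blinfun v"
      using gi(1) by (simp add: f'[OF zO0] bounded_linear_Blinfun_apply linear_conv_bounded_linear)
  qed
  obtain U' V g where U': "open U'" "U' \<subseteq> O0" "0 \<in> U'" "open V" "homeomorphism U' V \<Phi> g"
    and bij: "\<And>y. y \<in> V \<Longrightarrow> bij (blinfun_apply (f' (g y)))"
  proof -
    have d: "(\<Phi> has_derivative blinfun_apply (f' x)) (at x)" if "x \<in> O0" for x
      using d\<Phi>[OF that] by (simp add: f'[OF that])
    show ?thesis
      by (rule inverse_function_theorem[OF oO0 d contf' zO0 inv0], assumption) (rule that)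
  qed
  have g\<Phi>: "g (\<Phi> x) = x" "\<Phi> x \<in> V" if "x \<in> U'" for x
    using U'(5) that by (auto simp: homeomorphism_def)
  obtain r where r: "r > 0" "ball 0 r \<subseteq> U'" using U'(1,3) openE by blast
  obtain \<epsilon>1 where \<epsilon>1: "\<epsilon>1 > 0" "\<And>S. aut S \<Longrightarrow> S X \<in> hh \<Longrightarrow> norm (S X - X) < \<epsilon>1 \<Longrightarrow> S X = X"
    by (rule orbit_meets_hh_discretely) (rule that)
  obtain \<epsilon>2 where \<epsilon>2: "\<epsilon>2 > 0" "\<And>c v. norm c < \<epsilon>2 \<Longrightarrow> v \<in> nn \<Longrightarrow> br (X + c) v = 0 \<Longrightarrow> v = 0"
    by (rule nearby_injective_nn) (rule that)
  \<comment> \<open>With \<open>r / 4\<close> the three components together stay below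
    \<open>r\<close>, as does the image of the full box of unit balls under \<open>l\<close>. The
    bound \<open>\<epsilon>1\<close> isolates \<open>X\<close> in the orbit within
    \<open>hh\<close>, and \<open>\<epsilon>2\<close> allows \<open>nn_transitive\<close> at
    \<open>X + ph x\<close>.\<close>
  define \<epsilon> where "\<epsilon> = min (r / 4) (min \<epsilon>1 \<epsilon>2)"
  have \<epsilon>: "\<epsilon> > 0" "\<epsilon> \<le> r / 4" "\<epsilon> \<le> \<epsilon>1" "\<epsilon> \<le> \<epsilon>2"
    using r(1) \<epsilon>1(1) \<epsilon>2(1) by (simp_all add: \<epsilon>_def)
  define N where "N = {x. norm (pn x) < \<epsilon>} \<inter> {x. norm (pf x) < \<epsilon>} \<inter> {x. norm (ph x) < \<epsilon>}"
  have oN: "open N"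
    unfolding N_def
    by (intro open_Int open_Collect_less continuous_intros bounded_linear.continuous_on[OF bp(1)]
        bounded_linear.continuous_on[OF bp(2)] bounded_linear.continuous_on[OF bp(3)])
  have NU: "N \<subseteq> U'"
  proof
    fix x assume "x \<in> N"
    then have "norm (pn x) + norm (pf x) + norm (ph x) < r"
      using \<epsilon>(2) r(1) by (auto simp: N_def)
    moreover have "norm x \<le> norm (pn x) + norm (pf x) + norm (ph x)"
    proof -
      have "norm (pn x + pf x + ph x) \<le> norm (pn x + pf x) + norm (ph x)" by (rule norm_triangle_ineq)
      moreover have "norm (pn x + pf x) \<le> norm (pn x) + norm (pf x)" by (rule norm_triangle_ineq)
      ultimately show ?thesis unfolding psum[of x, symmetric] by linarith
    qed
    ultimately have "x \<in> ball 0 r" by simp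
    then show "x \<in> U'" using r(2) by blast
  qed
  \<comment> \<open>Undoing \<open>R\<close> and \<open>\<psi>\<close> leaves
    \<open>X + ph x + pn x\<close>. The last term can be removed within the orbit, and then
    \<open>X + ph x\<close> is a point of the orbit in \<open>hh\<close> close to \<open>X\<close>,
    hence equal to \<open>X\<close>.\<close>
  have slice: "ph x = 0" if x: "x \<in> N" "\<Phi> x \<in> orbit" for x
  proof -
    have qx: "X + q x = (X + ph x) + pn x" using psum[of x] by (simp add: q_def algebra_simps)
    define K where "K v = R (\<psi> (pf x) v)" for v
    have K: "K \<in> inner_auts" unfolding K_def by (rule inner_compose[OF R \<psi>(1)])
    have "finv K (\<Phi> x) = X + q x"
      using aut_inv(3)[OF inner_aut[OF K], of "X + q x"] by (simp add: \<Phi>_def K_def)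
    then have o: "(X + ph x) + pn x \<in> orbit" using orbit_inner[OF inner_inv[OF K] x(2)] qx by simp
    have hX: "X + ph x \<in> hh" by (rule subspace_add[OF subspace_hh X_hh pin(3)])
    have nph: "norm (ph x) < \<epsilon>1" "norm (ph x) < \<epsilon>2" using x(1) \<epsilon>(3,4) by (auto simp: N_def)
    have "X + ph x \<in> orbit"
      using X_nn_orbit[OF hX _ pin(1)] \<epsilon>2(2)[OF nph(2)] o by blast
    then obtain S where S: "S \<in> inner_auts" "X + ph x = S X" by (auto simp: orbit_def)
    have "norm (S X - X) < \<epsilon>1" using nph(1) by (simp flip: S(2))
    then have "S X = X" using \<epsilon>1(2)[OF inner_aut[OF S(1)]] hX S(2) by simp
    then show ?thesis using S(2) by simp
  qed
  let ?A = "nn \<inter> ball 0 1" and ?B = "F \<inter> ball 0 1"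
  define l where "l z = \<epsilon> *\<^sub>R (fst z + snd z)" for z :: "(real^'n) \<times> (real^'n)"
  have ll: "linear l"
    unfolding l_def by (simp add: linear_iff scaleR_add_right algebra_simps)
  have bl: "bounded_linear l" using ll by (simp add: linear_conv_bounded_linear)
  define \<phi> where "\<phi> z = \<Phi> (l z)" for z
  have pl: "pn (l (a, b)) = \<epsilon> *\<^sub>R a" "pf (l (a, b)) = \<epsilon> *\<^sub>R b" "ph (l (a, b)) = 0" if "a \<in> nn" "b \<in> F" for a b
    using pnn[OF that(1)] pF[OF that(2)]
    by (simp_all add: l_def linear_scale[OF lp(1)] linear_scale[OF lp(2)] linear_scale[OF lp(3)]
        linear_add[OF lp(1)] linear_add[OF lp(2)] linear_add[OF lp(3)])
  have lN: "l (a, b) \<in> N" if "a \<in> ?A" "b \<in> ?B" for a b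
  proof -
    have "norm (\<epsilon> *\<^sub>R a) < \<epsilon>" "norm (\<epsilon> *\<^sub>R b) < \<epsilon>" using that \<epsilon>(1) by simp_all
    then show ?thesis using pl[of a b] that \<epsilon>(1) by (simp add: N_def)
  qed
  define S where "S b v = R (\<psi> (\<epsilon> *\<^sub>R b) v)" for b v
  have S: "S b \<in> inner_auts" for b
    unfolding S_def by (rule inner_compose[OF R \<psi>(1)])
  have \<phi>_eq: "\<phi> (a, b) = S b (X + \<epsilon> *\<^sub>R a)" if "a \<in> nn" "b \<in> F" for a b
  proof -
    have "q (l (a, b)) = \<epsilon> *\<^sub>R a" using pl[OF that] psum[of "l (a, b)"] by (simp add: q_def)
    then show ?thesis using pl[OF that] by (simp add: \<phi>_def \<Phi>_def S_def)
  qed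
  have plaque: "\<phi> ` (?A \<times> {b}) = plaque (S b) \<epsilon>" if b: "b \<in> ?B" for b
  proof (intro Set.set_eqI iffI)
    fix z assume "z \<in> \<phi> ` (?A \<times> {b})"
    then obtain a where a: "a \<in> ?A" "z = \<phi> (a, b)" by blast
    have "\<epsilon> *\<^sub>R a \<in> nn \<inter> ball 0 \<epsilon>" using a(1) \<epsilon>(1) subspace_scale[OF subspace_nn] by simp
    then show "z \<in> plaque (S b) \<epsilon>" using a b \<phi>_eq[of a b] by (auto simp: plaque_def)
  next
    fix z assume "z \<in> plaque (S b) \<epsilon>"
    then obtain v where v: "v \<in> nn" "norm v < \<epsilon>" "z = S b (X + v)" by (auto simp: plaque_def)
    have "(1 / \<epsilon>) *\<^sub>R v \<in> ?A" using v(1,2) \<epsilon>(1) subspace_scale[OF subspace_nn] by simp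
    moreover have "z = \<phi> ((1 / \<epsilon>) *\<^sub>R v, b)"
      using \<phi>_eq[of "(1 / \<epsilon>) *\<^sub>R v" b] calculation b v(3) \<epsilon>(1) by simp
    ultimately show "z \<in> \<phi> ` (?A \<times> {b})" by blast
  qed
  let ?W = "\<phi> ` (?A \<times> ?B)"
  have W_plaques: "?W = (\<Union>b\<in>?B. plaque (S b) \<epsilon>)"
  proof -
    have "?W = (\<Union>b\<in>?B. \<phi> ` (?A \<times> {b}))" by blast
    then show ?thesis using plaque by simp
  qed
  have g\<phi>: "g (\<phi> (a, b)) = l (a, b)" if "a \<in> ?A" "b \<in> ?B" for a b
    using g\<Phi>(1)[OF subsetD[OF NU lN[OF that]]] by (simp add: \<phi>_def)
  define k where "k y = ((1 / \<epsilon>) *\<^sub>R pn (g y), (1 / \<epsilon>) *\<^sub>R pf (g y))" for y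
  have k\<phi>: "k (\<phi> (a, b)) = (a, b)" if "a \<in> ?A" "b \<in> ?B" for a b
    using g\<phi>[OF that] pl[of a b] that \<epsilon>(1) by (simp add: k_def)
  have W_orbit: "?W = orbit \<inter> \<Phi> ` N"
  proof (intro Set.set_eqI iffI)
    fix z assume z: "z \<in> ?W"
    then obtain b where b: "b \<in> ?B" "z \<in> plaque (S b) \<epsilon>" unfolding W_plaques by blast
    have "z \<in> orbit" by (rule subsetD[OF leaf_orbit[OF S] subsetD[OF plaque_subset_leaf b(2)]])
    moreover obtain a b where "a \<in> ?A" "b \<in> ?B" "z = \<phi> (a, b)" using z by blast
    then have "z \<in> \<Phi> ` N" using lN \<phi>_def by blast
    ultimately show "z \<in> orbit \<inter> \<Phi> ` N" by blast
  next
    fix z assume "z \<in> orbit \<inter> \<Phi> ` N"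
    then obtain x where x: "x \<in> N" "z = \<Phi> x" "\<Phi> x \<in> orbit" by blast
    have ph0: "ph x = 0" by (rule slice[OF x(1,3)])
    let ?a = "(1 / \<epsilon>) *\<^sub>R pn x" and ?b = "(1 / \<epsilon>) *\<^sub>R pf x"
    have "?a \<in> ?A" "?b \<in> ?B"
      using x(1) \<epsilon>(1) pin(1,2)[of x] subspace_scale[OF subspace_nn] subspace_scale[OF sF]
      by (simp_all add: N_def)
    moreover have "l (?a, ?b) = x"
      using psum[of x] ph0 \<epsilon>(1) by (simp add: l_def scaleR_add_right)
    ultimately show "z \<in> ?W" using x(2) by (intro image_eqI[of _ _ "(?a, ?b)"]) (simp_all add: \<phi>_def)
  qed
  have o\<Phi>N: "open (\<Phi> ` N)"
  proof -
    have "openin (top_of_set U') N" using oN NU U'(1) by (simp add: openin_open_eq)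
    then have "openin (top_of_set V) (\<Phi> ` N)" by (rule homeomorphism_imp_open_map[OF U'(5)])
    then show ?thesis using U'(4) by (simp add: openin_open_eq)
  qed
  have smooth\<phi>: "smooth_on (ball 0 1 \<times> ball 0 1) \<phi>"
    unfolding \<phi>_def
  proof (rule smooth_on_compose[OF _ smooth_on_linear[OF ll] smooth\<Phi>])
    show "open (ball (0::real^'n) 1 \<times> ball (0::real^'n) 1)" by (intro open_Times open_ball)
    show "l ` (ball 0 1 \<times> ball 0 1) \<subseteq> O0"
    proof
      fix x assume "x \<in> l ` (ball 0 1 \<times> ball 0 1)"
      then obtain a b where ab: "norm a < 1" "norm b < 1" "x = l (a, b)" by auto
      have "norm (a + b) < 2" using norm_triangle_ineq[of a b] ab(1,2) by linarith
      then have "\<epsilon> * norm (a + b) < \<epsilon> * 2" using \<epsilon>(1) by (rule mult_strict_left_mono)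
      then have "\<epsilon> * norm (a + b) < r" using \<epsilon>(2) r(1) by linarith
      then have "norm x < r" using \<epsilon>(1) ab(3) by (simp add: l_def)
      then show "x \<in> O0" using r(2) U'(2) by auto
    qed
  qed
  have contg: "continuous_on V g" using U'(5) by (simp add: homeomorphism_def)
  have "\<Phi> ` N \<subseteq> V" using NU g\<Phi>(2) by auto
  then have WV: "?W \<subseteq> V" unfolding W_orbit by (rule subset_trans[OF Int_lower2])
  have homeo: "homeomorphic_map (top_of_set (?A \<times> ?B)) (top_of_set ?W) \<phi>"
  proof -
    have "homeomorphic_maps (top_of_set (?A \<times> ?B)) (top_of_set ?W) \<phi> k"
      unfolding homeomorphic_maps_def
    proof (intro conjI ballI)
      have "continuous_on (?A \<times> ?B) \<phi>"
        by (rule continuous_on_subset[OF smooth_on_imp_continuous_on[OF smooth\<phi>]]) auto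
      then show "continuous_map (top_of_set (?A \<times> ?B)) (top_of_set ?W) \<phi>"
        by (simp add: continuous_map_in_subtopology)
      have "continuous_on ?W g" by (rule continuous_on_subset[OF contg WV])
      then have "continuous_on ?W k"
        unfolding k_def
        by (intro continuous_intros bounded_linear.continuous_on[OF bp(1)] bounded_linear.continuous_on[OF bp(2)])
      moreover have "k ` ?W \<subseteq> ?A \<times> ?B"
      proof
        fix z assume "z \<in> k ` ?W"
        then obtain a b where ab: "a \<in> ?A" "b \<in> ?B" "z = k (\<phi> (a, b))" by blast
        have "z = (a, b)" unfolding ab(3) by (rule k\<phi>[OF ab(1,2)])
        then show "z \<in> ?A \<times> ?B" using ab(1,2) by blast
      qed
      ultimately show "continuous_map (top_of_set ?W) (top_of_set (?A \<times> ?B)) k"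
        by (simp only: continuous_map_in_subtopology continuous_map_iff_continuous) (simp add: image_subset_iff_funcset)
      show "k (\<phi> x) = x" if "x \<in> topspace (top_of_set (?A \<times> ?B))" for x
        using that k\<phi>[of "fst x" "snd x"] by (cases x) simp
      show "\<phi> (k y) = y" if y: "y \<in> topspace (top_of_set ?W)" for y
      proof -
        have "y \<in> ?W" using y by simp
        then obtain a b where ab: "a \<in> ?A" "b \<in> ?B" "y = \<phi> (a, b)" by blast
        show ?thesis unfolding ab(3) k\<phi>[OF ab(1,2)] ..
      qed
    qed
    then show ?thesis using homeomorphic_map_maps by blast
  qed
  have inj: "inj_on (frechet_derivative \<phi> (at z)) (nn \<times> F)" if z: "z \<in> ?A \<times> ?B" for z
  proof -
    obtain a b where ab: "z = (a, b)" "a \<in> ?A" "b \<in> ?B" using z by blast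
    have lz: "l z \<in> U'" using lN[OF ab(2,3)] NU ab(1) by blast
    then have lz0: "l z \<in> O0" using U'(2) by blast
    have "(\<phi> has_derivative (\<lambda>h. ?D (l z) (l h))) (at z)"
      unfolding \<phi>_def
      by (rule has_derivative_compose[OF bounded_linear_imp_has_derivative[OF bl] d\<Phi>[OF lz0]])
    then have fd: "frechet_derivative \<phi> (at z) = (\<lambda>h. ?D (l z) (l h))" by (rule frechet_derivative_at[symmetric])
    have "inj (?D (l z))"
      using bij[OF g\<Phi>(2)[OF lz]] by (simp add: g\<Phi>(1)[OF lz] f'[OF lz0] bij_is_inj)
    show ?thesis
      unfolding fd
    proof (rule inj_onI)
      fix h h' assume h: "h \<in> nn \<times> F" "h' \<in> nn \<times> F" "?D (l z) (l h) = ?D (l z) (l h')"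
      then have "l h = l h'" using \<open>inj (?D (l z))\<close> by (simp add: inj_eq)
      moreover obtain a b a' b' where "h = (a, b)" "h' = (a', b')" by (cases h, cases h')
      ultimately show "h = h'"
        using h(1,2) pl[of a b] pl[of a' b'] \<epsilon>(1) by (metis SigmaE2 less_irrefl scaleR_cancel_left)
    qed
  qed
  have pc: "path_component_set (L \<inter> ?W) (\<phi> (a, b)) = \<phi> ` (?A \<times> {b})"
    if L: "L \<in> leaves" and ab: "a \<in> ?A" "b \<in> ?B" and y: "\<phi> (a, b) \<in> L" for L a b
  proof -
    have "plaque (S b) \<epsilon> \<inter> plaque (S b') \<epsilon> = {}" if b: "b \<in> ?B" "b' \<in> ?B" "b \<noteq> b'" for b b'
    proof (rule ccontr)
      assume "plaque (S b) \<epsilon> \<inter> plaque (S b') \<epsilon> \<noteq> {}"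
      then obtain w where "w \<in> \<phi> ` (?A \<times> {b})" "w \<in> \<phi> ` (?A \<times> {b'})"
        unfolding plaque[OF b(1)] plaque[OF b(2)] by blast
      then obtain a a' where aa: "a \<in> ?A" "a' \<in> ?A" "\<phi> (a, b) = \<phi> (a', b')" by auto
      have "(a, b) = k (\<phi> (a, b))" by (rule k\<phi>[OF aa(1) b(1), symmetric])
      also have "\<dots> = (a', b')" unfolding aa(3) by (rule k\<phi>[OF aa(2) b(2)])
      finally show False using b(3) by simp
    qed
    then have "path_component_set (L \<inter> (\<Union>b\<in>?B. plaque (S b) \<epsilon>)) (\<phi> (a, b)) = plaque (S b) \<epsilon>"
    proof (rule path_component_plaque[OF S _ L ab(2) _ y])
      show "\<phi> (a, b) \<in> plaque (S b) \<epsilon>" using plaque[OF ab(2)] ab(1) by blast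
    qed
    then show ?thesis unfolding W_plaques plaque[OF ab(2)] .
  qed
  have "foliated_chart orbit leaves nn F \<phi>"
    unfolding foliated_chart_def Let_def
  proof (intro conjI ballI impI)
    show "openin (top_of_set orbit) ?W" unfolding W_orbit using o\<Phi>N by (rule openin_open_Int)
  qed (use subspace_nn sF smooth\<phi> homeo inj pc in blast)+
  moreover have "R X \<in> ?W"
  proof -
    have "0 \<in> ?A" "0 \<in> ?B" using subspace_0[OF subspace_nn] subspace_0[OF sF] by simp_all
    moreover have "\<phi> (0, 0) = R X"
      using \<phi>_eq[OF subspace_0[OF subspace_nn] subspace_0[OF sF]] \<psi>(2) by (simp add: S_def)
    ultimately show ?thesis by (intro image_eqI[of _ _ "(0, 0)"]) simp_all
  qed
  ultimately show ?thesis by (rule that)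
qed

end

section \<open>Inner automorphisms from the group\<close>

text \<open>The exponential family has the identity as its logarithmic derivative at 0, so
  \<open>aut_open_mapping\<close> applies.\<close>

lemma (in cartan_pair) automorphisms_near_identity_inner:
  obtains \<epsilon> where "\<epsilon> > 0" "\<And>P. aut P \<Longrightarrow> norm (matrix P - matrix (\<lambda>v. v)) < \<epsilon> \<Longrightarrow> P \<in> inner_auts"
proof -
  let ?f = "\<lambda>Y. exp_lin (br Y)"
  have f0: "?f 0 = (\<lambda>v. v)" by (rule ext) (rule exp_lin_br_zero)
  have der: "((\<lambda>Y. ?f Y v) has_derivative (\<lambda>h. ?f 0 (br h v))) (at 0)" for v
    using exp_lin_derivative_0[OF bil, of v] by (simp add: exp_lin_br_zero)
  obtain \<epsilon> where \<epsilon>: "\<epsilon> > 0"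
    "\<And>P. aut P \<Longrightarrow> norm (matrix P - matrix (?f 0)) < \<epsilon> \<Longrightarrow> \<exists>x\<in>UNIV. norm x < 1 \<and> P = ?f x"
    by (rule aut_open_mapping[OF open_UNIV UNIV_I continuous_on_exp_lin[OF bil] aut_exp der
          linear_ident refl zero_less_one]) (rule that)
  have "P \<in> inner_auts" if "aut P" "norm (matrix P - matrix (\<lambda>v. v)) < \<epsilon>" for P
    using \<epsilon>(2)[OF that(1)] that(2) inner_exp unfolding f0 by blast
  then show ?thesis using that \<epsilon>(1) by blast
qed

section \<open>The image of the adjoint representation\<close>

locale lie_group_cartan =
  connected_lie_group_chart G T \<A> U \<phi> + L: cartan_pair "lie_bracket G U \<phi>" \<theta>
  for G :: "('g, 'm) monoid_scheme" (structure) and T \<A>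
    and U :: "'g set" and \<phi> :: "'g \<Rightarrow> real ^ 'n::finite" and \<theta>
begin

lemma aut_Ad:
  assumes "g \<in> carrier G"
  shows "L.aut (Ad' g)"
  unfolding L.aut_def
proof (intro conjI allI)
  show "bij (Ad' g)"
    by (rule o_bij[of "Ad' (inv g)"]) (use Ad_inv[OF assms] in \<open>simp_all add: fun_eq_iff\<close>)
qed (use assms Ad_linear Ad_bracket in auto)

lemma continuous_Ad_sigma: "continuous_on Edom (\<lambda>x. Ad' (\<sigma> x) v)"
  by (rule smooth_on_imp_continuous_on[OF smooth_Ad_sigma])

lemma Ad_x0: "Ad' (\<sigma> x\<^sub>0) = (\<lambda>v. v)"
  by (rule ext) (simp add: sigma_x0 Ad_one)

text \<open>For \<open>g\<close> near the unit, \<open>Ad' g\<close> is an automorphism near the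
  identity and hence inner; connectedness of the group extends this to all \<open>g\<close>.\<close>

lemma Ad_inner:
  assumes "g \<in> carrier G"
  shows "Ad' g \<in> L.inner_auts"
proof -
  obtain \<epsilon> where \<epsilon>: "\<epsilon> > 0"
    "\<And>P. L.aut P \<Longrightarrow> norm (matrix P - matrix (\<lambda>v. v)) < \<epsilon> \<Longrightarrow> P \<in> L.inner_auts"
    by (rule L.automorphisms_near_identity_inner) (rule that)
  have "continuous_on Edom (\<lambda>x. matrix (Ad' (\<sigma> x)))"
    by (rule continuous_on_matrix[OF continuous_Ad_sigma])
  then have "isCont (\<lambda>x. matrix (Ad' (\<sigma> x))) x\<^sub>0"
    using open_Edom x0_Edom by (simp add: continuous_on_eq_continuous_at)
  then obtain d1 where d1: "d1 > 0"
    "\<And>x. dist x x\<^sub>0 < d1 \<Longrightarrow> dist (matrix (Ad' (\<sigma> x))) (matrix (Ad' (\<sigma> x\<^sub>0))) < \<epsilon>"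
    using \<epsilon>(1) unfolding continuous_at_eps_delta by blast
  obtain d2 where d2: "d2 > 0" "ball x\<^sub>0 d2 \<subseteq> Edom" using open_Edom x0_Edom openE by blast
  define d where "d = min d1 d2"
  have d: "d > 0" using d1 d2 by (simp add: d_def)
  define N where "N = {u \<in> U. \<phi> u \<in> ball x\<^sub>0 d}"
  have "openin T N"
  proof -
    have "continuous_map (subtopology T U) (top_of_set D) \<phi>"
      by (rule homeomorphic_imp_continuous_map[OF chart_on(3)])
    moreover have "openin (top_of_set D) (D \<inter> ball x\<^sub>0 d)" by (rule openin_open_Int[OF open_ball])
    ultimately have "openin (subtopology T U) {u \<in> topspace (subtopology T U). \<phi> u \<in> D \<inter> ball x\<^sub>0 d}"
      by (rule openin_continuous_map_preimage)
    moreover have "{u \<in> topspace (subtopology T U). \<phi> u \<in> D \<inter> ball x\<^sub>0 d} = N"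
      using U_carrier by (auto simp: N_def D_def topspace)
    ultimately show ?thesis using openin_trans_full chart_on(1) by metis
  qed
  moreover have "\<one> \<in> N" using one_in d by (simp add: N_def x\<^sub>0_def)
  moreover have "Ad' g \<in> L.inner_auts" if g: "g \<in> N" for g
  proof -
    have gU: "g \<in> U" and b: "dist (\<phi> g) x\<^sub>0 < d" using g by (auto simp: N_def dist_commute)
    have "norm (matrix (Ad' g) - matrix (\<lambda>v. v)) < \<epsilon>"
      using d1(2)[of "\<phi> g"] b sigma_phi[OF gU] by (simp add: d_def Ad_x0 dist_norm)
    then show ?thesis using \<epsilon>(2) aut_Ad gU U_carrier by blast
  qed
  moreover have "Ad' (g \<otimes> h) \<in> L.inner_auts"
    if "g \<in> carrier G" "h \<in> carrier G" "Ad' g \<in> L.inner_auts" "Ad' h \<in> L.inner_auts" for g h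
  proof -
    have "Ad' (g \<otimes> h) = (\<lambda>v. Ad' g (Ad' h v))" by (rule ext) (rule Ad_mult[OF that(1,2)])
    then show ?thesis using L.inner_compose[OF that(3,4)] by simp
  qed
  ultimately show ?thesis by (rule connected_generation[OF conn _ _ _ _ assms])
qed

lemma Ad_image_compose:
  "S \<in> Ad' ` carrier G \<Longrightarrow> R \<in> Ad' ` carrier G \<Longrightarrow> (\<lambda>v. S (R v)) \<in> Ad' ` carrier G"
proof -
  assume "S \<in> Ad' ` carrier G" "R \<in> Ad' ` carrier G"
  then obtain g h where gh: "g \<in> carrier G" "h \<in> carrier G" "S = Ad' g" "R = Ad' h" by blast
  have "(\<lambda>v. S (R v)) = Ad' (g \<otimes> h)" unfolding gh(3,4) by (rule ext) (rule Ad_mult[OF gh(1,2), symmetric])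
  then show ?thesis using gh(1,2) by simp
qed

lemma shifted_derivative: "((\<lambda>b. Ad' (\<sigma> (x\<^sub>0 + b)) v) has_derivative (\<lambda>b. br b v)) (at 0)"
proof -
  have "((\<lambda>b. x\<^sub>0 + b) has_derivative (\<lambda>b. b)) (at 0)"
    by (auto intro!: derivative_eq_intros)
  from has_derivative_compose[OF this, of "\<lambda>x. Ad' (\<sigma> x) v" "\<lambda>b. br b v"]
  show ?thesis using bracket_derivative by simp
qed

text \<open>Here the chart supplies the family for \<open>aut_open_mapping\<close>, so the image of
  \<open>Ad'\<close> contains every automorphism near the identity.\<close>

lemma exp_Ad_image: "exp_lin (br Y) \<in> Ad' ` carrier G"
proof -
  let ?S = "{b. x\<^sub>0 + b \<in> Edom}" and ?f = "\<lambda>b. Ad' (\<sigma> (x\<^sub>0 + b))"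
  have oS: "open ?S"
  proof -
    have "open ((\<lambda>b. x\<^sub>0 + b) -` Edom)"
      by (rule open_vimage[OF open_Edom]) (intro continuous_intros)
    then show ?thesis by (simp add: vimage_def)
  qed
  have zS: "0 \<in> ?S" using x0_Edom by simp
  have cont: "continuous_on ?S (\<lambda>b. ?f b v)" for v
    by (rule continuous_on_compose2[OF continuous_Ad_sigma]) (auto intro!: continuous_intros)
  have aut: "L.aut (?f b)" if "b \<in> ?S" for b
    using that by (intro aut_Ad sigma_carrier Edom_D) simp
  have f0: "?f 0 = (\<lambda>v. v)" by (simp add: Ad_x0)
  have der: "((\<lambda>b. ?f b v) has_derivative (\<lambda>h. ?f 0 (br h v))) (at 0)" for v
    using shifted_derivative by (simp add: Ad_x0)
  obtain \<epsilon> where \<epsilon>: "\<epsilon> > 0"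
    "\<And>P. L.aut P \<Longrightarrow> norm (matrix P - matrix (?f 0)) < \<epsilon> \<Longrightarrow> \<exists>b\<in>?S. norm b < 1 \<and> P = ?f b"
    by (rule L.aut_open_mapping[OF oS zS cont aut der linear_ident refl zero_less_one])
      (assumption, rule that)
  have near: "P \<in> Ad' ` carrier G" if P: "L.aut P" "norm (matrix P - matrix (\<lambda>v. v)) < \<epsilon>" for P
  proof -
    obtain b where "b \<in> ?S" "P = ?f b" using \<epsilon>(2)[OF P(1)] P(2) unfolding f0 by blast
    then show ?thesis using sigma_carrier Edom_D by blast
  qed
  have "continuous_on UNIV (\<lambda>t. matrix (L.eprod [Y] t))"
    by (rule continuous_on_matrix[OF L.continuous_eprod])
  then have "isCont (\<lambda>t. matrix (L.eprod [Y] t)) 0" by (simp add: continuous_on_eq_continuous_at)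
  then obtain d where d: "d > 0"
    "\<And>t. dist t 0 < d \<Longrightarrow> dist (matrix (L.eprod [Y] t)) (matrix (L.eprod [Y] 0)) < \<epsilon>"
    using \<epsilon>(1) unfolding continuous_at_eps_delta by blast
  have e: "L.eprod [Y] t = exp_lin (br (t *\<^sub>R Y))" for t
    by (rule ext) (simp add: L.exp_lin_scaleR)
  have e0: "exp_lin (br (0 *\<^sub>R Y)) = (\<lambda>v. v)" by (rule ext) (simp add: L.exp_lin_br_zero)
  \<comment> \<open>The exponential of \<open>Y\<close> is a power of the exponential of
    \<open>Y / (n + 1)\<close>, which is close to the identity for large \<open>n\<close>.\<close>
  obtain n where n: "inverse (real (Suc n)) < d" using reals_Archimedean[OF d(1)] by blast
  let ?t = "inverse (real (Suc n))"
  have small: "exp_lin (br (?t *\<^sub>R Y)) \<in> Ad' ` carrier G"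
  proof (rule near[OF L.aut_exp])
    show "norm (matrix (exp_lin (br (?t *\<^sub>R Y))) - matrix (\<lambda>v. v)) < \<epsilon>"
      using d(2)[of ?t] n unfolding e e0 by (simp add: dist_norm)
  qed
  have "exp_lin (br ((real k * ?t) *\<^sub>R Y)) \<in> Ad' ` carrier G" for k
  proof (induction k)
    case 0
    have "Ad' \<one> = (\<lambda>v. v)" by (rule ext) (rule Ad_one)
    then have "(\<lambda>v. v) \<in> Ad' ` carrier G" by (metis image_eqI one_closed)
    then show ?case using e0 by simp
  next
    case (Suc k)
    have "exp_lin (br ((real (Suc k) * ?t) *\<^sub>R Y)) =
        (\<lambda>v. exp_lin (br ((real k * ?t) *\<^sub>R Y)) (exp_lin (br (?t *\<^sub>R Y)) v))"
    proof
      fix v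
      have "real (Suc k) * ?t = real k * ?t + ?t" by (simp only: of_nat_Suc) (simp only: distrib_right mult_1)
      then show "exp_lin (br ((real (Suc k) * ?t) *\<^sub>R Y)) v =
          exp_lin (br ((real k * ?t) *\<^sub>R Y)) (exp_lin (br (?t *\<^sub>R Y)) v)"
        by (simp only: L.exp_lin_br_add)
    qed
    then show ?case using Ad_image_compose[OF Suc small] by simp
  qed
  from this[of "Suc n"] show ?thesis by simp
qed

lemma Ad_image: "Ad' ` carrier G = L.inner_auts"
proof
  show "Ad' ` carrier G \<subseteq> L.inner_auts" using Ad_inner by blast
  have "L.eprod Ys 1 \<in> Ad' ` carrier G" for Ys
  proof (induction Ys)
    case Nil
    have "L.eprod [] 1 = Ad' \<one>" by (rule ext) (simp add: Ad_one)
    then show ?case by simp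
  next
    case (Cons Y Ys)
    have "L.eprod (Y # Ys) 1 = (\<lambda>v. exp_lin (br Y) (L.eprod Ys 1 v))" by (rule ext) simp
    then show ?case using Ad_image_compose[OF exp_Ad_image Cons] by simp
  qed
  then show "L.inner_auts \<subseteq> Ad' ` carrier G" by (auto simp: L.inner_auts_def)
qed

lemma inner_family:
  obtains \<psi> \<rho> where "\<And>b. \<psi> b \<in> L.inner_auts" "\<And>v. \<psi> 0 v = v"
    "\<rho> > 0" "\<And>v. smooth_on (ball 0 \<rho>) (\<lambda>b. \<psi> b v)"
    "\<And>v. ((\<lambda>b. \<psi> b v) has_derivative (\<lambda>b. br b v)) (at 0)"
proof -
  \<comment> \<open>The chart provides a family whose smoothness comes from the Lie group structure.
    Away from the unit it is replaced by the identity, so that every value is inner.\<close>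
  define \<psi> where "\<psi> b = (if x\<^sub>0 + b \<in> Edom then Ad' (\<sigma> (x\<^sub>0 + b)) else (\<lambda>v. v))" for b
  obtain \<rho> where \<rho>: "\<rho> > 0" "ball x\<^sub>0 \<rho> \<subseteq> Edom" using open_Edom x0_Edom openE by blast
  have shift: "x\<^sub>0 + b \<in> Edom" if "b \<in> ball 0 \<rho>" for b
    using that \<rho>(2) by (auto simp: dist_norm subset_iff)
  show ?thesis
  proof (rule that[of \<psi> \<rho>])
    show "\<psi> b \<in> L.inner_auts" for b
      using Ad_inner[OF sigma_carrier[OF Edom_D]] L.identity_inner by (simp add: \<psi>_def)
    show "\<psi> 0 v = v" for v by (simp add: \<psi>_def Ad_x0)
    show "smooth_on (ball 0 \<rho>) (\<lambda>b. \<psi> b v)" for v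
    proof (rule smooth_on_cong[OF open_ball])
      show "smooth_on (ball 0 \<rho>) (\<lambda>b. Ad' (\<sigma> (x\<^sub>0 + b)) v)"
      proof (rule smooth_on_compose[OF open_ball _ smooth_Ad_sigma])
        show "smooth_on (ball 0 \<rho>) (\<lambda>b. x\<^sub>0 + b)"
          by (rule smooth_on_add[OF smooth_on_const smooth_on_linear[OF linear_ident]])
        show "(\<lambda>b. x\<^sub>0 + b) ` ball 0 \<rho> \<subseteq> Edom" using shift by blast
      qed
    qed (simp add: \<psi>_def shift)
    show "((\<lambda>b. \<psi> b v) has_derivative (\<lambda>b. br b v)) (at 0)" for v
      by (rule has_derivative_transform_within_open[OF shifted_derivative open_ball[of 0 \<rho>]])
        (use \<rho>(1) shift in \<open>simp_all add: \<psi>_def\<close>)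
  qed (rule \<rho>(1))
qed

end

theorem theorem3p1:
  fixes G :: "('g, 'm) monoid_scheme"
    and T :: "'g topology"
    and \<A> :: "('g set \<times> ('g \<Rightarrow> real ^ 'n::finite)) set"
    and U\<^sub>0 :: "'g set" and \<phi>\<^sub>0 :: "'g \<Rightarrow> real ^ 'n"
    and AdG :: "'g \<Rightarrow> real ^ 'n \<Rightarrow> real ^ 'n"
    and br :: "real ^ 'n \<Rightarrow> real ^ 'n \<Rightarrow> real ^ 'n"
    and \<theta> :: "real ^ 'n \<Rightarrow> real ^ 'n"
    and X :: "real ^ 'n"
    and \<aa> \<nn> \<Omega> :: "(real ^ 'n) set"
    and \<Sigma>p :: "(real ^ 'n \<Rightarrow> real) set"
  assumes G: "lie_group G T \<A>" "connected_space T" "\<not> compact_space T"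
    and unit_chart: "(U\<^sub>0, \<phi>\<^sub>0) \<in> \<A>" "\<one>\<^bsub>G\<^esub> \<in> U\<^sub>0"
    and AdG: "AdG = Ad G U\<^sub>0 \<phi>\<^sub>0"
    and br: "br = lie_bracket G U\<^sub>0 \<phi>\<^sub>0"
    and semisimple: "semisimple_algebra br"
    and \<theta>: "cartan_involution br \<theta>"
    and X: "regular_element br X" "maximally_noncompact br \<theta> (stabilizer_algebra br X)"
    and \<aa>: "\<aa> = stabilizer_algebra br X \<inter> minus_eigenspace \<theta>"
    and \<Sigma>p: "positive_restricted_roots br \<aa> \<Sigma>p"
    and \<nn>: "\<nn> = nilpotent_part br \<aa> \<Sigma>p"
    and \<Omega>: "\<Omega> = adjoint_orbit G AdG X"
  shows "\<nn> \<inter> stabilizer_algebra br X = {0} \<and>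
    (\<exists>\<N>. foliation (dim \<nn>) \<Omega> \<N> \<and> left_invariant_foliation G AdG \<Omega> \<N>
       \<and> isotropic_foliation br \<Omega> \<N> \<and> leaf_tangent \<N> X = (\<lambda>U. br U X) ` \<nn>)"
proof -
  interpret C: connected_lie_group_chart G T \<A> U\<^sub>0 \<phi>\<^sub>0
    by unfold_locales (use G unit_chart in auto)
  have algebra: "bilinear br" "\<And>u. br u u = 0"
    "\<And>u v w. br w (br u v) = br (br w u) v + br u (br w v)"
    unfolding br by (rule C.bilinear_bracket C.bracket_self C.jacobi_bracket)+
  have cartan: "theta_stable_cartan br \<theta> (stabilizer_algebra br X)"
    using X(2) by (simp add: maximally_noncompact_def)
  interpret A: theta_cartan_roots br \<theta> X \<Sigma>p
    by unfold_locales (fact algebra \<theta> cartan \<Sigma>p[unfolded \<aa>])+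
  interpret D: lie_group_cartan G T \<A> U\<^sub>0 \<phi>\<^sub>0 \<theta>
    by unfold_locales (fact algebra[unfolded br] \<theta>[unfolded br])+
  \<comment> \<open>\<open>D\<close> concerns the bracket of the group and \<open>A\<close> its name
    \<open>br\<close>; identifying their inner automorphisms transfers the facts about
    \<open>Ad\<close>.\<close>
  have inner: "D.L.inner_auts = A.inner_auts" by (simp only: br)
  have nn: "\<nn> = A.nn" by (simp add: \<nn> \<aa> A.nn_def A.aa_def)
  have image: "AdG ` carrier G = A.inner_auts" using D.Ad_image by (simp add: AdG br)
  have orbit: "\<Omega> = A.orbit"
    unfolding \<Omega> adjoint_orbit_def A.orbit_def image[symmetric] image_image ..
  obtain \<psi> \<rho> where family: "\<And>b. \<psi> b \<in> D.L.inner_auts" "\<And>v. \<psi> 0 v = v"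
    "\<rho> > 0" "\<And>v. smooth_on (ball 0 \<rho>) (\<lambda>b. \<psi> b v)"
    "\<And>v. ((\<lambda>b. \<psi> b v) has_derivative (\<lambda>b. lie_bracket G U\<^sub>0 \<phi>\<^sub>0 b v)) (at 0)"
    by (rule D.inner_family) (rule that)
  have \<psi>: "\<psi> b \<in> A.inner_auts"
    "((\<lambda>b. \<psi> b v) has_derivative (\<lambda>b. br b v)) (at 0)" for b v
    using family(1)[of b] family(5)[of v] unfolding inner by (simp_all only: br)
  have "A.nn \<inter> A.hh = {0}"
    using A.nn_hh A.subspace_nn A.subspace_hh by (auto simp: subspace_0)
  then have 1: "\<nn> \<inter> stabilizer_algebra br X = {0}" by (simp add: nn A.hh_def)
  have 2: "foliation (dim \<nn>) \<Omega> A.leaves"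
    unfolding foliation_def
  proof (intro conjI ballI)
    show "partition_on \<Omega> A.leaves" unfolding orbit by (rule A.partition_leaves)
    show "path_connected L" if "L \<in> A.leaves" for L using that by (rule A.path_connected_leaf)
    fix y assume "y \<in> \<Omega>"
    then obtain R where R: "R \<in> A.inner_auts" "y = R X" unfolding orbit A.orbit_def by blast
    obtain F \<phi> where "foliated_chart A.orbit A.leaves A.nn F \<phi>"
      "R X \<in> \<phi> ` ((A.nn \<inter> ball 0 1) \<times> (F \<inter> ball 0 1))"
      by (rule A.foliated_chart_exists[OF \<psi>(1) family(2-4) \<psi>(2) R(1)]) (rule that)
    then show "\<exists>E F \<phi>. foliated_chart \<Omega> A.leaves E F \<phi> \<and> dim E = dim \<nn> \<and>
        y \<in> \<phi> ` ((E \<inter> ball 0 1) \<times> (F \<inter> ball 0 1))"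
      unfolding orbit R(2) nn by blast
  qed
  have 3: "left_invariant_foliation G AdG \<Omega> A.leaves"
    unfolding left_invariant_foliation_def
  proof (intro ballI)
    fix g y assume g: "g \<in> carrier G" and "y \<in> \<Omega>"
    then obtain S where S: "S \<in> A.inner_auts" "y = S X" unfolding orbit A.orbit_def by blast
    have "AdG g \<in> A.inner_auts" using g image by blast
    then have K: "(\<lambda>v. AdG g (S v)) \<in> A.inner_auts" using S(1) by (rule A.inner_compose)
    show "leaf_tangent A.leaves (AdG g y) = AdG g ` leaf_tangent A.leaves y"
      unfolding S(2) A.leaf_tangent_leaves[OF S(1)] A.leaf_tangent_leaves[OF K] image_image ..
  qed
  have 4: "isotropic_foliation br \<Omega> A.leaves" unfolding orbit by (rule A.isotropic_leaves)
  have 5: "leaf_tangent A.leaves X = (\<lambda>U. br U X) ` \<nn>"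
  proof -
    \<comment> \<open>The tangent space to the leaf at \<open>X\<close> is \<open>A.nn\<close>
      itself. It agrees with the space of vectors \<open>br U X\<close> because \<open>br X\<close>
      maps \<open>A.nn\<close> bijectively onto itself.\<close>
    have "(\<lambda>U. br U X) ` A.nn = A.nn"
    proof (rule linear_inj_on_subspace_surj[OF A.linear_br_left A.subspace_nn])
      fix w assume w: "w \<in> A.nn"
      have e: "br w X = - br X w" by (rule A.br_anticommute)
      show "br w X \<in> A.nn"
        unfolding e by (rule subspace_neg[OF A.subspace_nn A.br_hh_nn[OF A.X_hh w]])
      show "w = 0" if "br w X = 0" using A.X_injective_nn[OF w] e that by simp
    qed
    then show ?thesis using A.leaf_tangent_leaves[OF A.identity_inner] by (simp add: nn)
  qed
  show ?thesis using 1 2 3 4 5 by blast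
qed

end
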